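(* Let $\gamma>1$ and $K\in\mathbb{R}$, and consider the two-sided sonic configuration $(\Omega^\pm,\varphi^\pm,\Gamma_{\rm sonic})$ described in the context. Assume that the sonic curve $\Gamma_{\rm sonic}$ is connected. Then: (i) A sonic point $Q\in\Gamma_{\rm sonic}$ is exceptional if and only if $\partial_{\boldsymbol\tau}c(Q)=0$ or $c(Q)=0$. (ii) If all sonic points are exceptional and $c>0$ on $\Gamma_{\rm sonic}$, then $c=c_2$ on $\Gamma_{\rm sonic}$ for some constant $c_2$, and $\Gamma_{\rm sonic}$ lies on a circle of radius $c_2$. (iii) There exists a local solution whose sonic curve lies on a circle and all of whose sonic points are non-exceptional.
   Context: Equation. Fix $\gamma>1$ and $K\in\mathbb{R}$. In coordinates $(\xi,\eta)\in\mathbb{R}^2$, with $D=(\partial_\xi,\partial_\eta)$, self-similar potential flow is $\mathrm{div}(\rho D\varphi)+2\rho=0$ with $\rho=(K-\varphi-\frac12|D\varphi|^2)^{1/(\gamma-1)}$. The sonic speed $c\ge 0$ is given by $c^2=(\gamma-1)(K-\varphi-\frac12|D\varphi|^2)$. The pseudo-velocity is $(U,V)=D\varphi$ and the velocity is $(u,v)=(U,V)+(\xi,\eta)$. Equivalently, $(c^2-U^2)u_\xi-UV(u_\eta+v_\xi)+(c^2-V^2)v_\eta=0$, $u_\eta=v_\xi$, and $\frac{c^2}{\gamma-1}+\frac{U^2+V^2}{2}+\varphi=K$. The solution is (pseudo-)supersonic where $|D\varphi|>c$, (pseudo-)subsonic where $|D\varphi|<c$, and a point is (pseudo-)sonic if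 $|D\varphi|=c$. Configuration. $\Omega^-$ and $\Omega^+$ are the supersonic and subsonic regions, lying on the two sides of the curve formed by all sonic points; $\Gamma_{\rm sonic}$ denotes the relative interior of that curve. $\varphi^-\in C^2(\overline{\Omega^-})$ is a supersonic solution in $\Omega^-$, $\varphi^+\in C^2(\Omega^+\cup\Gamma_{\rm sonic})$ is a subsonic solution in $\Omega^+$, and $\varphi^+=\varphi^-$, $D\varphi^+=D\varphi^-$ on $\Gamma_{\rm sonic}$. Write $\varphi=\varphi^\pm$ on the respective sides. For each $Q\in\Gamma_{\rm sonic}$, in suitable (rotated) coordinates $(\xi,\eta)$ (the equations are invariant under rotation) there is $r>0$ such that $\Gamma_{\rm sonic}\cap B_r(Q)=\{\eta=f(\xi)\}\cap B_r(Q)$ with $f\in C^{1,1}((l_1,l_2))$, $l_1<l_2$. Notation. $\partial_{\boldsymbol\tau}=\partial_\xi+f'(\xi)\partial_\eta$ is the tangential derivative along $\Gamma_{\rm sonic}$. A point $(\xi,f(\xi))\in\Gamma_{\rm sonic}$ is called exceptional if $(U,V)(\xi,f(\xi))$ is normal to $\Gamma_{\rm sonic}$ there, i.e. $U+f'(\xi)V=0$ (the zero vector counts as normal). In (iii), a "local solution" is a solution of the self-similar potential flow equation $\mathrm{div}(\rho D\varphi)+2\rho=0$ with $\rho=(K-\varphi-\frac12|D\varphi|^2)^{1/(\gamma-1)}$ (equivalently, of the system $(c^2-U^2)u_\xi-UV(u_\eta+v_\xi)+(c^2-V^2)v_\eta=0$, $u_\eta=v_\xi$, $\frac{c^2}{\gamma-1}+\frac{U^2+V^2}{2}+\varphi=K$)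 defined in a neighborhood of its sonic curve, supersonic on one side of the curve and subsonic on the other. *)

theory Defs
  imports "HOL-Analysis.Analysis"
begin

type_synonym plane = "real \<times> real"

text \<open>Throughout, \<open>\<phi>\<close> is the pseudo-potential and \<open>g\<close> its gradient \<open>D\<phi> = (U, V)\<close>. The gradient is
  carried along explicitly because on the sonic curve \<open>D\<phi>\<close> means the continuous extension of the
  gradient from one side.\<close>

text \<open>\<open>\<phi> \<in> C\<^sup>2(S)\<close> for an open set \<open>\<Omega> \<subseteq> S \<subseteq> closure \<Omega>\<close>: \<open>\<phi>\<close> is \<open>C\<^sup>2\<close> in \<open>\<Omega>\<close>, and \<open>\<phi>\<close>, \<open>D\<phi> = g\<close> and
  \<open>D\<^sup>2\<phi>\<close> extend continuously to \<open>S\<close>.  The inclusions determine \<open>g\<close> on \<open>S\<close> uniquely.\<close>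

definition C2_upto :: "plane set \<Rightarrow> plane set \<Rightarrow> (plane \<Rightarrow> real) \<Rightarrow> (plane \<Rightarrow> plane) \<Rightarrow> bool" where
  "C2_upto \<Omega> S \<phi> g \<longleftrightarrow>
     open \<Omega> \<and> \<Omega> \<subseteq> S \<and> S \<subseteq> closure \<Omega> \<and>
     continuous_on S \<phi> \<and> continuous_on S g \<and> (\<forall>x\<in>\<Omega>. GDERIV \<phi> x :> g x) \<and>
     (\<exists>H :: plane \<Rightarrow> plane \<Rightarrow>\<^sub>L plane.
        continuous_on S H \<and> (\<forall>x\<in>\<Omega>. (g has_derivative blinfun_apply (H x)) (at x)))"

definition has_divergence :: "(plane \<Rightarrow> plane) \<Rightarrow> real \<Rightarrow> plane \<Rightarrow> bool" where
  "has_divergence F d x \<longleftrightarrow>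
     (\<exists>F'. (F has_derivative F') (at x) \<and> d = (\<Sum>b\<in>Basis. F' b \<bullet> b))"

text \<open>\<open>head K \<phi> g = K - \<phi> - |D\<phi>|\<^sup>2/2\<close> has to be nonnegative for the density and the sonic speed
  to be meaningful; this is required in \<open>potential_flow\<close>.  At a point where \<open>norm (g x) = sonic_speed \<gamma> K \<phi> g x\<close>
  or \<open>norm (g x) < sonic_speed \<gamma> K \<phi> g x\<close> it is automatic, as \<open>sqrt\<close> is odd.\<close>

definition head :: "real \<Rightarrow> (plane \<Rightarrow> real) \<Rightarrow> (plane \<Rightarrow> plane) \<Rightarrow> plane \<Rightarrow> real" where
  "head K \<phi> g x = K - \<phi> x - (norm (g x))\<^sup>2 / 2"

definition density :: "real \<Rightarrow> real \<Rightarrow> (plane \<Rightarrow> real) \<Rightarrow> (plane \<Rightarrow> plane) \<Rightarrow> plane \<Rightarrow> real" where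
  "density \<gamma> K \<phi> g x = head K \<phi> g x powr (1 / (\<gamma> - 1))"

definition sonic_speed :: "real \<Rightarrow> real \<Rightarrow> (plane \<Rightarrow> real) \<Rightarrow> (plane \<Rightarrow> plane) \<Rightarrow> plane \<Rightarrow> real" where
  "sonic_speed \<gamma> K \<phi> g x = sqrt ((\<gamma> - 1) * head K \<phi> g x)"

text \<open>\<open>div(\<rho> D\<phi>) + 2 \<rho> = 0\<close> in the classical sense, for \<open>\<phi>\<close> of class \<open>C\<^sup>2\<close> with gradient \<open>g\<close>.\<close>

definition potential_flow :: "real \<Rightarrow> real \<Rightarrow> plane set \<Rightarrow> (plane \<Rightarrow> real) \<Rightarrow> (plane \<Rightarrow> plane) \<Rightarrow> bool" where
  "potential_flow \<gamma> K \<Omega> \<phi> g \<longleftrightarrow>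
     (\<forall>x\<in>\<Omega>. 0 \<le> head K \<phi> g x \<and>
        has_divergence (\<lambda>y. density \<gamma> K \<phi> g y *\<^sub>R g y) (- 2 * density \<gamma> K \<phi> g x) x)"

definition supersonic :: "real \<Rightarrow> real \<Rightarrow> (plane \<Rightarrow> real) \<Rightarrow> (plane \<Rightarrow> plane) \<Rightarrow> plane \<Rightarrow> bool" where
  "supersonic \<gamma> K \<phi> g x \<longleftrightarrow> norm (g x) > sonic_speed \<gamma> K \<phi> g x"

definition subsonic :: "real \<Rightarrow> real \<Rightarrow> (plane \<Rightarrow> real) \<Rightarrow> (plane \<Rightarrow> plane) \<Rightarrow> plane \<Rightarrow> bool" where
  "subsonic \<gamma> K \<phi> g x \<longleftrightarrow> norm (g x) < sonic_speed \<gamma> K \<phi> g x"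

definition sonic :: "real \<Rightarrow> real \<Rightarrow> (plane \<Rightarrow> real) \<Rightarrow> (plane \<Rightarrow> plane) \<Rightarrow> plane \<Rightarrow> bool" where
  "sonic \<gamma> K \<phi> g x \<longleftrightarrow> norm (g x) = sonic_speed \<gamma> K \<phi> g x"

text \<open>\<open>rot \<theta> (\<xi>, \<eta>)\<close> is the point (or vector) with coordinates \<open>(\<xi>, \<eta>)\<close> in the frame rotated by \<open>\<theta>\<close>;
  \<open>rot (-\<theta>)\<close> recovers the rotated coordinates.\<close>

definition rot :: "real \<Rightarrow> plane \<Rightarrow> plane" where
  "rot \<theta> p = (cos \<theta> * fst p - sin \<theta> * snd p, sin \<theta> * fst p + cos \<theta> * snd p)"

text \<open>\<open>C\<^sup>1\<^sup>,\<^sup>1\<close> of an open interval is the local space: \<open>f'\<close> is locally Lipschitz.\<close>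

definition C11_on :: "real \<Rightarrow> real \<Rightarrow> (real \<Rightarrow> real) \<Rightarrow> bool" where
  "C11_on l1 l2 f \<longleftrightarrow>
     (\<forall>t\<in>{l1<..<l2}. f differentiable (at t)) \<and>
     (\<forall>t\<in>{l1<..<l2}. \<exists>\<epsilon>>0. \<exists>L. L-lipschitz_on ({l1<..<l2} \<inter> ball t \<epsilon>) (deriv f))"

definition curve_chart ::
  "plane set \<Rightarrow> plane \<Rightarrow> real \<Rightarrow> (real \<Rightarrow> real) \<Rightarrow> real \<Rightarrow> real \<Rightarrow> real \<Rightarrow> bool" where
  "curve_chart \<Gamma> Q \<theta> f l1 l2 r \<longleftrightarrow>
     l1 < l2 \<and> C11_on l1 l2 f \<and> r > 0 \<and>
     \<Gamma> \<inter> ball Q r = {rot \<theta> (t, f t) |t. l1 < t \<and> t < l2} \<inter> ball Q r"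

definition above_graph :: "real \<Rightarrow> (real \<Rightarrow> real) \<Rightarrow> real \<Rightarrow> real \<Rightarrow> plane set" where
  "above_graph \<theta> f l1 l2 = {rot \<theta> (t, s) |t s. l1 < t \<and> t < l2 \<and> f t < s}"

definition below_graph :: "real \<Rightarrow> (real \<Rightarrow> real) \<Rightarrow> real \<Rightarrow> real \<Rightarrow> plane set" where
  "below_graph \<theta> f l1 l2 = {rot \<theta> (t, s) |t s. l1 < t \<and> t < l2 \<and> s < f t}"

definition on_two_sides ::
  "plane set \<Rightarrow> plane set \<Rightarrow> plane \<Rightarrow> real \<Rightarrow> (real \<Rightarrow> real) \<Rightarrow> real \<Rightarrow> real \<Rightarrow> real \<Rightarrow> bool" where
  "on_two_sides \<Omega>1 \<Omega>2 Q \<theta> f l1 l2 r \<longleftrightarrow>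
     \<Omega>1 \<inter> ball Q r = above_graph \<theta> f l1 l2 \<inter> ball Q r \<and>
     \<Omega>2 \<inter> ball Q r = below_graph \<theta> f l1 l2 \<inter> ball Q r"

text \<open>The flow region is \<open>\<Omega>m \<union> \<Gamma> \<union> \<Omega>p\<close>; \<open>\<Gamma>\<close> is exactly the set of its sonic points.  This set
  is open, so possible end points of the sonic curve lie on its boundary, and \<open>\<Gamma>\<close> is the curve
  without end points.\<close>

definition sonic_configuration ::
  "real \<Rightarrow> real \<Rightarrow> plane set \<Rightarrow> plane set \<Rightarrow> plane set \<Rightarrow> (plane \<Rightarrow> real) \<Rightarrow> (plane \<Rightarrow> real) \<Rightarrow>
   (plane \<Rightarrow> plane) \<Rightarrow> (plane \<Rightarrow> plane) \<Rightarrow> bool" where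
  "sonic_configuration \<gamma> K \<Omega>m \<Omega>p \<Gamma> \<phi>m \<phi>p gm gp \<longleftrightarrow>
     \<Omega>m \<inter> \<Omega>p = {} \<and>
     C2_upto \<Omega>m (closure \<Omega>m) \<phi>m gm \<and> C2_upto \<Omega>p (\<Omega>p \<union> \<Gamma>) \<phi>p gp \<and>
     potential_flow \<gamma> K \<Omega>m \<phi>m gm \<and> potential_flow \<gamma> K \<Omega>p \<phi>p gp \<and>
     (\<forall>x\<in>\<Omega>m. supersonic \<gamma> K \<phi>m gm x) \<and> (\<forall>x\<in>\<Omega>p. subsonic \<gamma> K \<phi>p gp x) \<and>
     (\<forall>x\<in>\<Gamma>. \<phi>p x = \<phi>m x \<and> gp x = gm x \<and> sonic \<gamma> K \<phi>p gp x) \<and>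
     (\<forall>Q\<in>\<Gamma>. \<exists>\<theta> f l1 l2 r. curve_chart \<Gamma> Q \<theta> f l1 l2 r \<and>
        (on_two_sides \<Omega>p \<Omega>m Q \<theta> f l1 l2 r \<or> on_two_sides \<Omega>m \<Omega>p Q \<theta> f l1 l2 r))"

text \<open>\<open>U + f' V = 0\<close> at \<open>Q\<close>, where \<open>(U, V)\<close> are the components of \<open>g Q\<close> in the rotated coordinates
  of a chart.  The tangent line does not depend on the chart, so neither does the condition.\<close>

definition exceptional :: "plane set \<Rightarrow> (plane \<Rightarrow> plane) \<Rightarrow> plane \<Rightarrow> bool" where
  "exceptional \<Gamma> g Q \<longleftrightarrow>
     (\<exists>\<theta> f l1 l2 r. curve_chart \<Gamma> Q \<theta> f l1 l2 r \<and>
        fst (rot (-\<theta>) (g Q)) + deriv f (fst (rot (-\<theta>) Q)) * snd (rot (-\<theta>) (g Q)) = 0)"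

text \<open>\<open>\<partial>\<^sub>\<tau> h (Q) = d\<close> for \<open>\<partial>\<^sub>\<tau> = \<partial>\<^sub>\<xi> + f' \<partial>\<^sub>\<eta>\<close>, i.e. the derivative of \<open>h\<close> along the graph with
  respect to \<open>\<xi>\<close>.  Only the values of \<open>h\<close> on the curve enter: \<open>h\<close> may have different normal
  derivatives on the two sides.\<close>

definition has_tangential_derivative ::
  "real \<Rightarrow> (real \<Rightarrow> real) \<Rightarrow> (plane \<Rightarrow> real) \<Rightarrow> real \<Rightarrow> plane \<Rightarrow> bool" where
  "has_tangential_derivative \<theta> f h d Q \<longleftrightarrow>
     ((\<lambda>t. h (rot \<theta> (t, f t))) has_real_derivative d) (at (fst (rot (-\<theta>) Q)))"

text \<open>A solution in an open neighbourhood \<open>N\<close> of its sonic curve \<open>\<Gamma>\<close> with the supersonic and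
  the subsonic part on the two sides of \<open>\<Gamma>\<close>.\<close>

definition local_solution ::
  "real \<Rightarrow> real \<Rightarrow> plane set \<Rightarrow> plane set \<Rightarrow> (plane \<Rightarrow> real) \<Rightarrow> (plane \<Rightarrow> plane) \<Rightarrow> bool" where
  "local_solution \<gamma> K N \<Gamma> \<phi> g \<longleftrightarrow>
     C2_upto N N \<phi> g \<and> potential_flow \<gamma> K N \<phi> g \<and>
     \<Gamma> = {x \<in> N. sonic \<gamma> K \<phi> g x} \<and> \<Gamma> \<noteq> {} \<and> connected \<Gamma> \<and>
     sonic_configuration \<gamma> K {x \<in> N. supersonic \<gamma> K \<phi> g x} {x \<in> N. subsonic \<gamma> K \<phi> g x} \<Gamma> \<phi> \<phi> g g"

end

theory Submission
  imports Defs
begin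

text \<open>On the sonic curve Bernoulli's law reads \<open>c\<^sup>2 = |D\<phi>|\<^sup>2 = \<kappa> (K - \<phi>)\<close> with \<open>\<kappa> = 2 (\<gamma> - 1) / (\<gamma> + 1)\<close>, so the
  tangential derivative of \<open>c\<^sup>2\<close> is \<open>- \<kappa> D\<phi> \<sqdot> \<tau>\<close>, which is (i).  If all points are exceptional, then \<open>\<phi>\<close> and
  hence \<open>|D\<phi>| = c\<close> are constant along the curve, so \<open>D\<phi> \<sqdot> (D\<^sup>2\<phi> + I) \<tau> = 0\<close>; the flow equation at a
  sonic point with \<open>D\<phi>\<close> normal reduces to \<open>\<tau> \<sqdot> (D\<^sup>2\<phi> + I) \<tau> = 0\<close>.  Thus the velocity \<open>D\<phi> + id\<close> is constant
  along the curve, say \<open>z\<close>, and \<open>|z - Q| = |D\<phi>(Q)| = c\<close>.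

  For (iii), a sonic circle is noncharacteristic where \<open>D\<phi>\<close> is not normal to it, so the solution is
  obtained from the Cauchy problem with analytic data on the arc.  The Cauchy--Kovalevskaya
  argument is a contraction for the second transversal derivative of \<open>\<phi>\<close>, in the norm
  \<open>\<Sum> |a\<^sub>m\<^sub>n| \<eta>\<^bsup>2m+n\<^esup> / (m+n choose m)\<close> on double power series: it is submultiplicative by Vandermonde's
  identity, and all operators \<open>\<partial>\<^sub>t\<^sup>-\<^sup>1\<close>, \<open>\<partial>\<^sub>t\<^sup>-\<^sup>1 \<partial>\<^sub>z\<close> in the equation have norm at most \<open>\<eta>\<close>.\<close>

section \<open>Curves in charts and one-sided derivatives\<close>

text \<open>On the sonic curve the second derivatives of \<phi> exist only as limits from one side.
  The chain rule along the curve therefore needs an argument of its own, in which derivatives are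
  taken within \<Gamma>. For (iii) everything is centered at the point (1, 1) of the circle of
  radius sqrt 2, where D\<phi> is prescribed to be the vertical unit vector. It makes an angle of 45
  degrees with the normal. At a sonic point with c > 0 the Cauchy-Schwarz inequality shows that a
  curve is characteristic exactly if D\<phi> is normal to it, so one condition makes the Cauchy
  problem solvable and the points non-exceptional. The second transversal derivative is the right
  unknown because all other quantities follow from it by integration from the data, each derivative
  along the curve being paired with at least one integration. The data make the arc sonic but do not
  by themselves produce a change of type. This comes from the equation: at the center it fixes the
  second transversal derivative as -1, whence |D\<phi>|^2 - c^2 has transversal derivative
  -(\<gamma> + 1) there and changes sign across the arc.\<close>

lemma rot_minus [simp]: "rot (- \<theta>) (rot \<theta> p) = p"
proof -
  have "cos \<theta> * (cos \<theta> * x) + sin \<theta> * (sin \<theta> * x) = x" for x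
    using sin_cos_squared_add[of \<theta>] by (simp add: power2_eq_square flip: mult.assoc distrib_right)
  then show ?thesis by (simp add: rot_def prod_eq_iff algebra_simps)
qed

lemma rot_minus' [simp]: "rot \<theta> (rot (- \<theta>) p) = p"
  using rot_minus[of "- \<theta>" p] by simp

lemma bounded_linear_rot: "bounded_linear (rot \<theta>)"
  unfolding rot_def
  by (intro bounded_linear_Pair bounded_linear_add bounded_linear_sub
      bounded_linear_const_mult bounded_linear_fst bounded_linear_snd)

lemma inner_rot: "v \<bullet> rot \<theta> w = rot (- \<theta>) v \<bullet> w"
  by (simp add: rot_def inner_prod_def algebra_simps)

lemma norm_rot [simp]: "norm (rot \<theta> p) = norm p"
  by (simp add: norm_eq_sqrt_inner inner_rot)

lemma rot_diff: "rot \<theta> (p - q) = rot \<theta> p - rot \<theta> q"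
  by (rule linear_diff[OF bounded_linear.linear[OF bounded_linear_rot]])

lemma dist_rot [simp]: "dist (rot \<theta> p) (rot \<theta> q) = dist p q"
  by (simp add: dist_norm flip: rot_diff)

lemma curve_chart_param:
  assumes "curve_chart \<Gamma> Q \<theta> f l1 l2 r" "x \<in> \<Gamma>" "dist Q x < r"
  obtains t where "t = fst (rot (- \<theta>) x)" "l1 < t" "t < l2" "x = rot \<theta> (t, f t)"
proof -
  have "x \<in> {rot \<theta> (t, f t) |t. l1 < t \<and> t < l2}"
    using assms by (auto simp: curve_chart_def)
  then obtain t where "x = rot \<theta> (t, f t)" "l1 < t" "t < l2" by auto
  then show thesis using that[of t] by simp
qed

lemma curve_chart_center:
  assumes "curve_chart \<Gamma> Q \<theta> f l1 l2 r" "Q \<in> \<Gamma>"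
  obtains t where "t = fst (rot (- \<theta>) Q)" "l1 < t" "t < l2" "Q = rot \<theta> (t, f t)"
  using assms by (auto intro: curve_chart_param[of \<Gamma> Q \<theta> f l1 l2 r Q] simp: curve_chart_def)

lemma curve_chart_differentiable:
  assumes "curve_chart \<Gamma> Q \<theta> f l1 l2 r" "l1 < t" "t < l2"
  shows "(f has_real_derivative deriv f t) (at t)"
  using assms by (simp add: curve_chart_def C11_on_def DERIV_deriv_iff_real_differentiable)

lemma graph_has_vector_derivative:
  assumes "(f has_real_derivative d) (at t)"
  shows "((\<lambda>t. rot \<theta> (t, f t)) has_vector_derivative rot \<theta> (1, d)) (at t)"
  using assms
  by (auto intro!: bounded_linear.has_vector_derivative[OF bounded_linear_rot]
      has_vector_derivative_Pair derivative_eq_intros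
      simp: has_real_derivative_iff_has_vector_derivative)

text \<open>The chart equation compares sets inside a ball; this is its form for the parameter.
  Identities known on \<Gamma> become identities of functions of \<open>t\<close> near the center,
  which can be differentiated.\<close>

lemma curve_chart_eventually:
  assumes ch: "curve_chart \<Gamma> Q \<theta> f l1 l2 r" and Q: "Q \<in> \<Gamma>" and "e > 0"
  shows "\<forall>\<^sub>F t in nhds (fst (rot (- \<theta>) Q)). rot \<theta> (t, f t) \<in> \<Gamma> \<inter> ball Q e \<inter> ball Q r
     \<and> l1 < t \<and> t < l2"
proof -
  obtain t0 where t0: "t0 = fst (rot (- \<theta>) Q)" "l1 < t0" "t0 < l2" "Q = rot \<theta> (t0, f t0)"
    using curve_chart_center[OF ch Q] .
  have "isCont (\<lambda>t. rot \<theta> (t, f t)) t0"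
    using graph_has_vector_derivative[OF curve_chart_differentiable[OF ch t0(2,3)], of \<theta>]
    by (rule has_vector_derivative_continuous)
  then have "((\<lambda>t. rot \<theta> (t, f t)) \<longlongrightarrow> Q) (nhds t0)"
    using t0(4) tendsto_at_iff_tendsto_nhds[of "\<lambda>t. rot \<theta> (t, f t)" t0] by (simp add: isCont_def)
  moreover have "open (ball Q e \<inter> ball Q r)" "Q \<in> ball Q e \<inter> ball Q r"
    using ch \<open>e > 0\<close> by (auto simp: curve_chart_def)
  ultimately have "\<forall>\<^sub>F t in nhds t0. rot \<theta> (t, f t) \<in> ball Q e \<inter> ball Q r"
    by (rule topological_tendstoD)
  moreover have "\<forall>\<^sub>F t in nhds t0. t \<in> {l1<..<l2}"
    using t0(2,3) by (intro eventually_nhds_in_open) auto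
  ultimately show ?thesis
    unfolding t0(1)[symmetric]
  proof eventually_elim
    case (elim t)
    then have "rot \<theta> (t, f t) \<in> {rot \<theta> (t, f t) |t. l1 < t \<and> t < l2} \<inter> ball Q r" by auto
    also have "\<dots> \<subseteq> \<Gamma>" using ch by (auto simp: curve_chart_def)
    finally show ?case using elim by auto
  qed
qed

text \<open>Statements about charts speak of the center only. Moving the center lets them be used at
  every point of one fixed graph.\<close>

lemma curve_chart_move:
  assumes ch: "curve_chart \<Gamma> Q \<theta> f l1 l2 r" and Q': "dist Q Q' < r"
  shows "curve_chart \<Gamma> Q' \<theta> f l1 l2 (r - dist Q Q')"
proof -
  have sub: "ball Q' (r - dist Q Q') \<subseteq> ball Q r"
  proof
    fix x assume "x \<in> ball Q' (r - dist Q Q')"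
    then show "x \<in> ball Q r" using dist_triangle[of Q x Q'] by simp
  qed
  let ?G = "{rot \<theta> (t, f t) |t. l1 < t \<and> t < l2}"
  have "\<Gamma> \<inter> ball Q r = ?G \<inter> ball Q r" using ch unfolding curve_chart_def by (elim conjE)
  then have "\<Gamma> \<inter> ball Q' (r - dist Q Q') = ?G \<inter> ball Q' (r - dist Q Q')" using sub by blast
  then show ?thesis using assms unfolding curve_chart_def by (intro conjI) simp_all
qed

section \<open>Tangent lines and their independence of the chart\<close>

definition tangent :: "real \<Rightarrow> (real \<Rightarrow> real) \<Rightarrow> plane \<Rightarrow> plane" where
  "tangent \<theta> f Q = rot \<theta> (1, deriv f (fst (rot (- \<theta>) Q)))"

lemma tangent_nonzero: "tangent \<theta> f Q \<noteq> 0"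
proof -
  have "norm (tangent \<theta> f Q) \<noteq> 0" by (simp add: tangent_def zero_prod_def)
  then show ?thesis by auto
qed

text \<open>Seen in the first frame, the second graph satisfies \<open>snd = f1 (fst)\<close>.
  Differentiating this relation at \<open>Q\<close> puts its velocity on the line spanned by the
  first tangent.\<close>

lemma chart_tangents_parallel:
  assumes 1: "curve_chart \<Gamma> Q \<theta>1 f1 l1 u1 r1" and 2: "curve_chart \<Gamma> Q \<theta>2 f2 l2 u2 r2" and Q: "Q \<in> \<Gamma>"
  obtains s where "tangent \<theta>2 f2 Q = s *\<^sub>R tangent \<theta>1 f1 Q"
proof -
  have r1: "r1 > 0" using 1 by (simp add: curve_chart_def)
  obtain t1 where t1: "t1 = fst (rot (- \<theta>1) Q)" "l1 < t1" "t1 < u1" "Q = rot \<theta>1 (t1, f1 t1)"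
    using curve_chart_center[OF 1 Q] .
  obtain t2 where t2: "t2 = fst (rot (- \<theta>2) Q)" "l2 < t2" "t2 < u2" "Q = rot \<theta>2 (t2, f2 t2)"
    using curve_chart_center[OF 2 Q] .
  let ?c = "\<lambda>t. rot (- \<theta>1) (rot \<theta>2 (t, f2 t))"
  define v where "v = rot (- \<theta>1) (tangent \<theta>2 f2 Q)"
  have c: "(?c has_vector_derivative v) (at t2)"
    unfolding v_def tangent_def t2(1)[symmetric]
    by (intro bounded_linear.has_vector_derivative[OF bounded_linear_rot]
        graph_has_vector_derivative[OF curve_chart_differentiable[OF 2 t2(2,3)]])
  have c1: "((\<lambda>t. fst (?c t)) has_real_derivative fst v) (at t2)"
    and c2: "((\<lambda>t. snd (?c t)) has_real_derivative snd v) (at t2)"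
    using bounded_linear.has_vector_derivative[OF bounded_linear_fst c]
      bounded_linear.has_vector_derivative[OF bounded_linear_snd c]
    by (auto simp: has_real_derivative_iff_has_vector_derivative)
  have ev: "\<forall>\<^sub>F t in nhds t2. snd (?c t) = f1 (fst (?c t))"
    using curve_chart_eventually[OF 2 Q r1] unfolding t2(1)[symmetric]
  proof eventually_elim
    case (elim t)
    then have "rot \<theta>2 (t, f2 t) \<in> \<Gamma>" "dist Q (rot \<theta>2 (t, f2 t)) < r1" by auto
    then obtain s where "rot \<theta>2 (t, f2 t) = rot \<theta>1 (s, f1 s)"
      using curve_chart_param[OF 1] by metis
    then show ?case by simp
  qed
  have "((\<lambda>t. f1 (fst (?c t))) has_real_derivative deriv f1 t1 * fst v) (at t2)"
  proof (rule DERIV_chain2[OF _ c1])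
    have "fst (?c t2) = t1" by (simp only: t1(1) flip: t2(4))
    then show "(f1 has_real_derivative deriv f1 t1) (at (fst (?c t2)))"
      using curve_chart_differentiable[OF 1 t1(2,3)] by simp
  qed
  then have "((\<lambda>t. snd (?c t)) has_real_derivative deriv f1 t1 * fst v) (at t2)"
    by (simp only: DERIV_cong_ev[OF refl ev refl])
  then have "snd v = deriv f1 t1 * fst v" using c2 DERIV_unique by blast
  then have "v = fst v *\<^sub>R (1, deriv f1 t1)" by (simp add: prod_eq_iff)
  then have "rot \<theta>1 v = rot \<theta>1 (fst v *\<^sub>R (1, deriv f1 t1))" by simp
  also have "\<dots> = fst v *\<^sub>R tangent \<theta>1 f1 Q"
    unfolding tangent_def t1(1)[symmetric]
    by (rule linear_scale[OF bounded_linear.linear[OF bounded_linear_rot]])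
  finally show thesis using that by (simp add: v_def)
qed

text \<open>The definition asks for some chart. Since tangents of different charts are parallel, the
  condition can be tested in whichever chart is at hand.\<close>

lemma exceptional_iff:
  assumes ch: "curve_chart \<Gamma> Q \<theta> f l1 l2 r" and Q: "Q \<in> \<Gamma>"
  shows "exceptional \<Gamma> g Q \<longleftrightarrow> g Q \<bullet> tangent \<theta> f Q = 0"
proof -
  have eq: "fst (rot (- \<theta>) (g Q)) + deriv f (fst (rot (- \<theta>) Q)) * snd (rot (- \<theta>) (g Q))
      = g Q \<bullet> tangent \<theta> f Q" for \<theta> f
    unfolding tangent_def inner_rot by (simp add: inner_prod_def mult.commute)
  show ?thesis
    unfolding exceptional_def eq
    using ch chart_tangents_parallel[OF _ ch Q] by (metis inner_scaleR_right mult_zero_right)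
qed

text \<open>Mean value inequality along the curve shifted into \<open>\<Omega>\<close>, followed by shift \<open>\<longrightarrow> 0\<close>.\<close>

lemma has_derivative_along_boundary:
  fixes F :: "plane \<Rightarrow> 'b::real_normed_vector" and H :: "plane \<Rightarrow> plane \<Rightarrow>\<^sub>L 'b"
  assumes ch: "curve_chart \<Gamma> Q \<theta> f l1 l2 r" and Q: "Q \<in> \<Gamma>"
    and side: "\<Omega> \<inter> ball Q r = above_graph \<theta> f l1 l2 \<inter> ball Q r \<or>
      \<Omega> \<inter> ball Q r = below_graph \<theta> f l1 l2 \<inter> ball Q r"
    and sub: "\<Omega> \<union> \<Gamma> \<subseteq> S"
    and F: "continuous_on S F" and H: "continuous_on S H"
    and der: "\<And>x. x \<in> \<Omega> \<Longrightarrow> (F has_derivative blinfun_apply (H x)) (at x)"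
  shows "(F has_derivative blinfun_apply (H Q)) (at Q within \<Gamma>)"
  unfolding has_derivative_within_alt
proof (intro conjI allI impI)
  show "bounded_linear (blinfun_apply (H Q))" by (rule blinfun.bounded_linear_right)
  fix e :: real assume e: "e > 0"
  have r: "r > 0" using ch by (simp add: curve_chart_def)
  \<comment> \<open>\<nu> is the vertical unit vector of the chart, pointing up or down according to
    the side on which \<Omega> lies. The shifted curve then runs inside \<Omega>, where
    \<open>F\<close> is differentiable.\<close>
  obtain \<nu> where \<nu>: "norm \<nu> = 1" and into: "\<And>t \<epsilon>. \<epsilon> > 0 \<Longrightarrow> l1 < t \<Longrightarrow> t < l2 \<Longrightarrow>
      dist Q (rot \<theta> (t, f t) + \<epsilon> *\<^sub>R \<nu>) < r \<Longrightarrow> rot \<theta> (t, f t) + \<epsilon> *\<^sub>R \<nu> \<in> \<Omega>"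
  proof -
    have shift: "rot \<theta> (t, s) + \<epsilon> *\<^sub>R rot \<theta> (0, \<sigma>) = rot \<theta> (t, s + \<epsilon> * \<sigma>)" for t s \<epsilon> \<sigma>
      by (simp add: rot_def algebra_simps)
    show thesis
      using side
    proof
      assume a: "\<Omega> \<inter> ball Q r = above_graph \<theta> f l1 l2 \<inter> ball Q r"
      show thesis
      proof (rule that[of "rot \<theta> (0, 1)"])
        fix t \<epsilon> :: real assume h: "\<epsilon> > 0" "l1 < t" "t < l2" "dist Q (rot \<theta> (t, f t) + \<epsilon> *\<^sub>R rot \<theta> (0, 1)) < r"
        then have "rot \<theta> (t, f t) + \<epsilon> *\<^sub>R rot \<theta> (0, 1) \<in> above_graph \<theta> f l1 l2 \<inter> ball Q r"
          unfolding shift above_graph_def by fastforce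
        then show "rot \<theta> (t, f t) + \<epsilon> *\<^sub>R rot \<theta> (0, 1) \<in> \<Omega>" using a by blast
      qed (simp add: norm_Pair)
    next
      assume a: "\<Omega> \<inter> ball Q r = below_graph \<theta> f l1 l2 \<inter> ball Q r"
      show thesis
      proof (rule that[of "rot \<theta> (0, - 1)"])
        fix t \<epsilon> :: real assume h: "\<epsilon> > 0" "l1 < t" "t < l2" "dist Q (rot \<theta> (t, f t) + \<epsilon> *\<^sub>R rot \<theta> (0, - 1)) < r"
        then have "rot \<theta> (t, f t) + \<epsilon> *\<^sub>R rot \<theta> (0, - 1) \<in> below_graph \<theta> f l1 l2 \<inter> ball Q r"
          unfolding shift below_graph_def by fastforce
        then show "rot \<theta> (t, f t) + \<epsilon> *\<^sub>R rot \<theta> (0, - 1) \<in> \<Omega>" using a by blast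
      qed (simp add: norm_Pair)
    qed
  qed
  obtain t0 where t0: "t0 = fst (rot (- \<theta>) Q)" "l1 < t0" "t0 < l2" "Q = rot \<theta> (t0, f t0)"
    using curve_chart_center[OF ch Q] .
  \<comment> \<open>This is where the Lipschitz bound on f' enters: it bounds the slope near the
    center, and hence the speed of the parametrized curve by 1 + M.\<close>
  obtain \<epsilon>0 M where \<epsilon>0: "\<epsilon>0 > 0" and M: "M \<ge> 0"
    "\<And>t. l1 < t \<Longrightarrow> t < l2 \<Longrightarrow> \<bar>t - t0\<bar> < \<epsilon>0 \<Longrightarrow> \<bar>deriv f t\<bar> \<le> M"
  proof -
    have "\<exists>\<epsilon>>0. \<exists>L. L-lipschitz_on ({l1<..<l2} \<inter> ball t0 \<epsilon>) (deriv f)"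
      using ch t0(2,3) by (simp add: curve_chart_def C11_on_def)
    then obtain \<epsilon> L where L: "\<epsilon> > 0" "L-lipschitz_on ({l1<..<l2} \<inter> ball t0 \<epsilon>) (deriv f)"
      by blast
    show thesis
    proof (rule that[OF L(1), of "\<bar>deriv f t0\<bar> + L * \<epsilon>"])
      show "0 \<le> \<bar>deriv f t0\<bar> + L * \<epsilon>" using L lipschitz_on_nonneg[OF L(2)] by simp
      fix t assume t: "l1 < t" "t < l2" "\<bar>t - t0\<bar> < \<epsilon>"
      have "dist (deriv f t) (deriv f t0) \<le> L * dist t t0"
        using t t0(2,3) L(1) by (intro lipschitz_onD[OF L(2)]) (auto simp: dist_real_def)
      also have "\<dots> \<le> L * \<epsilon>"
        using t lipschitz_on_nonneg[OF L(2)] by (intro mult_left_mono) (auto simp: dist_real_def)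
      finally show "\<bar>deriv f t\<bar> \<le> \<bar>deriv f t0\<bar> + L * \<epsilon>" by (simp add: dist_real_def)
    qed
  qed
  have "e / (1 + M) > 0" using e M(1) by simp
  then obtain \<delta> where \<delta>: "\<delta> > 0" "\<And>x. x \<in> S \<Longrightarrow> dist x Q < \<delta> \<Longrightarrow> dist (H x) (H Q) < e / (1 + M)"
    using H sub Q unfolding continuous_on_iff by (metis Un_upper2 subset_iff)
  \<comment> \<open>Half of \<open>min \<delta> r\<close> is reserved for the distance travelled
    along the curve, at most (1 + M) d, the other half for the shift into \<Omega>.\<close>
  define d where "d = min (min \<epsilon>0 r) (min \<delta> r / (2 * (1 + M)))"
  have d: "d > 0" "d \<le> \<epsilon>0" "d \<le> r" using \<epsilon>0 r \<delta>(1) M(1) by (auto simp: d_def)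
  have dM: "(1 + M) * d \<le> min \<delta> r / 2"
  proof -
    have "(1 + M) * d \<le> (1 + M) * (min \<delta> r / (2 * (1 + M)))"
      using M(1) by (intro mult_left_mono) (auto simp: d_def)
    also have "(1 + M) * (y / (2 * (1 + M))) = y / 2" for y
      using M(1) by (simp add: field_simps)
    finally show ?thesis .
  qed
  show "\<exists>d>0. \<forall>y\<in>\<Gamma>. norm (y - Q) < d \<longrightarrow>
      norm (F y - F Q - blinfun_apply (H Q) (y - Q)) \<le> e * norm (y - Q)"
  proof (intro exI[of _ d] conjI ballI impI d(1))
    fix x assume x: "x \<in> \<Gamma>" "norm (x - Q) < d"
    then have "dist Q x < r" using d by (simp add: dist_norm norm_minus_commute)
    then obtain s where s: "s = fst (rot (- \<theta>) x)" "l1 < s" "s < l2" "x = rot \<theta> (s, f s)"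
      using curve_chart_param[OF ch x(1)] by metis
    have st0: "\<bar>s - t0\<bar> \<le> norm (x - Q)"
    proof -
      have "\<bar>s - t0\<bar> = norm (fst (rot (- \<theta>) (x - Q)))" using s(1) t0(1) by (simp add: rot_diff)
      also have "\<dots> \<le> norm (rot (- \<theta>) (x - Q))" by (metis norm_fst_le prod.collapse)
      finally show ?thesis by simp
    qed
    let ?I = "closed_segment t0 s"
    have I: "l1 < t" "t < l2" "\<bar>t - t0\<bar> \<le> \<bar>s - t0\<bar>" if "t \<in> ?I" for t
      using that t0(2,3) s(2,3) by (auto simp: closed_segment_eq_real_ivl split: if_splits)
    have near: "dist Q (rot \<theta> (t, f t)) \<le> min \<delta> r / 2" if t: "t \<in> ?I" for t
    proof -
      have "\<bar>f t - f t0\<bar> \<le> M * \<bar>t - t0\<bar>"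
      proof -
        have "norm (f t - f t0) \<le> M * norm (t - t0)"
        proof (rule differentiable_bound[of ?I f "\<lambda>t h. deriv f t * h"])
          show "convex ?I" by simp
          fix y assume y: "y \<in> ?I"
          show "(f has_derivative (\<lambda>h. deriv f y * h)) (at y within ?I)"
            using curve_chart_differentiable[OF ch I(1,2)[OF y]]
            by (simp add: has_field_derivative_def has_derivative_at_withinI)
          have "\<bar>deriv f y\<bar> \<le> M" using I[OF y] st0 x(2) d by (intro M(2)) auto
          then show "onorm ((*) (deriv f y)) \<le> M"
            by (intro onorm_le) (simp add: abs_mult mult_right_mono)
        qed (use t in auto)
        then show ?thesis by simp
      qed
      then have "dist Q (rot \<theta> (t, f t)) \<le> (1 + M) * \<bar>t - t0\<bar>"
        using norm_triangle_ineq[of "(t - t0, 0)" "(0, f t - f t0)"]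
        unfolding t0(4) dist_rot by (simp add: dist_norm norm_Pair power2_commute[of t0] power2_commute[of "f t0"] algebra_simps)
      also have "\<dots> \<le> (1 + M) * d" using I(3)[OF t] st0 x(2) M(1) by (intro mult_left_mono) auto
      finally show ?thesis using dM by simp
    qed
    have shifted: "norm (F (x + \<epsilon> *\<^sub>R \<nu>) - F (Q + \<epsilon> *\<^sub>R \<nu>) - blinfun_apply (H Q) (x - Q))
        \<le> e * norm (x - Q)" if \<epsilon>: "0 < \<epsilon>" "\<epsilon> < min \<delta> r / 2" for \<epsilon>
    proof -
      let ?c = "\<lambda>t. rot \<theta> (t, f t) + \<epsilon> *\<^sub>R \<nu>"
      have c: "?c t \<in> \<Omega>" "dist (?c t) Q < \<delta>" if t: "t \<in> ?I" for t
      proof -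
        have "dist Q (?c t) \<le> dist Q (rot \<theta> (t, f t)) + \<epsilon>"
          using norm_triangle_ineq[of "rot \<theta> (t, f t) - Q" "\<epsilon> *\<^sub>R \<nu>"] \<epsilon> \<nu>
          by (simp add: dist_norm norm_minus_commute algebra_simps)
        then have "dist Q (?c t) < min \<delta> r" using near[OF t] \<epsilon> by linarith
        then show "?c t \<in> \<Omega>" "dist (?c t) Q < \<delta>"
          using into[OF \<epsilon>(1) I(1,2)[OF t]] by (auto simp: dist_commute)
      qed
      \<comment> \<open>Subtracting the candidate derivative leaves a function whose velocity is
        (H(c(t)) - H(Q)) applied to the tangent. This is at most e/(1 + M) times 1 + M.\<close>
      let ?\<psi> = "\<lambda>t. F (?c t) - blinfun_apply (H Q) (?c t)"
      have "norm (?\<psi> s - ?\<psi> t0) \<le> e * norm (s - t0)"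
      proof (rule differentiable_bound[of ?I ?\<psi>
            "\<lambda>t h. h *\<^sub>R blinfun_apply (H (?c t) - H Q) (rot \<theta> (1, deriv f t))"])
        show "convex ?I" by simp
        fix t assume t: "t \<in> ?I"
        have "((\<lambda>t. rot \<theta> (t, f t)) has_derivative (\<lambda>h. h *\<^sub>R rot \<theta> (1, deriv f t))) (at t within ?I)"
          using graph_has_vector_derivative[OF curve_chart_differentiable[OF ch I(1,2)[OF t]], of \<theta>]
          by (simp add: has_vector_derivative_def has_derivative_at_withinI)
        from has_derivative_add[OF this has_derivative_const[of "\<epsilon> *\<^sub>R \<nu>"]]
        have dc: "(?c has_derivative (\<lambda>h. h *\<^sub>R rot \<theta> (1, deriv f t))) (at t within ?I)"
          by simp
        show "(?\<psi> has_derivative (\<lambda>h. h *\<^sub>R blinfun_apply (H (?c t) - H Q) (rot \<theta> (1, deriv f t))))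
            (at t within ?I)"
          using has_derivative_diff[OF
              has_derivative_compose[OF dc der[OF c(1)[OF t]]]
              has_derivative_compose[OF dc bounded_linear_imp_has_derivative[OF blinfun.bounded_linear_right[of "H Q"]]]]
          by (simp add: blinfun.scaleR_right blinfun.diff_left scaleR_diff_right)
        have "?c t \<in> S" using c(1)[OF t] sub by auto
        then have H1: "norm (H (?c t) - H Q) \<le> e / (1 + M)"
          using \<delta>(2) c(2)[OF t] by (metis dist_norm less_imp_le)
        have "\<bar>deriv f t\<bar> \<le> M" using I[OF t] st0 x(2) d by (intro M(2)) auto
        then have "norm (rot \<theta> (1, deriv f t)) \<le> 1 + M"
          using norm_triangle_ineq[of "(1 :: real, 0 :: real)" "(0, deriv f t)"]
          by (simp add: norm_Pair)
        then have "norm (blinfun_apply (H (?c t) - H Q) (rot \<theta> (1, deriv f t))) \<le> e / (1 + M) * (1 + M)"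
          using norm_blinfun[of "H (?c t) - H Q" "rot \<theta> (1, deriv f t)"] H1
          by (meson mult_mono norm_ge_zero order_trans)
        then have "norm (blinfun_apply (H (?c t) - H Q) (rot \<theta> (1, deriv f t))) \<le> e"
          using M(1) by simp
        then show "onorm (\<lambda>h. h *\<^sub>R blinfun_apply (H (?c t) - H Q) (rot \<theta> (1, deriv f t))) \<le> e"
          by (intro onorm_le) (simp add: mult.commute[of e] mult_left_mono)
      qed auto
      also have "\<dots> \<le> e * norm (x - Q)" using st0 e by simp
      finally show ?thesis
        using s(4) t0(4) by (simp add: blinfun.diff_right blinfun.add_right algebra_simps)
    qed
    \<comment> \<open>Both end points are approached from inside \<open>S\<close>, so continuity of
      \<open>F\<close> up to the boundary suffices for removing the shift.\<close>
    have lim: "((\<lambda>\<epsilon>. F (y + \<epsilon> *\<^sub>R \<nu>)) \<longlongrightarrow> F y) (at_right 0)"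
      if y: "y \<in> {x, Q}" for y
    proof -
      have "\<forall>\<^sub>F \<epsilon> in at_right 0. \<epsilon> \<in> {0<..<min \<delta> r / 2}"
        using \<delta>(1) r by (intro eventually_at_right_real) auto
      then have ev: "\<forall>\<^sub>F \<epsilon> in at_right 0. y + \<epsilon> *\<^sub>R \<nu> \<in> S"
      proof eventually_elim
        case (elim \<epsilon>)
        obtain t where t: "t \<in> ?I" "y = rot \<theta> (t, f t)" using y s(4) t0(4) by auto
        have "dist Q (y + \<epsilon> *\<^sub>R \<nu>) \<le> dist Q y + \<epsilon>"
          using norm_triangle_ineq[of "y - Q" "\<epsilon> *\<^sub>R \<nu>"] elim \<nu>
          by (simp add: dist_norm norm_minus_commute algebra_simps)
        then have "dist Q (y + \<epsilon> *\<^sub>R \<nu>) < r" using near[OF t(1)] t(2) elim by auto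
        then show ?case using into[of \<epsilon> t] I[OF t(1)] t(2) elim sub by auto
      qed
      have "((\<lambda>\<epsilon>. y + \<epsilon> *\<^sub>R \<nu>) \<longlongrightarrow> y + 0 *\<^sub>R \<nu>) (at_right 0)"
        by (intro tendsto_intros)
      then show ?thesis
        using y x(1) Q sub ev by (intro continuous_on_tendsto_compose[OF F]) auto
    qed
    have "((\<lambda>\<epsilon>. norm (F (x + \<epsilon> *\<^sub>R \<nu>) - F (Q + \<epsilon> *\<^sub>R \<nu>) - blinfun_apply (H Q) (x - Q)))
        \<longlongrightarrow> norm (F x - F Q - blinfun_apply (H Q) (x - Q))) (at_right 0)"
      by (intro tendsto_intros lim) auto
    moreover have "\<forall>\<^sub>F \<epsilon> in at_right 0. \<epsilon> \<in> {0<..<min \<delta> r / 2}"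
      using \<delta>(1) r by (intro eventually_at_right_real) auto
    then have "\<forall>\<^sub>F \<epsilon> in at_right 0. norm (F (x + \<epsilon> *\<^sub>R \<nu>) - F (Q + \<epsilon> *\<^sub>R \<nu>) - blinfun_apply (H Q) (x - Q))
        \<le> e * norm (x - Q)"
      by eventually_elim (use shifted in auto)
    ultimately show "norm (F x - F Q - blinfun_apply (H Q) (x - Q)) \<le> e * norm (x - Q)"
      by (intro tendsto_upperbound[where F = "at_right (0 :: real)"]) auto
  qed
qed

text \<open>A whole parameter interval is mapped into \<Gamma>, so a derivative within \<Gamma> is
  all that the chain rule needs to give an ordinary derivative in the parameter.\<close>

lemma vector_derivative_along_chart:
  assumes ch: "curve_chart \<Gamma> Q \<theta> f l1 l2 r" and Q: "Q \<in> \<Gamma>"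
    and F: "(F has_derivative D) (at Q within \<Gamma>)"
  shows "((\<lambda>t. F (rot \<theta> (t, f t))) has_vector_derivative D (tangent \<theta> f Q)) (at (fst (rot (- \<theta>) Q)))"
proof -
  let ?c = "\<lambda>t. rot \<theta> (t, f t)"
  obtain t0 where t0: "t0 = fst (rot (- \<theta>) Q)" "l1 < t0" "t0 < l2" "Q = ?c t0"
    using curve_chart_center[OF ch Q] .
  have "r > 0" using ch by (simp add: curve_chart_def)
  then obtain d where d: "d > 0" "\<And>t. dist t t0 < d \<Longrightarrow> ?c t \<in> \<Gamma>"
    using curve_chart_eventually[OF ch Q] unfolding t0(1)[symmetric] eventually_nhds_metric by blast
  have c: "(?c has_derivative (\<lambda>h. h *\<^sub>R tangent \<theta> f Q)) (at t0 within ball t0 d)"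
    using graph_has_vector_derivative[OF curve_chart_differentiable[OF ch t0(2,3)], of \<theta>]
    unfolding tangent_def t0(1)[symmetric] has_vector_derivative_def by (rule has_derivative_at_withinI)
  have "?c ` ball t0 d \<subseteq> \<Gamma>" using d(2) by (auto simp: dist_commute)
  then have "(F has_derivative D) (at (?c t0) within ?c ` ball t0 d)"
    using F unfolding t0(4)[symmetric] by (rule has_derivative_subset[rotated])
  from has_derivative_in_compose[OF c this]
  have "((\<lambda>t. F (?c t)) has_derivative (\<lambda>h. D (h *\<^sub>R tangent \<theta> f Q))) (at t0)"
    using d(1) by (simp add: at_within_open[of t0 "ball t0 d"])
  moreover have "D (h *\<^sub>R tangent \<theta> f Q) = h *\<^sub>R D (tangent \<theta> f Q)" for h
    by (rule linear_scale[OF has_derivative_linear[OF F]])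
  ultimately show ?thesis by (simp add: has_vector_derivative_def flip: t0(1))
qed

section \<open>Exceptional sonic points\<close>

text \<open>In a chart the derivative in the parameter vanishes at every parameter, not only at the
  center, because the chart can be recentered. Hence \<open>F\<close> is locally constant, and
  connectedness does the rest.\<close>

lemma constant_along_curve:
  fixes F :: "plane \<Rightarrow> 'b::real_normed_vector"
  assumes "connected \<Gamma>"
    and charts: "\<And>Q. Q \<in> \<Gamma> \<Longrightarrow> \<exists>\<theta> f l1 l2 r. curve_chart \<Gamma> Q \<theta> f l1 l2 r"
    and der: "\<And>Q. Q \<in> \<Gamma> \<Longrightarrow> (F has_derivative D Q) (at Q within \<Gamma>)"
    and zero: "\<And>Q \<theta> f l1 l2 r. Q \<in> \<Gamma> \<Longrightarrow> curve_chart \<Gamma> Q \<theta> f l1 l2 r \<Longrightarrow> D Q (tangent \<theta> f Q) = 0"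
  shows "F constant_on \<Gamma>"
proof (rule locally_constant_imp_constant[OF \<open>connected \<Gamma>\<close>])
  fix Q assume Q: "Q \<in> \<Gamma>"
  obtain \<theta> f l1 l2 r where ch: "curve_chart \<Gamma> Q \<theta> f l1 l2 r" using charts[OF Q] by blast
  let ?c = "\<lambda>t. rot \<theta> (t, f t)"
  define t0 where "t0 = fst (rot (- \<theta>) Q)"
  have r: "r > 0" using ch by (simp add: curve_chart_def)
  obtain d where d: "d > 0" "\<And>t. dist t t0 < d \<Longrightarrow> ?c t \<in> \<Gamma> \<inter> ball Q r \<and> l1 < t \<and> t < l2"
    using curve_chart_eventually[OF ch Q r] unfolding t0_def[symmetric] eventually_nhds_metric by blast
  have const: "F (?c t) = F Q" if t: "t \<in> ball t0 d" for t
  proof -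
    have "((\<lambda>t. F (?c t)) has_derivative (\<lambda>h. 0)) (at t within ball t0 d)" if t: "t \<in> ball t0 d" for t
    proof -
      have ct: "?c t \<in> \<Gamma>" "dist Q (?c t) < r"
        using d(2)[of t] t by (auto simp: dist_commute)
      note ch' = curve_chart_move[OF ch ct(2)]
      show ?thesis
        using vector_derivative_along_chart[OF ch' ct(1) der[OF ct(1)]] zero[OF ct(1) ch']
        by (simp add: has_vector_derivative_def has_derivative_at_withinI)
    qed
    then obtain c where c: "\<And>t. t \<in> ball t0 d \<Longrightarrow> F (?c t) = c"
      using has_derivative_zero_constant[of "ball t0 d" "\<lambda>t. F (?c t)"] by auto
    moreover obtain t1 where "t1 = t0" "Q = ?c t1"
      using curve_chart_center[OF ch Q] unfolding t0_def by metis
    ultimately show ?thesis using c[OF t] c[of t0] d(1) by simp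
  qed
  show "\<exists>T. openin (top_of_set \<Gamma>) T \<and> Q \<in> T \<and> (\<forall>x\<in>T. F x = F Q)"
  proof (intro exI[of _ "\<Gamma> \<inter> ball Q (min d r)"] conjI ballI)
    fix x assume x: "x \<in> \<Gamma> \<inter> ball Q (min d r)"
    then obtain t where t: "t = fst (rot (- \<theta>) x)" "x = ?c t"
      using curve_chart_param[OF ch, of x] by (metis IntE mem_ball min_less_iff_conj)
    \<comment> \<open>The parameter is a coordinate projection and does not increase distances, so
      points of \<Gamma> close to \<open>Q\<close> have parameters close to
      \<open>t0\<close>.\<close>
    have "\<bar>t0 - t\<bar> = norm (fst (rot (- \<theta>) (Q - x)))" by (simp add: t(1) t0_def rot_diff)
    also have "\<dots> \<le> norm (rot (- \<theta>) (Q - x))" by (metis norm_fst_le prod.collapse)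
    also have "\<dots> < d" using x by (simp add: dist_norm)
    finally have "t \<in> ball t0 d" by (simp add: dist_real_def)
    then show "F x = F Q" using const t(2) by simp
  qed (use Q d r in auto)
qed

section \<open>The flow equation in non-divergence form, and linear algebra in the plane\<close>

lemma has_derivative_head:
  assumes "GDERIV \<phi> x :> g x" "(g has_derivative H) (at x)"
  shows "(head K \<phi> g has_derivative (\<lambda>h. - (g x \<bullet> h) - g x \<bullet> H h)) (at x)"
proof -
  have "((\<lambda>x. K - \<phi> x - (g x \<bullet> g x) / 2) has_derivative (\<lambda>h. - (g x \<bullet> h) - g x \<bullet> H h)) (at x)"
    using assms unfolding gderiv_def
    by (auto intro!: derivative_eq_intros simp: inner_commute fun_eq_iff field_simps)
  moreover have "head K \<phi> g = (\<lambda>x. K - \<phi> x - (g x \<bullet> g x) / 2)"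
    by (simp add: head_def fun_eq_iff power2_norm_eq_inner)
  ultimately show ?thesis by simp
qed

text \<open>With s = \<rho>/c^2 the gradient of the density is s times the gradient of
  \<open>head\<close>. The product rule then makes the divergence equation s times the
  non-divergence equation, and s is nonzero where the head is positive.\<close>

lemma has_divergence_density_iff:
  assumes "\<gamma> > 1" and pos: "head K \<phi> g x > 0"
    and \<phi>: "GDERIV \<phi> x :> g x" and g: "(g has_derivative H) (at x)"
  shows "has_divergence (\<lambda>y. density \<gamma> K \<phi> g y *\<^sub>R g y) (- 2 * density \<gamma> K \<phi> g x) x \<longleftrightarrow>
    (\<gamma> - 1) * head K \<phi> g x * ((\<Sum>b\<in>Basis. H b \<bullet> b) + 2) = g x \<bullet> g x + g x \<bullet> H (g x)"
proof -
  let ?h = "head K \<phi> g x" and ?\<rho> = "density \<gamma> K \<phi> g x" and ?T = "\<Sum>b\<in>Basis. H b \<bullet> b"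
  let ?h' = "\<lambda>h. - (g x \<bullet> h) - g x \<bullet> H h"
  define s where "s = ?\<rho> / ((\<gamma> - 1) * ?h)"
  have \<rho>0: "?\<rho> > 0" using pos by (simp add: density_def)
  have pw: "((\<lambda>u. u powr (1 / (\<gamma> - 1))) has_real_derivative
      1 / (\<gamma> - 1) * ?h powr (1 / (\<gamma> - 1) - 1)) (at ?h)"
    using pos by (rule has_real_derivative_powr)
  have s_eq: "1 / (\<gamma> - 1) * ?h powr (1 / (\<gamma> - 1) - 1) = s"
    using pos by (simp add: s_def density_def powr_diff)
  have dens: "(density \<gamma> K \<phi> g has_derivative (\<lambda>h. s * ?h' h)) (at x)"
    using has_derivative_compose[OF has_derivative_head[OF \<phi> g] pw[unfolded has_field_derivative_def s_eq]]
    by (simp add: density_def[abs_def])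
  have lin: "linear ?h'" "linear H"
    using has_derivative_linear[OF has_derivative_head[OF \<phi> g]] has_derivative_linear[OF g] by auto
  let ?F = "\<lambda>h. ?\<rho> *\<^sub>R H h + (s * ?h' h) *\<^sub>R g x"
  have F: "((\<lambda>y. density \<gamma> K \<phi> g y *\<^sub>R g y) has_derivative ?F) (at x)"
    using dens g by (rule has_derivative_scaleR)
  have "(\<Sum>b\<in>Basis. ?F b \<bullet> b) = ?\<rho> * ?T + s * (\<Sum>b\<in>Basis. (g x \<bullet> b) * ?h' b)"
    by (simp add: inner_add_left sum.distrib sum_distrib_left mult_ac)
  also have "(\<Sum>b\<in>Basis. (g x \<bullet> b) * ?h' b) = ?h' (g x)"
  proof -
    have "?h' (g x) = ?h' (\<Sum>b\<in>Basis. (g x \<bullet> b) *\<^sub>R b)" by (simp only: euclidean_representation)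
    also have "\<dots> = (\<Sum>b\<in>Basis. (g x \<bullet> b) * ?h' b)"
      by (subst linear_sum[OF lin(1)]) (simp only: linear_scale[OF lin(1)] real_scaleR_def)
    finally show ?thesis by simp
  qed
  finally have div: "(\<Sum>b\<in>Basis. ?F b \<bullet> b) = ?\<rho> * ?T + s * ?h' (g x)" .
  have "has_divergence (\<lambda>y. density \<gamma> K \<phi> g y *\<^sub>R g y) (- 2 * ?\<rho>) x \<longleftrightarrow>
      - 2 * ?\<rho> = ?\<rho> * ?T + s * ?h' (g x)"
  proof
    assume "has_divergence (\<lambda>y. density \<gamma> K \<phi> g y *\<^sub>R g y) (- 2 * ?\<rho>) x"
    then obtain F' where F': "((\<lambda>y. density \<gamma> K \<phi> g y *\<^sub>R g y) has_derivative F') (at x)"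
      "- 2 * ?\<rho> = (\<Sum>b\<in>Basis. F' b \<bullet> b)"
      unfolding has_divergence_def by blast
    show "- 2 * ?\<rho> = ?\<rho> * ?T + s * ?h' (g x)"
      using F'(2) unfolding has_derivative_unique[OF F'(1) F] div .
  next
    assume "- 2 * ?\<rho> = ?\<rho> * ?T + s * ?h' (g x)"
    then show "has_divergence (\<lambda>y. density \<gamma> K \<phi> g y *\<^sub>R g y) (- 2 * ?\<rho>) x"
      unfolding has_divergence_def using F div by (intro exI[of _ ?F]) simp
  qed
  also have "\<dots> \<longleftrightarrow> (\<gamma> - 1) * ?h * (?T + 2) = g x \<bullet> g x + g x \<bullet> H (g x)"
  proof -
    have R: "?\<rho> = s * ((\<gamma> - 1) * ?h)" using pos \<open>\<gamma> > 1\<close> by (simp add: s_def)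
    have iff: "l = r \<longleftrightarrow> z = 0" if "l - r = - z" for l r z :: real
      using that by auto
    have D: "- 2 * ?\<rho> - (?\<rho> * ?T + s * ?h' (g x)) =
        - (s * ((\<gamma> - 1) * ?h * (?T + 2) - (g x \<bullet> g x + g x \<bullet> H (g x))))"
      unfolding R by (simp add: algebra_simps)
    have "- 2 * ?\<rho> = ?\<rho> * ?T + s * ?h' (g x) \<longleftrightarrow>
        s * ((\<gamma> - 1) * ?h * (?T + 2) - (g x \<bullet> g x + g x \<bullet> H (g x))) = 0"
      by (rule iff[OF D])
    moreover have "s \<noteq> 0" using \<rho>0 pos \<open>\<gamma> > 1\<close> by (simp add: s_def)
    ultimately show ?thesis by simp
  qed
  finally show ?thesis .
qed

text \<open>Carries the flow equation, once it is written with continuous functions, from the open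
  subsonic region to the sonic curve.\<close>

lemma zero_on_closure:
  fixes F :: "plane \<Rightarrow> real"
  assumes "continuous_on S F" "\<Omega> \<subseteq> S" "S \<subseteq> closure \<Omega>" "\<And>x. x \<in> \<Omega> \<Longrightarrow> F x = 0" "x \<in> S"
  shows "F x = 0"
proof -
  have "closedin (top_of_set S) (S \<inter> F -` {0})"
    using assms(1) by (intro continuous_closedin_preimage) auto
  then obtain U where U: "closed U" "S \<inter> F -` {0} = S \<inter> U" by (auto simp: closedin_closed)
  then have "\<Omega> \<subseteq> U" using assms by blast
  then have "closure \<Omega> \<subseteq> U" using U(1) by (rule closure_minimal)
  then show ?thesis using assms U by blast
qed

lemma orthogonal_pair_zero:
  fixes u v w :: plane
  assumes "u \<noteq> 0" "v \<noteq> 0" "u \<bullet> v = 0" "u \<bullet> w = 0" "v \<bullet> w = 0"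
  shows "w = 0"
proof -
  obtain a b where u: "u = (a, b)" by (cases u)
  obtain c d where v: "v = (c, d)" by (cases v)
  obtain x y where w: "w = (x, y)" by (cases w)
  have e: "a * c + b * d = 0" "a * x + b * y = 0" "c * x + d * y = 0"
    using assms by (auto simp: u v w inner_prod_def)
  have n: "a \<noteq> 0 \<or> b \<noteq> 0" "c \<noteq> 0 \<or> d \<noteq> 0" using assms by (auto simp: u v zero_prod_def)
  have "a\<^sup>2 + b\<^sup>2 > 0" "c\<^sup>2 + d\<^sup>2 > 0" using n by (simp_all add: sum_power2_gt_zero_iff)
  then have "(a\<^sup>2 + b\<^sup>2) * (c\<^sup>2 + d\<^sup>2) > 0" by simp
  \<comment> \<open>Lagrange's identity: for orthogonal nonzero vectors it forces a nonzero
    determinant.\<close>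
  moreover have "(a\<^sup>2 + b\<^sup>2) * (c\<^sup>2 + d\<^sup>2) = (a * c + b * d)\<^sup>2 + (a * d - b * c)\<^sup>2" by algebra
  ultimately have det: "a * d - b * c \<noteq> 0" using e(1) by auto
  have "(a * d - b * c) * x = 0" "(a * d - b * c) * y = 0" using e(2,3) by algebra+
  then show ?thesis using det by (simp add: w zero_prod_def)
qed

text \<open>The trace may be computed in any orthonormal basis; multiplying by both squared lengths
  avoids normalizing \<open>u\<close> and \<open>v\<close>.\<close>

lemma trace_orthogonal_pair:
  fixes u v :: plane
  assumes "linear H" "u \<bullet> v = 0"
  shows "(u \<bullet> u) * (v \<bullet> v) * (\<Sum>b\<in>Basis. H b \<bullet> b) = (v \<bullet> v) * (u \<bullet> H u) + (u \<bullet> u) * (v \<bullet> H v)"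
proof -
  obtain a b where u: "u = (a, b)" by (cases u)
  obtain c d where v: "v = (c, d)" by (cases v)
  have H: "H (x, y) = x *\<^sub>R H (1, 0) + y *\<^sub>R H (0, 1)" for x y
  proof -
    have "H (x, y) = H (x *\<^sub>R (1, 0) + y *\<^sub>R (0, 1))" by simp
    then show ?thesis by (simp only: linear_add[OF assms(1)] linear_scale[OF assms(1)])
  qed
  obtain p q where 1: "H (1, 0) = (p, q)" by (cases "H (1, 0)")
  obtain r s where 2: "H (0, 1) = (r, s)" by (cases "H (0, 1)")
  have tr: "(\<Sum>b\<in>Basis. H b \<bullet> b) = p + s"
    by (simp add: Basis_prod_def sum.union_disjoint sum.reindex inner_prod_def 1 2)
  have o: "a * c + b * d = 0" using assms(2) by (simp add: u v inner_prod_def)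
  show ?thesis
    unfolding tr unfolding u v H[of a b] H[of c d] 1 2
    using o by (simp add: inner_prod_def) algebra
qed

definition kappa :: "real \<Rightarrow> real" where
  "kappa \<gamma> = 2 * (\<gamma> - 1) / (\<gamma> + 1)"

lemma kappa_pos: "\<gamma> > 1 \<Longrightarrow> kappa \<gamma> > 0"
  by (simp add: kappa_def)

section \<open>The sonic curve of a two-sided configuration\<close>

context
  fixes \<gamma> K :: real and \<Omega>m \<Omega>p \<Gamma> :: "plane set" and \<phi>m \<phi>p :: "plane \<Rightarrow> real" and gm gp :: "plane \<Rightarrow> plane"
  assumes \<gamma>: "\<gamma> > 1" and conf: "sonic_configuration \<gamma> K \<Omega>m \<Omega>p \<Gamma> \<phi>m \<phi>p gm gp"
begin

lemma sonic_point:
  assumes "x \<in> \<Gamma>"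
  shows "norm (gp x) = sonic_speed \<gamma> K \<phi>p gp x" "(norm (gp x))\<^sup>2 = kappa \<gamma> * (K - \<phi>p x)"
    "(\<gamma> - 1) * head K \<phi>p gp x = (norm (gp x))\<^sup>2"
proof -
  show n: "norm (gp x) = sonic_speed \<gamma> K \<phi>p gp x"
    using conf assms by (auto simp: sonic_configuration_def sonic_def)
  \<comment> \<open>A negative head would give a negative value of \<open>sqrt\<close>, which cannot
    equal a norm.\<close>
  have "0 \<le> (\<gamma> - 1) * head K \<phi>p gp x"
    using norm_ge_zero[of "gp x"] unfolding n sonic_speed_def by (rule real_sqrt_ge_0_iff[THEN iffD1])
  then show h: "(\<gamma> - 1) * head K \<phi>p gp x = (norm (gp x))\<^sup>2"
    unfolding n sonic_speed_def by simp
  show "(norm (gp x))\<^sup>2 = kappa \<gamma> * (K - \<phi>p x)"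
    using h \<gamma> by (simp add: head_def kappa_def field_simps)
qed

lemma chart_at:
  assumes "Q \<in> \<Gamma>"
  obtains \<theta> f l1 l2 r where "curve_chart \<Gamma> Q \<theta> f l1 l2 r"
    "\<Omega>p \<inter> ball Q r = above_graph \<theta> f l1 l2 \<inter> ball Q r \<or> \<Omega>p \<inter> ball Q r = below_graph \<theta> f l1 l2 \<inter> ball Q r"
proof -
  have "\<exists>\<theta> f l1 l2 r. curve_chart \<Gamma> Q \<theta> f l1 l2 r \<and>
        (on_two_sides \<Omega>p \<Omega>m Q \<theta> f l1 l2 r \<or> on_two_sides \<Omega>m \<Omega>p Q \<theta> f l1 l2 r)"
    using conf assms by (auto simp: sonic_configuration_def)
  then show thesis using that unfolding on_two_sides_def by blast
qed

lemma C2_plus: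
  obtains H :: "plane \<Rightarrow> plane \<Rightarrow>\<^sub>L plane" where "open \<Omega>p" "\<Omega>p \<union> \<Gamma> \<subseteq> closure \<Omega>p"
    "continuous_on (\<Omega>p \<union> \<Gamma>) \<phi>p" "continuous_on (\<Omega>p \<union> \<Gamma>) gp" "continuous_on (\<Omega>p \<union> \<Gamma>) H"
    "\<And>x. x \<in> \<Omega>p \<Longrightarrow> GDERIV \<phi>p x :> gp x"
    "\<And>x. x \<in> \<Omega>p \<Longrightarrow> (gp has_derivative blinfun_apply (H x)) (at x)"
proof -
  have "C2_upto \<Omega>p (\<Omega>p \<union> \<Gamma>) \<phi>p gp" using conf by (simp add: sonic_configuration_def)
  then show thesis using that unfolding C2_upto_def by blast
qed

lemma potential_derivative:
  assumes Q: "Q \<in> \<Gamma>"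
  shows "(\<phi>p has_derivative (\<lambda>h. gp Q \<bullet> h)) (at Q within \<Gamma>)"
proof -
  obtain \<theta> f l1 l2 r where ch: "curve_chart \<Gamma> Q \<theta> f l1 l2 r"
    "\<Omega>p \<inter> ball Q r = above_graph \<theta> f l1 l2 \<inter> ball Q r \<or> \<Omega>p \<inter> ball Q r = below_graph \<theta> f l1 l2 \<inter> ball Q r"
    using chart_at[OF Q] .
  obtain H :: "plane \<Rightarrow> plane \<Rightarrow>\<^sub>L plane" where H: "continuous_on (\<Omega>p \<union> \<Gamma>) \<phi>p" "continuous_on (\<Omega>p \<union> \<Gamma>) gp"
    "\<And>x. x \<in> \<Omega>p \<Longrightarrow> GDERIV \<phi>p x :> gp x"
    using C2_plus by metis
  have "(\<phi>p has_derivative blinfun_apply (blinfun_inner_right (gp Q))) (at Q within \<Gamma>)"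
  proof (rule has_derivative_along_boundary[OF ch(1) Q ch(2) subset_refl H(1)])
    show "continuous_on (\<Omega>p \<union> \<Gamma>) (\<lambda>x. blinfun_inner_right (gp x))"
      by (intro continuous_intros H(2) bounded_linear.continuous_on[OF bounded_linear_blinfun_inner_right])
    show "(\<phi>p has_derivative blinfun_apply (blinfun_inner_right (gp x))) (at x)" if "x \<in> \<Omega>p" for x
    proof -
      have "(\<bullet>) (gp x) = (\<lambda>h. h \<bullet> gp x)" by (simp add: fun_eq_iff inner_commute)
      then show ?thesis using H(3)[OF that] by (simp add: gderiv_def)
    qed
  qed
  then show ?thesis by simp
qed

lemma potential_curve_derivative:
  assumes ch: "curve_chart \<Gamma> Q \<theta> f l1 l2 r" and Q: "Q \<in> \<Gamma>"
  shows "((\<lambda>t. \<phi>p (rot \<theta> (t, f t))) has_real_derivative gp Q \<bullet> tangent \<theta> f Q) (at (fst (rot (- \<theta>) Q)))"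
  using vector_derivative_along_chart[OF ch Q potential_derivative[OF Q]]
  by (simp add: has_real_derivative_iff_has_vector_derivative)

text \<open>The square root in c = sqrt (\<kappa> (K - \<phi>)) can be differentiated where c > 0,
  and its derivative is then a nonzero multiple of D\<phi> \<bullet> \<tau>. Where c = 0 the
  gradient vanishes and counts as normal, which accounts for the second alternative.\<close>

lemma exceptional_iff_tangential:
  assumes ch: "curve_chart \<Gamma> Q \<theta> f l1 l2 r" and Q: "Q \<in> \<Gamma>"
  shows "exceptional \<Gamma> gp Q \<longleftrightarrow>
    has_tangential_derivative \<theta> f (sonic_speed \<gamma> K \<phi>p gp) 0 Q \<or> sonic_speed \<gamma> K \<phi>p gp Q = 0"
proof -
  let ?c = "sonic_speed \<gamma> K \<phi>p gp" let ?t0 = "fst (rot (- \<theta>) Q)"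
  let ?\<tau> = "gp Q \<bullet> tangent \<theta> f Q"
  obtain t0 where t0: "t0 = ?t0" "Q = rot \<theta> (t0, f t0)"
    using curve_chart_center[OF ch Q] by metis
  have c: "?c x = sqrt (kappa \<gamma> * (K - \<phi>p x))" if "x \<in> \<Gamma>" for x
    using sonic_point(1,2)[OF that] by (metis norm_ge_zero real_sqrt_unique)
  show ?thesis
  proof (cases "?c Q = 0")
    case True
    then have "gp Q = 0" using sonic_point(1)[OF Q] by simp
    then show ?thesis using True by (simp add: exceptional_iff[OF ch Q])
  next
    case False
    then have pos: "?c Q > 0" using sonic_point(1)[OF Q] by (metis norm_ge_zero order_less_le)
    have r: "r > 0" using ch by (simp add: curve_chart_def)
    have pos': "kappa \<gamma> * (K - \<phi>p (rot \<theta> (t0, f t0))) > 0"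
      using pos c[OF Q] t0(2) by simp
    have "((\<lambda>t. sqrt (kappa \<gamma> * (K - \<phi>p (rot \<theta> (t, f t))))) has_real_derivative
        - (kappa \<gamma> * ?\<tau>) * (inverse (?c Q) / 2)) (at t0)"
      using potential_curve_derivative[OF ch Q] pos' c[OF Q] unfolding t0(1)[symmetric]
      by (auto intro!: derivative_eq_intros simp flip: t0(2))
    moreover have "\<forall>\<^sub>F t in nhds t0. ?c (rot \<theta> (t, f t)) = sqrt (kappa \<gamma> * (K - \<phi>p (rot \<theta> (t, f t))))"
      using curve_chart_eventually[OF ch Q r] unfolding t0(1)[symmetric]
      by eventually_elim (use c in auto)
    ultimately have d: "((\<lambda>t. ?c (rot \<theta> (t, f t))) has_real_derivative
        - (kappa \<gamma> * ?\<tau>) * (inverse (?c Q) / 2)) (at t0)"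
      by (subst DERIV_cong_ev[OF refl _ refl])
    have "has_tangential_derivative \<theta> f ?c 0 Q \<longleftrightarrow> - (kappa \<gamma> * ?\<tau>) * (inverse (?c Q) / 2) = 0"
      unfolding has_tangential_derivative_def t0(1)[symmetric] using d DERIV_unique by metis
    also have "\<dots> \<longleftrightarrow> ?\<tau> = 0" using False kappa_pos[OF \<gamma>] by simp
    finally show ?thesis using False by (simp add: exceptional_iff[OF ch Q])
  qed
qed

text \<open>In the subsonic region c > 0, so the non-divergence equation holds there and passes to
  the limit on \<Gamma>. Putting c^2 = |D\<phi>|^2 cancels one |D\<phi>|^2, which turns the constant
  2 into 1. \<open>H\<close> is the continuous extension of the Hessian.\<close>

lemma hessian_equation:
  "\<exists>H :: plane \<Rightarrow> plane \<Rightarrow>\<^sub>L plane. \<forall>Q\<in>\<Gamma>. (gp has_derivative blinfun_apply (H Q)) (at Q within \<Gamma>) \<and>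
    (norm (gp Q))\<^sup>2 * ((\<Sum>b\<in>Basis. H Q b \<bullet> b) + 1) = gp Q \<bullet> H Q (gp Q)"
proof -
  obtain H :: "plane \<Rightarrow> plane \<Rightarrow>\<^sub>L plane" where H: "open \<Omega>p" "\<Omega>p \<union> \<Gamma> \<subseteq> closure \<Omega>p"
    "continuous_on (\<Omega>p \<union> \<Gamma>) \<phi>p" "continuous_on (\<Omega>p \<union> \<Gamma>) gp" "continuous_on (\<Omega>p \<union> \<Gamma>) H"
    "\<And>x. x \<in> \<Omega>p \<Longrightarrow> GDERIV \<phi>p x :> gp x"
    "\<And>x. x \<in> \<Omega>p \<Longrightarrow> (gp has_derivative blinfun_apply (H x)) (at x)"
    using C2_plus by metis
  let ?E = "\<lambda>x. (\<gamma> - 1) * head K \<phi>p gp x * ((\<Sum>b\<in>Basis. H x b \<bullet> b) + 2) - (gp x \<bullet> gp x + gp x \<bullet> H x (gp x))"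
  have "continuous_on (\<Omega>p \<union> \<Gamma>) ?E"
    unfolding head_def by (intro continuous_intros H(3-5)) auto
  moreover have "?E x = 0" if x: "x \<in> \<Omega>p" for x
  proof -
    have "norm (gp x) < sonic_speed \<gamma> K \<phi>p gp x"
      using conf x by (auto simp: sonic_configuration_def subsonic_def)
    then have "0 < sonic_speed \<gamma> K \<phi>p gp x" by (rule le_less_trans[OF norm_ge_zero])
    then have pos: "head K \<phi>p gp x > 0" using \<gamma> by (simp add: sonic_speed_def zero_less_mult_iff)
    have "has_divergence (\<lambda>y. density \<gamma> K \<phi>p gp y *\<^sub>R gp y) (- 2 * density \<gamma> K \<phi>p gp x) x"
      using conf x by (auto simp: sonic_configuration_def potential_flow_def)
    then show ?thesis
      using has_divergence_density_iff[OF \<gamma> pos H(6)[OF x] H(7)[OF x]] by simp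
  qed
  ultimately have E0: "?E x = 0" if "x \<in> \<Omega>p \<union> \<Gamma>" for x
    by (rule zero_on_closure[OF _ Un_upper1 H(2) _ that])
  show ?thesis
  proof (intro exI[of _ H] ballI conjI)
    fix Q assume Q: "Q \<in> \<Gamma>"
    obtain \<theta> f l1 l2 r where ch: "curve_chart \<Gamma> Q \<theta> f l1 l2 r"
      "\<Omega>p \<inter> ball Q r = above_graph \<theta> f l1 l2 \<inter> ball Q r \<or> \<Omega>p \<inter> ball Q r = below_graph \<theta> f l1 l2 \<inter> ball Q r"
      using chart_at[OF Q] .
    show "(gp has_derivative blinfun_apply (H Q)) (at Q within \<Gamma>)"
      by (rule has_derivative_along_boundary[OF ch(1) Q ch(2) subset_refl H(4,5,7)])
    show "(norm (gp Q))\<^sup>2 * ((\<Sum>b\<in>Basis. H Q b \<bullet> b) + 1) = gp Q \<bullet> H Q (gp Q)"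
      using E0[of Q] Q unfolding sonic_point(3)[OF Q] power2_norm_eq_inner by (simp add: algebra_simps)
  qed
qed

lemma exceptional_curve_circle:
  assumes conn: "connected \<Gamma>" and ex: "\<And>Q. Q \<in> \<Gamma> \<Longrightarrow> exceptional \<Gamma> gp Q"
    and pos: "\<And>Q. Q \<in> \<Gamma> \<Longrightarrow> sonic_speed \<gamma> K \<phi>p gp Q > 0"
  shows "\<exists>c2>0. (\<forall>Q\<in>\<Gamma>. sonic_speed \<gamma> K \<phi>p gp Q = c2) \<and> (\<exists>z. \<Gamma> \<subseteq> sphere z c2)"
proof (cases "\<Gamma> = {}")
  case True
  \<comment> \<open>On an empty curve any positive constant serves.\<close>
  then show ?thesis by (intro exI[of _ 1]) auto
next
  case False
  then obtain Q0 where Q0: "Q0 \<in> \<Gamma>" by blast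
  let ?c = "sonic_speed \<gamma> K \<phi>p gp"
  define c0 where "c0 = ?c Q0"
  have charts: "\<exists>\<theta> f l1 l2 r. curve_chart \<Gamma> Q \<theta> f l1 l2 r" if "Q \<in> \<Gamma>" for Q
    using chart_at[OF that] by metis
  have orth: "gp Q \<bullet> tangent \<theta> f Q = 0" if "Q \<in> \<Gamma>" "curve_chart \<Gamma> Q \<theta> f l1 l2 r" for Q \<theta> f l1 l2 r
    using ex[OF that(1)] exceptional_iff[OF that(2,1)] by simp
  have "\<phi>p constant_on \<Gamma>"
    by (rule constant_along_curve[OF conn charts potential_derivative orth])
  then have speed: "?c Q = c0" if "Q \<in> \<Gamma>" for Q
    using sonic_point(1,2)[OF that] sonic_point(1,2)[OF Q0] Q0 that
    unfolding c0_def by (metis constant_on_def norm_ge_zero power2_eq_iff_nonneg)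
  then have norm_g: "gp Q \<bullet> gp Q = (c0)\<^sup>2" if "Q \<in> \<Gamma>" for Q
    using sonic_point(1)[OF that] speed[OF that] by (simp flip: power2_norm_eq_inner)
  obtain H :: "plane \<Rightarrow> plane \<Rightarrow>\<^sub>L plane" where
    H: "\<And>Q. Q \<in> \<Gamma> \<Longrightarrow> (gp has_derivative blinfun_apply (H Q)) (at Q within \<Gamma>)"
    and eq: "\<And>Q. Q \<in> \<Gamma> \<Longrightarrow> (norm (gp Q))\<^sup>2 * ((\<Sum>b\<in>Basis. H Q b \<bullet> b) + 1) = gp Q \<bullet> H Q (gp Q)"
    using hessian_equation by blast
  have "(\<lambda>x. gp x + x) constant_on \<Gamma>"
  proof (rule constant_along_curve[OF conn])
    show "\<exists>\<theta> f l1 l2 r. curve_chart \<Gamma> Q \<theta> f l1 l2 r" if "Q \<in> \<Gamma>" for Q by (rule charts[OF that])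
    show "((\<lambda>x. gp x + x) has_derivative (\<lambda>h. H Q h + h)) (at Q within \<Gamma>)" if "Q \<in> \<Gamma>" for Q
      by (intro derivative_intros H that)
    fix Q \<theta> f l1 l2 r assume Q: "Q \<in> \<Gamma>" and ch: "curve_chart \<Gamma> Q \<theta> f l1 l2 r"
    let ?\<tau> = "tangent \<theta> f Q"
    have g0: "gp Q \<noteq> 0" using sonic_point(1)[OF Q] pos[OF Q] by auto
    have o: "gp Q \<bullet> ?\<tau> = 0" by (rule orth[OF Q ch])
    have "gp Q \<bullet> H Q ?\<tau> = 0"
    proof -
      let ?c = "\<lambda>t. rot \<theta> (t, f t)"
      obtain t0 where t0: "t0 = fst (rot (- \<theta>) Q)" "Q = ?c t0" using curve_chart_center[OF ch Q] by metis
      have "r > 0" using ch by (simp add: curve_chart_def)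
      then have ev: "\<forall>\<^sub>F t in nhds t0. gp (?c t) \<bullet> gp (?c t) = c0\<^sup>2"
        using curve_chart_eventually[OF ch Q, of r] unfolding t0(1)[symmetric]
        by (auto elim!: eventually_mono simp: norm_g)
      have "((\<lambda>t. gp (?c t)) has_vector_derivative H Q ?\<tau>) (at t0)"
        using vector_derivative_along_chart[OF ch Q H[OF Q]] unfolding t0(1)[symmetric] .
      then have "((\<lambda>t. gp (?c t)) has_derivative (\<lambda>h. h *\<^sub>R H Q ?\<tau>)) (at t0)"
        by (simp add: has_vector_derivative_def)
      from has_derivative_inner[OF this this]
      have "((\<lambda>t. gp (?c t) \<bullet> gp (?c t)) has_derivative (\<lambda>h. 2 * (gp Q \<bullet> H Q ?\<tau>) * h)) (at t0)"
        unfolding t0(2)[symmetric] by (simp add: inner_commute mult_ac)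
      then have "((\<lambda>t. gp (?c t) \<bullet> gp (?c t)) has_real_derivative 2 * (gp Q \<bullet> H Q ?\<tau>)) (at t0)"
        by (simp add: has_field_derivative_def)
      then have "((\<lambda>t. c0\<^sup>2) has_real_derivative 2 * (gp Q \<bullet> H Q ?\<tau>)) (at t0)"
        by (simp only: DERIV_cong_ev[OF refl ev refl])
      then show ?thesis using DERIV_unique[OF _ DERIV_const] by fastforce
    qed
    \<comment> \<open>Multiply the flow equation by |\<tau>|^2 and insert the trace in the
      orthogonal frame D\<phi>, \<tau>. The trace and the term D\<phi> \<bullet> H D\<phi> cancel,
      and |D\<phi>|^2 (\<tau> \<bullet> H \<tau> + |\<tau>|^2) = 0 remains.\<close>
    moreover have "?\<tau> \<bullet> (H Q ?\<tau> + ?\<tau>) = 0"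
    proof -
      have "(gp Q \<bullet> gp Q) * (?\<tau> \<bullet> H Q ?\<tau> + ?\<tau> \<bullet> ?\<tau>) = 0"
        using trace_orthogonal_pair[OF bounded_linear.linear[OF blinfun.bounded_linear_right[of "H Q"]] o]
          eq[OF Q] unfolding power2_norm_eq_inner by algebra
      then show ?thesis using g0 by (simp add: inner_add_right)
    qed
    ultimately show "H Q ?\<tau> + ?\<tau> = 0"
      using o by (intro orthogonal_pair_zero[OF g0 tangent_nonzero o]) (auto simp: inner_add_right)
  qed
  then obtain z where z: "\<And>x. x \<in> \<Gamma> \<Longrightarrow> gp x + x = z" by (auto simp: constant_on_def)
  have "dist z x = c0" if "x \<in> \<Gamma>" for x
    using z[OF that] sonic_point(1)[OF that] speed[OF that] by (simp add: dist_norm flip: z[OF that])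
  then show ?thesis
    using pos[OF Q0] speed by (intro exI[of _ c0] exI[of _ z] conjI) (simp_all add: c0_def subset_eq)
qed

end

section \<open>A Banach algebra norm on double power series\<close>

unbundle no vec_syntax and fps_syntax

type_synonym fps2 = "real fps fps"

text \<open>A double power series in \<open>t\<close> (outer variable) and \<open>z\<close> (inner variable).  The binomial
  coefficient in the weight makes the integrated derivative \<open>\<partial>\<^sub>t\<^sup>-\<^sup>1 \<partial>\<^sub>z\<close>, which loses no powers of
  \<open>t\<close> and \<open>z\<close> altogether, an operator of norm at most \<open>\<eta>\<close>.\<close>

definition weight :: "real \<Rightarrow> nat \<Rightarrow> nat \<Rightarrow> real" where
  "weight \<eta> m n = \<eta> ^ (2 * m + n) / real ((m + n) choose m)"

text \<open>Truncation at total degree k gives every formal series a finite norm. Products,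
  \<open>int_t\<close> and the composite of \<open>int_t\<close> and \<open>deriv_z\<close> never
  lower the total degree, so their estimates hold for each k with the same constant; boundedness in
  k takes the place of membership in a Banach space.\<close>

definition degs :: "nat \<Rightarrow> (nat \<times> nat) set" where
  "degs k = {(m, n). m + n \<le> k}"

definition fnorm :: "real \<Rightarrow> nat \<Rightarrow> fps2 \<Rightarrow> real" where
  "fnorm \<eta> k a = (\<Sum>(m, n)\<in>degs k. \<bar>a $ m $ n\<bar> * weight \<eta> m n)"

definition const2 :: "real \<Rightarrow> fps2" where
  "const2 c = fps_const (fps_const c)"

definition var_t :: fps2 where "var_t = fps_X"

definition var_z :: fps2 where "var_z = fps_const fps_X"

definition int_t :: "fps2 \<Rightarrow> fps2" where
  "int_t a = Abs_fps (\<lambda>m. if m = 0 then 0 else fps_const (1 / real m) * a $ (m - 1))"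

definition deriv_z :: "fps2 \<Rightarrow> fps2" where
  "deriv_z a = Abs_fps (\<lambda>m. fps_deriv (a $ m))"

lemma finite_degs [simp, intro]: "finite (degs k)"
proof -
  have "degs k \<subseteq> {..k} \<times> {..k}" by (auto simp: degs_def)
  then show ?thesis by (rule finite_subset) auto
qed

lemma mem_degs [simp]: "(m, n) \<in> degs k \<longleftrightarrow> m + n \<le> k"
  by (simp add: degs_def)

lemma weight_pos: "\<eta> > 0 \<Longrightarrow> weight \<eta> m n > 0"
  by (simp add: weight_def)

text \<open>The product of the two binomial coefficients is a single term of the Vandermonde sum for
  the binomial coefficient of the total exponents.\<close>

lemma weight_mult_le:
  assumes "\<eta> > 0"
  shows "weight \<eta> (m + m') (n + n') \<le> weight \<eta> m n * weight \<eta> m' n'"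
proof -
  let ?b = "(m + n choose m) * (m' + n' choose m')"
  have "?b \<le> (\<Sum>k\<le>m + m'. (m + n choose k) * (m' + n' choose (m + m' - k)))"
    using member_le_sum[of m "{..m + m'}" "\<lambda>k. (m + n choose k) * (m' + n' choose (m + m' - k))"]
    by auto
  also have "\<dots> = (m + m') + (n + n') choose (m + m')"
    by (simp add: vandermonde ac_simps)
  finally have le: "?b \<le> (m + m') + (n + n') choose (m + m')" .
  have pos: "0 < ?b" by simp
  have "weight \<eta> (m + m') (n + n') \<le> \<eta> ^ (2 * (m + m') + (n + n')) / real ?b"
    unfolding weight_def using le pos assms
    by (intro divide_left_mono mult_pos_pos) (simp_all del: of_nat_mult)
  also have "\<dots> = weight \<eta> m n * weight \<eta> m' n'"
    by (simp add: weight_def power_add power_mult mult_ac)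
  finally show ?thesis .
qed

text \<open>Differentiation in z contributes n + 1 and integration in t contributes 1/(m + 1). Their
  quotient is exactly the quotient of neighboring binomial coefficients. One factor \<eta> is left
  over because t counts twice in the exponent 2m + n.\<close>

lemma weight_shift_both:
  assumes "\<eta> > 0"
  shows "weight \<eta> (Suc m) n * real (Suc n) / real (Suc m) = \<eta> * weight \<eta> m (Suc n)"
proof -
  have "Suc m * (m + Suc n choose Suc m) = (m + Suc n - m) * (m + Suc n choose m)"
    by (metis binomial_absorb_comp binomial_absorption)
  then have "Suc m * (Suc m + n choose Suc m) = Suc n * (m + Suc n choose m)" by simp
  then have e: "real (Suc m) * real (Suc m + n choose Suc m) = real (Suc n) * real (m + Suc n choose m)"
    by (metis of_nat_mult)
  have p: "real (Suc m + n choose Suc m) > 0" "real (m + Suc n choose m) > 0"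
    by (simp_all del: binomial_Suc_Suc)
  have "real (Suc n) / (real (Suc m) * real (Suc m + n choose Suc m)) = 1 / real (m + Suc n choose m)"
    unfolding e using p by simp
  then show ?thesis
    by (simp add: weight_def field_simps del: binomial_Suc_Suc)
qed

text \<open>Absorption rewrites the denominator as (m + n + 1) times the old binomial coefficient,
  which can only help.\<close>

lemma weight_shift:
  assumes "\<eta> > 0"
  shows "weight \<eta> (Suc m) n / real (Suc m) \<le> \<eta>\<^sup>2 * weight \<eta> m n"
proof -
  have e: "Suc m * (Suc m + n choose Suc m) = Suc (m + n) * (m + n choose m)"
    using Suc_times_binomial[of m "m + n"] by simp
  have "real (m + n choose m) \<le> real (Suc m * (Suc m + n choose Suc m))"
    unfolding e of_nat_le_iff by simp
  then have "\<eta> ^ (2 * Suc m + n) / real (Suc m * (Suc m + n choose Suc m))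
      \<le> \<eta> ^ (2 * Suc m + n) / real (m + n choose m)"
    using assms
    by (intro divide_left_mono mult_pos_pos)
      (simp_all del: of_nat_mult binomial_Suc_Suc mult_Suc add: zero_less_mult_iff)
  moreover have "\<eta> ^ (2 * Suc m + n) = \<eta>\<^sup>2 * \<eta> ^ (2 * m + n)"
    by (simp add: power2_eq_square)
  ultimately show ?thesis
    by (simp only: weight_def of_nat_mult divide_divide_eq_left times_divide_eq_right mult.commute)
qed

lemma fnorm_nonneg: "\<eta> > 0 \<Longrightarrow> fnorm \<eta> k a \<ge> 0"
  unfolding fnorm_def by (intro sum_nonneg) (auto simp: weight_pos less_imp_le)

lemma fnorm_coeff_le:
  assumes "\<eta> > 0" "m + n \<le> k"
  shows "\<bar>a $ m $ n\<bar> * weight \<eta> m n \<le> fnorm \<eta> k a"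
  unfolding fnorm_def
proof -
  let ?h = "\<lambda>(m, n). \<bar>a $ m $ n\<bar> * weight \<eta> m n"
  have "?h (m, n) \<le> sum ?h (degs k)"
    using assms weight_pos[OF assms(1)]
    by (intro member_le_sum) (auto simp: less_imp_le)
  then show "\<bar>a $ m $ n\<bar> * weight \<eta> m n \<le> sum ?h (degs k)" by simp
qed

lemma fnorm_triangle:
  assumes "\<eta> > 0"
  shows "fnorm \<eta> k (a + b) \<le> fnorm \<eta> k a + fnorm \<eta> k b"
  unfolding fnorm_def sum.distrib[symmetric]
proof (intro sum_mono, clarify)
  fix m n
  have "\<bar>(a + b) $ m $ n\<bar> * weight \<eta> m n \<le> (\<bar>a $ m $ n\<bar> + \<bar>b $ m $ n\<bar>) * weight \<eta> m n"
    using weight_pos[OF assms] by (intro mult_right_mono) (auto simp: less_imp_le)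
  then show "\<bar>(a + b) $ m $ n\<bar> * weight \<eta> m n
      \<le> \<bar>a $ m $ n\<bar> * weight \<eta> m n + \<bar>b $ m $ n\<bar> * weight \<eta> m n"
    by (simp add: algebra_simps)
qed

lemma fnorm_minus [simp]: "fnorm \<eta> k (- a) = fnorm \<eta> k a"
  by (simp add: fnorm_def)

lemma fnorm_zero [simp]: "fnorm \<eta> k 0 = 0"
  by (simp add: fnorm_def)

lemma fnorm_minus_commute: "fnorm \<eta> k (a - b) = fnorm \<eta> k (b - a)"
  using fnorm_minus[of \<eta> k "a - b"] by simp

lemma fnorm_triangle_minus:
  "\<eta> > 0 \<Longrightarrow> fnorm \<eta> k (a - b) \<le> fnorm \<eta> k a + fnorm \<eta> k b"
  using fnorm_triangle[of \<eta> k a "- b"] by simp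

lemma fps2_mult_nth:
  "(a * b :: fps2) $ m $ n = (\<Sum>i\<le>m. \<Sum>j\<le>n. a $ i $ j * b $ (m - i) $ (n - j))"
  by (simp add: fps_mult_nth fps_sum_nth atLeast0AtMost)

lemma fnorm_mult:
  assumes "\<eta> > 0"
  shows "fnorm \<eta> k (a * b) \<le> fnorm \<eta> k a * fnorm \<eta> k b"
proof -
  let ?h = "\<lambda>c (m, n). \<bar>c $ m $ n\<bar> * weight \<eta> m n"
  let ?g = "\<lambda>((m, n), (i, j)). ?h a (i, j) * ?h b (m - i, n - j)"
  let ?S = "Sigma (degs k) (\<lambda>x. {..fst x} \<times> {..snd x})"
  have "fnorm \<eta> k (a * b) \<le> (\<Sum>x\<in>degs k. \<Sum>y\<in>{..fst x} \<times> {..snd x}. ?g (x, y))"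
    unfolding fnorm_def
  proof (rule sum_mono)
    fix x assume "x \<in> degs k"
    obtain m n where x: "x = (m, n)" by (cases x)
    have "\<bar>(a * b) $ m $ n\<bar> * weight \<eta> m n
      \<le> (\<Sum>i\<le>m. \<Sum>j\<le>n. \<bar>a $ i $ j\<bar> * \<bar>b $ (m - i) $ (n - j)\<bar>) * weight \<eta> m n"
      unfolding fps2_mult_nth using weight_pos[OF assms]
      by (intro mult_right_mono order_trans[OF sum_abs] sum_mono) (auto simp: abs_mult less_imp_le)
    also have "\<dots> = (\<Sum>i\<le>m. \<Sum>j\<le>n. \<bar>a $ i $ j\<bar> * \<bar>b $ (m - i) $ (n - j)\<bar> * weight \<eta> m n)"
      by (simp add: sum_distrib_right)
    also have "\<dots> \<le> (\<Sum>i\<le>m. \<Sum>j\<le>n. ?g ((m, n), (i, j)))"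
    proof (intro sum_mono)
      fix i j assume "i \<in> {..m}" "j \<in> {..n}"
      then have "weight \<eta> m n \<le> weight \<eta> i j * weight \<eta> (m - i) (n - j)"
        using weight_mult_le[OF assms, of i "m - i" j "n - j"] by simp
      then have "\<bar>a $ i $ j\<bar> * \<bar>b $ (m - i) $ (n - j)\<bar> * weight \<eta> m n
          \<le> \<bar>a $ i $ j\<bar> * \<bar>b $ (m - i) $ (n - j)\<bar> * (weight \<eta> i j * weight \<eta> (m - i) (n - j))"
        by (intro mult_left_mono) auto
      then show "\<bar>a $ i $ j\<bar> * \<bar>b $ (m - i) $ (n - j)\<bar> * weight \<eta> m n \<le> ?g ((m, n), (i, j))"
        by (simp add: mult_ac)
    qed
    finally show "?h (a * b) x \<le> (\<Sum>y\<in>{..fst x} \<times> {..snd x}. ?g (x, y))"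
      by (simp add: x sum.cartesian_product case_prod_unfold)
  qed
  also have "\<dots> = sum ?g ?S"
    by (simp add: sum.Sigma case_prod_unfold)
  \<comment> \<open>Recording a term of the Cauchy product by its two factors is injective, and both
    factors have total degree at most k.\<close>
  also have "\<dots> = (\<Sum>(x, y)\<in>(\<lambda>((m, n), (i, j)). ((i, j), (m - i, n - j))) ` ?S. ?h a x * ?h b y)"
    by (subst sum.reindex) (auto simp: inj_on_def intro!: sum.cong)
  also have "\<dots> \<le> (\<Sum>(x, y)\<in>degs k \<times> degs k. ?h a x * ?h b y)"
    using less_imp_le[OF weight_pos[OF assms]] by (intro sum_mono2) (auto intro!: mult_nonneg_nonneg)
  also have "\<dots> = fnorm \<eta> k a * fnorm \<eta> k b"
    unfolding fnorm_def sum_product by (simp add: sum.cartesian_product)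
  finally show ?thesis .
qed

lemma fnorm_single:
  assumes "\<eta> > 0" "\<And>m n. (m, n) \<noteq> (i, j) \<Longrightarrow> a $ m $ n = 0"
  shows "fnorm \<eta> k a \<le> \<bar>a $ i $ j\<bar> * weight \<eta> i j"
proof -
  have "fnorm \<eta> k a = (\<Sum>(m, n)\<in>degs k \<inter> {(i, j)}. \<bar>a $ m $ n\<bar> * weight \<eta> m n)"
    unfolding fnorm_def
  proof (rule sum.mono_neutral_right)
    show "\<forall>x\<in>degs k - degs k \<inter> {(i, j)}. (case x of (m, n) \<Rightarrow> \<bar>a $ m $ n\<bar> * weight \<eta> m n) = 0"
    proof
      fix x assume x: "x \<in> degs k - degs k \<inter> {(i, j)}"
      then have "a $ fst x $ snd x = 0" by (intro assms(2)) auto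
      then show "(case x of (m, n) \<Rightarrow> \<bar>a $ m $ n\<bar> * weight \<eta> m n) = 0"
        by (simp add: case_prod_unfold)
    qed
  qed auto
  also have "\<dots> \<le> (\<Sum>(m, n)\<in>{(i, j)}. \<bar>a $ m $ n\<bar> * weight \<eta> m n)"
    using weight_pos[OF assms(1)] by (intro sum_mono2) (auto simp: less_imp_le)
  finally show ?thesis by simp
qed

lemma fnorm_const2: "\<eta> > 0 \<Longrightarrow> fnorm \<eta> k (const2 c) \<le> \<bar>c\<bar>"
  by (rule order_trans[OF fnorm_single[of \<eta> 0 0]]) (auto simp: const2_def weight_def)

lemma fnorm_var_t: "\<eta> > 0 \<Longrightarrow> fnorm \<eta> k var_t \<le> \<eta>\<^sup>2"
  by (rule order_trans[OF fnorm_single[of \<eta> 1 0]]) (auto simp: var_t_def weight_def)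

lemma fnorm_var_z: "\<eta> > 0 \<Longrightarrow> fnorm \<eta> k var_z \<le> \<eta>"
  by (rule order_trans[OF fnorm_single[of \<eta> 0 1]]) (auto simp: var_z_def weight_def)

lemma int_t_nth:
  "int_t a $ 0 = 0" "int_t a $ Suc m $ n = a $ m $ n / real (Suc m)"
  by (simp_all add: int_t_def fps_mult_left_const_nth del: of_nat_Suc)

lemma deriv_z_nth: "deriv_z a $ m $ n = real (Suc n) * a $ m $ Suc n"
  by (simp add: deriv_z_def fps_deriv_nth mult.commute)

lemma fps2_eqI: "(\<And>m n. a $ m $ n = b $ m $ n) \<Longrightarrow> a = (b :: fps2)"
  by (simp add: fps_eq_iff)

lemma int_t_diff: "int_t (a - b) = int_t a - int_t b"
proof (rule fps2_eqI)
  fix m n show "int_t (a - b) $ m $ n = (int_t a - int_t b) $ m $ n"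
    by (cases m) (simp_all add: int_t_nth diff_divide_distrib)
qed

lemma deriv_z_diff: "deriv_z (a - b) = deriv_z a - deriv_z b"
  by (rule fps2_eqI) (simp add: deriv_z_nth algebra_simps)

lemma deriv_z_int_t: "deriv_z (int_t a) = int_t (deriv_z a)"
proof (rule fps2_eqI)
  fix m n show "deriv_z (int_t a) $ m $ n = int_t (deriv_z a) $ m $ n"
    by (cases m) (simp_all add: int_t_nth deriv_z_nth)
qed

text \<open>Common reindexing for the two integration operators, whose values have no terms free of
  t.\<close>

lemma fnorm_shift:
  assumes "\<eta> > 0" and b0: "\<And>n. b $ 0 $ n = 0"
  shows "fnorm \<eta> k b \<le> (\<Sum>(m, n)\<in>{(m, n). Suc m + n \<le> k}. \<bar>b $ Suc m $ n\<bar> * weight \<eta> (Suc m) n)"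
proof -
  let ?h = "\<lambda>(m, n). \<bar>b $ m $ n\<bar> * weight \<eta> m n"
  let ?D = "{(m, n). Suc m + n \<le> k}"
  have "fnorm \<eta> k b = sum ?h ((\<lambda>(m, n). (Suc m, n)) ` ?D)"
    unfolding fnorm_def
  proof (rule sum.mono_neutral_right)
    show "\<forall>x\<in>degs k - (\<lambda>(m, n). (Suc m, n)) ` ?D. ?h x = 0"
    proof clarify
      fix m n assume "(m, n) \<in> degs k" "(m, n) \<notin> (\<lambda>(m, n). (Suc m, n)) ` ?D"
      then have "m = 0" by (cases m) (auto simp: image_iff)
      then show "\<bar>b $ m $ n\<bar> * weight \<eta> m n = 0" using b0 by simp
    qed
  qed auto
  also have "\<dots> = (\<Sum>(m, n)\<in>?D. \<bar>b $ Suc m $ n\<bar> * weight \<eta> (Suc m) n)"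
    by (subst sum.reindex) (auto simp: inj_on_def case_prod_unfold)
  finally show ?thesis by simp
qed

lemma fnorm_int_t:
  assumes "\<eta> > 0"
  shows "fnorm \<eta> k (int_t a) \<le> \<eta>\<^sup>2 * fnorm \<eta> k a"
proof -
  let ?D = "{(m, n). Suc m + n \<le> k}"
  have "fnorm \<eta> k (int_t a) \<le> (\<Sum>(m, n)\<in>?D. \<bar>int_t a $ Suc m $ n\<bar> * weight \<eta> (Suc m) n)"
    by (rule fnorm_shift[OF assms]) (simp add: int_t_nth)
  also have "\<dots> \<le> (\<Sum>(m, n)\<in>?D. \<eta>\<^sup>2 * (\<bar>a $ m $ n\<bar> * weight \<eta> m n))"
  proof (intro sum_mono, clarify)
    fix m n
    have "\<bar>int_t a $ Suc m $ n\<bar> * weight \<eta> (Suc m) n = \<bar>a $ m $ n\<bar> * (weight \<eta> (Suc m) n / real (Suc m))"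
      by (simp add: int_t_nth del: of_nat_Suc)
    also have "\<dots> \<le> \<bar>a $ m $ n\<bar> * (\<eta>\<^sup>2 * weight \<eta> m n)"
      by (intro mult_left_mono weight_shift assms) auto
    finally show "\<bar>int_t a $ Suc m $ n\<bar> * weight \<eta> (Suc m) n \<le> \<eta>\<^sup>2 * (\<bar>a $ m $ n\<bar> * weight \<eta> m n)"
      by (simp add: mult_ac)
  qed
  also have "\<dots> \<le> (\<Sum>(m, n)\<in>degs k. \<eta>\<^sup>2 * (\<bar>a $ m $ n\<bar> * weight \<eta> m n))"
    using weight_pos[OF assms] by (intro sum_mono2) (auto simp: less_imp_le)
  also have "\<dots> = \<eta>\<^sup>2 * fnorm \<eta> k a"
    by (simp add: fnorm_def sum_distrib_left case_prod_unfold)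
  finally show ?thesis .
qed

lemma fnorm_int_t_deriv_z:
  assumes "\<eta> > 0"
  shows "fnorm \<eta> k (int_t (deriv_z a)) \<le> \<eta> * fnorm \<eta> k a"
proof -
  let ?D = "{(m, n). Suc m + n \<le> k}"
  let ?b = "int_t (deriv_z a)"
  have "fnorm \<eta> k ?b \<le> (\<Sum>(m, n)\<in>?D. \<bar>?b $ Suc m $ n\<bar> * weight \<eta> (Suc m) n)"
    by (rule fnorm_shift[OF assms]) (simp add: int_t_nth)
  also have "\<dots> = (\<Sum>(m, n)\<in>?D. \<eta> * (\<bar>a $ m $ Suc n\<bar> * weight \<eta> m (Suc n)))"
  proof (intro sum.cong refl, clarify)
    fix m n
    have "\<bar>?b $ Suc m $ n\<bar> * weight \<eta> (Suc m) n
        = \<bar>a $ m $ Suc n\<bar> * (weight \<eta> (Suc m) n * real (Suc n) / real (Suc m))"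
      by (simp add: int_t_nth deriv_z_nth abs_mult del: of_nat_Suc)
    also have "\<dots> = \<eta> * (\<bar>a $ m $ Suc n\<bar> * weight \<eta> m (Suc n))"
      unfolding weight_shift_both[OF assms] by simp
    finally show "\<bar>?b $ Suc m $ n\<bar> * weight \<eta> (Suc m) n
        = \<eta> * (\<bar>a $ m $ Suc n\<bar> * weight \<eta> m (Suc n))" .
  qed
  also have "\<dots> = (\<Sum>(m, n)\<in>(\<lambda>(m, n). (m, Suc n)) ` ?D. \<eta> * (\<bar>a $ m $ n\<bar> * weight \<eta> m n))"
    by (subst sum.reindex) (auto simp: inj_on_def case_prod_unfold)
  also have "\<dots> \<le> (\<Sum>(m, n)\<in>degs k. \<eta> * (\<bar>a $ m $ n\<bar> * weight \<eta> m n))"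
    using weight_pos[OF assms] assms by (intro sum_mono2) (auto simp: less_imp_le)
  also have "\<dots> = \<eta> * fnorm \<eta> k a"
    by (simp add: fnorm_def sum_distrib_left case_prod_unfold)
  finally show ?thesis .
qed

lemma fnorm_tendsto_zero:
  assumes "\<And>m n. (\<lambda>j. c j $ m $ n) \<longlonglongrightarrow> w $ m $ n"
  shows "(\<lambda>j. fnorm \<eta> k (c j - w)) \<longlonglongrightarrow> 0"
proof -
  have "(\<lambda>j. fnorm \<eta> k (c j - w)) \<longlonglongrightarrow> (\<Sum>(m, n)\<in>degs k. \<bar>w $ m $ n - w $ m $ n\<bar> * weight \<eta> m n)"
    unfolding fnorm_def case_prod_unfold fps_sub_nth by (intro tendsto_intros assms)
  then show ?thesis by simp
qed

text \<open>Picard iteration from 0. Successive iterates differ by at most M/2^j in every truncated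
  norm, so each single coefficient converges, and the limit series is assembled from these limits.
  The bound M survives because each truncated norm involves finitely many coefficients.\<close>

lemma fps2_contraction_fixed_point:
  fixes P :: "fps2 \<Rightarrow> fps2"
  assumes \<eta>: "\<eta> > 0" and M: "M \<ge> 0"
    and ball: "\<And>k a. fnorm \<eta> k a \<le> M \<Longrightarrow> fnorm \<eta> k (P a) \<le> M"
    and lip: "\<And>k a b. fnorm \<eta> k a \<le> M \<Longrightarrow> fnorm \<eta> k b \<le> M \<Longrightarrow>
      fnorm \<eta> k (P a - P b) \<le> fnorm \<eta> k (a - b) / 2"
  obtains w where "P w = w" "\<And>k. fnorm \<eta> k w \<le> M"
proof -
  define c where "c = (\<lambda>j. (P ^^ j) 0)"
  have c_Suc: "c (Suc j) = P (c j)" for j by (simp add: c_def)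
  have cM: "fnorm \<eta> k (c j) \<le> M" for k j
    by (induction j) (use M ball in \<open>auto simp: c_def\<close>)
  have step: "fnorm \<eta> k (c (Suc j) - c j) \<le> M * (1 / 2) ^ j" for k j
  proof (induction j)
    case 0
    show ?case using cM[of k 1] by (simp add: c_def)
  next
    case (Suc j)
    show ?case using lip[OF cM[of k "Suc j"] cM[of k j]] Suc by (simp add: c_Suc)
  qed
  have conv: "convergent (\<lambda>j. c j $ m $ n)" for m n
  proof -
    let ?d = "\<lambda>j. c (Suc j) $ m $ n - c j $ m $ n"
    have bound: "\<bar>?d j\<bar> \<le> M / weight \<eta> m n * (1 / 2) ^ j" for j
    proof -
      have "\<bar>?d j\<bar> * weight \<eta> m n \<le> M * (1 / 2) ^ j"
        using fnorm_coeff_le[OF \<eta>, of m n "m + n" "c (Suc j) - c j"] step[of "m + n" j] by simp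
      then show ?thesis
        using weight_pos[OF \<eta>, of m n] by (simp add: pos_le_divide_eq)
    qed
    have "summable (\<lambda>j. M / weight \<eta> m n * (1 / 2 :: real) ^ j)"
      by (intro summable_mult summable_geometric) simp
    then have "summable ?d"
      by (rule summable_comparison_test') (simp only: real_norm_def bound)
    then have "convergent (\<lambda>j. \<Sum>i<j. ?d i)" by (simp add: summable_iff_convergent)
    then have "convergent (\<lambda>j. c 0 $ m $ n + (\<Sum>i<j. ?d i))"
      by (intro convergent_add convergent_const)
    then show ?thesis by (simp add: sum_lessThan_telescope[of "\<lambda>j. c j $ m $ n"])
  qed
  define w where "w = Abs_fps (\<lambda>m. Abs_fps (\<lambda>n. lim (\<lambda>j. c j $ m $ n)))"
  have lim: "(\<lambda>j. c j $ m $ n) \<longlonglongrightarrow> w $ m $ n" for m n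
    using conv[of m n] by (simp add: w_def convergent_LIMSEQ_iff)
  have dist0: "(\<lambda>j. fnorm \<eta> k (c j - w)) \<longlonglongrightarrow> 0" for k
    by (rule fnorm_tendsto_zero[OF lim])
  have wM: "fnorm \<eta> k w \<le> M" for k
  proof -
    have "(\<lambda>j. M + fnorm \<eta> k (c j - w)) \<longlonglongrightarrow> M + 0"
      by (intro tendsto_intros dist0)
    moreover have "fnorm \<eta> k w \<le> M + fnorm \<eta> k (c j - w)" for j
      using fnorm_triangle_minus[OF \<eta>, of k "c j" "c j - w"] cM[of k j] by simp
    ultimately show ?thesis
      by (metis (no_types, lifting) LIMSEQ_le_const add.right_neutral)
  qed
  \<comment> \<open>Compare through the iterates: P w - w = (P w - P c_j) + (c_(j+1) - w), and both
    parts tend to 0.\<close>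
  have fix0: "fnorm \<eta> k (P w - w) \<le> 0" for k
  proof -
    have "(\<lambda>j. fnorm \<eta> k (c j - w) / 2 + fnorm \<eta> k (c (Suc j) - w)) \<longlonglongrightarrow> 0 / 2 + 0"
      by (intro tendsto_intros dist0 LIMSEQ_Suc[OF dist0]) simp
    moreover have "fnorm \<eta> k (P w - w) \<le> fnorm \<eta> k (c j - w) / 2 + fnorm \<eta> k (c (Suc j) - w)" for j
      using fnorm_triangle[OF \<eta>, of k "P w - P (c j)" "c (Suc j) - w"]
        lip[OF wM[of k] cM[of k j]] fnorm_minus_commute[of \<eta> k w "c j"] by (simp add: c_Suc)
    ultimately show ?thesis by (auto intro: LIMSEQ_le_const)
  qed
  have "P w = w"
  proof (rule fps2_eqI)
    fix m n
    have "\<bar>(P w - w) $ m $ n\<bar> * weight \<eta> m n \<le> 0"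
      using fnorm_coeff_le[OF \<eta>, of m n "m + n" "P w - w"] fix0[of "m + n"] by simp
    then show "P w $ m $ n = w $ m $ n"
      using weight_pos[OF \<eta>, of m n] by (simp add: mult_le_0_iff)
  qed
  then show thesis using wM by (rule that)
qed

section \<open>Evaluation of double power series\<close>

text \<open>The Cauchy estimates of a function analytic in both variables; they give convergence
  where both variables are smaller than 1/\<sigma> in absolute value.\<close>

definition conv2 :: "real \<Rightarrow> fps2 \<Rightarrow> bool" where
  "conv2 \<sigma> a \<longleftrightarrow> (\<exists>C. \<forall>m n. \<bar>a $ m $ n\<bar> \<le> C * \<sigma> ^ (m + n))"

text \<open>Evaluating the inner variable leaves an ordinary power series in t. Double series are
  thus summed iteratively, and the one-variable theory applies twice.\<close>

definition slice :: "fps2 \<Rightarrow> real \<Rightarrow> real fps" where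
  "slice a z = Abs_fps (\<lambda>m. eval_fps (a $ m) z)"

definition eval2 :: "fps2 \<Rightarrow> real \<Rightarrow> real \<Rightarrow> real" where
  "eval2 a t z = eval_fps (slice a z) t"

definition square :: "real \<Rightarrow> (real \<times> real) set" where
  "square \<rho> = {-\<rho><..<\<rho>} \<times> {-\<rho><..<\<rho>}"

lemma square_iff: "(t, z) \<in> square \<rho> \<longleftrightarrow> \<bar>t\<bar> < \<rho> \<and> \<bar>z\<bar> < \<rho>"
  by (auto simp: square_def)

lemma eval2_int_t_0: "eval2 (int_t a) 0 z = 0"
  by (simp add: eval2_def eval_fps_at_0 slice_def int_t_nth)

lemma geometric_bound_summable:
  fixes f :: "real fps"
  assumes f: "\<And>n. \<bar>f $ n\<bar> \<le> C * \<sigma> ^ n" and "\<sigma> > 0" "\<bar>z\<bar> * \<sigma> < 1"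
  shows "summable (\<lambda>n. \<bar>f $ n * z ^ n\<bar>)" "\<bar>eval_fps f z\<bar> \<le> C / (1 - \<bar>z\<bar> * \<sigma>)"
proof -
  have C: "C \<ge> 0" using f[of 0] by simp
  have g: "(\<lambda>n. C * (\<bar>z\<bar> * \<sigma>) ^ n) sums (C * (1 / (1 - \<bar>z\<bar> * \<sigma>)))"
    using assms by (intro sums_mult geometric_sums) (simp add: abs_mult)
  have le: "\<bar>f $ n * z ^ n\<bar> \<le> C * (\<bar>z\<bar> * \<sigma>) ^ n" for n
    using mult_right_mono[OF f[of n], of "\<bar>z\<bar> ^ n"]
    by (simp add: abs_mult power_abs power_mult_distrib mult_ac)
  show s: "summable (\<lambda>n. \<bar>f $ n * z ^ n\<bar>)"
    by (rule summable_comparison_test'[OF sums_summable[OF g]]) (use le in simp)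
  have "\<bar>eval_fps f z\<bar> \<le> (\<Sum>n. \<bar>f $ n * z ^ n\<bar>)"
    unfolding eval_fps_def by (rule summable_rabs[OF s])
  also have "\<dots> \<le> (\<Sum>n. C * (\<bar>z\<bar> * \<sigma>) ^ n)"
    using le by (intro suminf_le s sums_summable[OF g])
  also have "\<dots> = C / (1 - \<bar>z\<bar> * \<sigma>)" using sums_unique[OF g] by simp
  finally show "\<bar>eval_fps f z\<bar> \<le> C / (1 - \<bar>z\<bar> * \<sigma>)" .
qed

lemma geometric_bound_conv_radius:
  fixes f :: "real fps"
  assumes f: "\<And>n. \<bar>f $ n\<bar> \<le> C * \<sigma> ^ n" and \<sigma>: "\<sigma> > 0" and z: "\<bar>z\<bar> * \<sigma> < 1"
  shows "ereal (norm z) < fps_conv_radius f"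
proof -
  obtain r where r: "\<bar>z\<bar> < r" "r < 1 / \<sigma>"
    using z \<sigma> by (meson dense pos_less_divide_eq)
  have r0: "r > 0" using r by linarith
  have "summable (\<lambda>n. \<bar>f $ n * r ^ n\<bar>)"
    using r r0 \<sigma> by (intro geometric_bound_summable[OF f \<sigma>]) (simp add: field_simps)
  then have "summable (\<lambda>n. f $ n * r ^ n)"
    by (rule summable_rabs_cancel)
  then have "ereal (norm r) \<le> fps_conv_radius f"
    unfolding fps_conv_radius_def by (rule conv_radius_geI)
  then show ?thesis
    using r r0 by (simp add: less_le_trans[of _ "ereal r"])
qed

context
  fixes \<sigma> \<rho> :: real
  assumes \<sigma>: "\<sigma> > 0" and \<rho>: "\<rho> = 1 / \<sigma>"
begin

lemma less_rho: "\<bar>z\<bar> < \<rho> \<Longrightarrow> \<bar>z\<bar> * \<sigma> < 1"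
  using \<sigma> by (simp add: \<rho> field_simps)

lemma conv2_inner_radius:
  assumes "conv2 \<sigma> a" "\<bar>z\<bar> < \<rho>"
  shows "ereal (norm z) < fps_conv_radius (a $ m)"
proof -
  obtain C where C: "\<And>m n. \<bar>a $ m $ n\<bar> \<le> C * \<sigma> ^ (m + n)"
    using assms(1) by (auto simp: conv2_def)
  have "\<bar>a $ m $ n\<bar> \<le> C * \<sigma> ^ m * \<sigma> ^ n" for n
    using C[of m n] by (simp add: power_add mult.assoc)
  then show ?thesis
    by (rule geometric_bound_conv_radius[OF _ \<sigma> less_rho[OF assms(2)]])
qed

text \<open>One constant serves all |z| \<le> r, which makes the slice estimate uniform in z as the
  Weierstrass test requires.\<close>

lemma conv2_slice_bound:
  assumes "conv2 \<sigma> a"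
  obtains C where "C \<ge> 0"
    "\<And>r z m. r < \<rho> \<Longrightarrow> \<bar>z\<bar> \<le> r \<Longrightarrow> \<bar>eval_fps (a $ m) z\<bar> \<le> C / (1 - r * \<sigma>) * \<sigma> ^ m"
proof -
  obtain C where C: "\<And>m n. \<bar>a $ m $ n\<bar> \<le> C * \<sigma> ^ (m + n)"
    using assms(1) by (auto simp: conv2_def)
  have C0: "C \<ge> 0" using C[of 0 0] by simp
  show thesis
  proof (rule that[OF C0])
    fix r z m assume r: "r < \<rho>" "\<bar>z\<bar> \<le> r"
    have r1: "r * \<sigma> < 1" using r less_rho[of r] by simp
    have zr: "\<bar>z\<bar> * \<sigma> \<le> r * \<sigma>" using r \<sigma> by (intro mult_right_mono) auto
    then have z1: "\<bar>z\<bar> * \<sigma> < 1" using r1 by linarith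
    have "\<bar>a $ m $ n\<bar> \<le> C * \<sigma> ^ m * \<sigma> ^ n" for n
      using C[of m n] by (simp add: power_add mult.assoc)
    then have "\<bar>eval_fps (a $ m) z\<bar> \<le> C * \<sigma> ^ m / (1 - \<bar>z\<bar> * \<sigma>)"
      using z1 by (intro geometric_bound_summable(2)[OF _ \<sigma>]) simp_all
    also have "\<dots> \<le> C * \<sigma> ^ m / (1 - r * \<sigma>)"
      using C0 \<sigma> r1 zr z1 by (intro divide_left_mono mult_pos_pos) auto
    finally show "\<bar>eval_fps (a $ m) z\<bar> \<le> C / (1 - r * \<sigma>) * \<sigma> ^ m" by simp
  qed
qed

lemma conv2_outer_radius:
  assumes "conv2 \<sigma> a" "(t, z) \<in> square \<rho>"
  shows "ereal (norm t) < fps_conv_radius (slice a z)"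
proof -
  obtain C where "C \<ge> 0"
    "\<And>r z m. r < \<rho> \<Longrightarrow> \<bar>z\<bar> \<le> r \<Longrightarrow> \<bar>eval_fps (a $ m) z\<bar> \<le> C / (1 - r * \<sigma>) * \<sigma> ^ m"
    using conv2_slice_bound[OF assms(1)] by blast
  then have "\<bar>slice a z $ m\<bar> \<le> C / (1 - \<bar>z\<bar> * \<sigma>) * \<sigma> ^ m" for m
    using assms(2) by (simp add: slice_def square_iff)
  then show ?thesis
    by (rule geometric_bound_conv_radius[OF _ \<sigma> less_rho]) (use assms(2) in \<open>simp add: square_iff\<close>)
qed

lemma eval2_mult:
  assumes "conv2 \<sigma> a" "conv2 \<sigma> b" "(t, z) \<in> square \<rho>"
  shows "eval2 (a * b) t z = eval2 a t z * eval2 b t z"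
proof -
  have z: "\<bar>z\<bar> < \<rho>" using assms(3) by (simp add: square_iff)
  have rad: "ereal (norm z) < fps_conv_radius (a $ i * b $ j)" for i j
    using conv2_inner_radius[OF assms(1) z, of i] conv2_inner_radius[OF assms(2) z, of j]
    by (simp add: less_le_trans[OF _ fps_conv_radius_mult])
  \<comment> \<open>Evaluation is additive only inside the radii of convergence, so the induction
    carries the radius of the partial sum along with its value.\<close>
  have sum: "eval_fps (\<Sum>i\<in>I. a $ i * b $ (m - i)) z = (\<Sum>i\<in>I. eval_fps (a $ i * b $ (m - i)) z)
      \<and> ereal (norm z) < fps_conv_radius (\<Sum>i\<in>I. a $ i * b $ (m - i))"
    if "finite I" for I m
    using that
  proof induction
    case (insert i I)
    have "ereal (norm z) < fps_conv_radius (a $ i * b $ (m - i) + (\<Sum>i\<in>I. a $ i * b $ (m - i)))"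
      using insert.IH rad[of i "m - i"] by (simp add: less_le_trans[OF _ fps_conv_radius_add])
    then show ?case using insert rad[of i "m - i"] by (simp add: eval_fps_add)
  qed simp
  have "slice (a * b) z = slice a z * slice b z"
    by (rule fps_ext)
      (simp add: slice_def fps_mult_nth sum eval_fps_mult
        conv2_inner_radius[OF assms(1) z, unfolded real_norm_def]
        conv2_inner_radius[OF assms(2) z, unfolded real_norm_def])
  then show ?thesis
    using conv2_outer_radius[OF assms(1,3)] conv2_outer_radius[OF assms(2,3)]
    by (simp add: eval2_def eval_fps_mult)
qed

lemma eval2_add:
  assumes "conv2 \<sigma> a" "conv2 \<sigma> b" "(t, z) \<in> square \<rho>"
  shows "eval2 (a + b) t z = eval2 a t z + eval2 b t z"
proof -
  have z: "\<bar>z\<bar> < \<rho>" using assms(3) by (simp add: square_iff)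
  have "slice (a + b) z = slice a z + slice b z"
    by (rule fps_ext)
      (simp add: slice_def eval_fps_add
        conv2_inner_radius[OF assms(1) z, unfolded real_norm_def]
        conv2_inner_radius[OF assms(2) z, unfolded real_norm_def])
  then show ?thesis
    using conv2_outer_radius[OF assms(1,3)] conv2_outer_radius[OF assms(2,3)]
    by (simp add: eval2_def eval_fps_add)
qed

lemma eval2_minus:
  assumes "conv2 \<sigma> a" "(t, z) \<in> square \<rho>"
  shows "eval2 (- a) t z = - eval2 a t z"
proof -
  have z: "\<bar>z\<bar> < \<rho>" using assms(2) by (simp add: square_iff)
  have "slice (- a) z = - slice a z"
    by (rule fps_ext) (simp add: slice_def eval_fps_minus
        conv2_inner_radius[OF assms(1) z, unfolded real_norm_def])
  then show ?thesis
    using conv2_outer_radius[OF assms] by (simp add: eval2_def eval_fps_minus)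
qed

lemma eval2_int_t:
  assumes "conv2 \<sigma> a" and c: "conv2 \<sigma> (int_t a)" and tz: "(t, z) \<in> square \<rho>"
  shows "((\<lambda>t. eval2 (int_t a) t z) has_real_derivative eval2 a t z) (at t)"
proof -
  have z: "\<bar>z\<bar> < \<rho>" using tz by (simp add: square_iff)
  have "fps_deriv (slice (int_t a) z) $ m = slice a z $ m" for m
  proof -
    have "int_t a $ Suc m = fps_const (1 / real (Suc m)) * a $ m"
      by (simp add: int_t_def del: of_nat_Suc)
    then show ?thesis
      using eval_fps_mult[OF _ conv2_inner_radius[OF assms(1) z, of m], of "fps_const (1 / real (Suc m))"]
      by (simp add: slice_def fps_deriv_nth del: of_nat_Suc)
  qed
  then have "fps_deriv (slice (int_t a) z) = slice a z" by (rule fps_ext)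
  then show "((\<lambda>t. eval2 (int_t a) t z) has_real_derivative eval2 a t z) (at t)"
    unfolding eval2_def
    using has_field_derivative_eval_fps[OF conv2_outer_radius[OF c tz]] by simp
qed

text \<open>On a smaller closed square the slice bound gives a geometric majorant with ratio r
  \<sigma> < 1.\<close>

lemma eval2_series_uniform:
  assumes "conv2 \<sigma> a" "0 \<le> r" "r < \<rho>"
  shows "uniformly_convergent_on ({-r..r} \<times> {-r..r})
    (\<lambda>N (t, z). \<Sum>m<N. eval_fps (a $ m) z * t ^ m)"
proof -
  obtain C where C: "C \<ge> 0"
    "\<And>r z m. r < \<rho> \<Longrightarrow> \<bar>z\<bar> \<le> r \<Longrightarrow> \<bar>eval_fps (a $ m) z\<bar> \<le> C / (1 - r * \<sigma>) * \<sigma> ^ m"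
    using conv2_slice_bound[OF assms(1)] by blast
  let ?M = "\<lambda>m. C / (1 - r * \<sigma>) * (r * \<sigma>) ^ m"
  have "uniformly_convergent_on ({-r..r} \<times> {-r..r})
      (\<lambda>N x. \<Sum>m<N. eval_fps (a $ m) (snd x) * fst x ^ m)"
  proof (rule Weierstrass_m_test')
    fix m and x :: "real \<times> real" assume "x \<in> {-r..r} \<times> {-r..r}"
    then have x: "\<bar>fst x\<bar> \<le> r" "\<bar>snd x\<bar> \<le> r" by (auto simp: mem_Times_iff)
    have "\<bar>eval_fps (a $ m) (snd x)\<bar> * \<bar>fst x\<bar> ^ m \<le> (C / (1 - r * \<sigma>) * \<sigma> ^ m) * r ^ m"
      using C(1) C(2)[OF assms(3) x(2), of m] x assms less_rho[of r] \<sigma>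
      by (intro mult_mono power_mono) auto
    then show "norm (eval_fps (a $ m) (snd x) * fst x ^ m) \<le> ?M m"
      by (simp add: abs_mult power_abs power_mult_distrib mult_ac)
  next
    show "summable ?M"
      using assms less_rho[of r] \<sigma> by (intro summable_mult summable_geometric) (simp add: abs_mult)
  qed
  then show ?thesis by (simp add: case_prod_unfold)
qed

lemma eval2_eq: "eval2 a t z = (\<Sum>m. eval_fps (a $ m) z * t ^ m)"
  unfolding eval2_def eval_fps_def[of "slice a z"] by (simp add: slice_def)

lemma square_inner:
  assumes "x \<in> square \<rho>"
  obtains r where "0 < r" "r < \<rho>" "x \<in> square r"
proof -
  have "max \<bar>fst x\<bar> \<bar>snd x\<bar> < \<rho>" "0 < \<rho>" using assms \<sigma> by (auto simp: square_def \<rho>)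
  then obtain r where "max \<bar>fst x\<bar> \<bar>snd x\<bar> < r" "r < \<rho>" using dense by blast
  moreover from this have "0 < r" by linarith
  ultimately show thesis using that[of r] by (cases x) (auto simp: square_iff)
qed

lemma continuous_on_eval2:
  assumes "conv2 \<sigma> a"
  shows "continuous_on (square \<rho>) (\<lambda>(t, z). eval2 a t z)"
proof -
  have "isCont (\<lambda>(t, z). eval2 a t z) x" if x: "x \<in> square \<rho>" for x
  proof -
    obtain r where r: "0 < r" "r < \<rho>" "x \<in> square r" using square_inner[OF x] .
    let ?S = "{-r..r} \<times> {-r..r}"
    have ul: "uniform_limit ?S (\<lambda>N (t, z). \<Sum>m<N. eval_fps (a $ m) z * t ^ m)
        (\<lambda>(t, z). eval2 a t z) sequentially"
      using eval2_series_uniform[OF assms _ r(2)] r(1)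
      by (simp add: uniformly_convergent_uniform_limit_iff eval2_eq suminf_eq_lim case_prod_unfold)
    have "continuous_on ?S (\<lambda>(t, z). \<Sum>m<N. eval_fps (a $ m) z * t ^ m)" for N
      unfolding case_prod_unfold
    proof (intro continuous_intros continuous_on_compose2[OF continuous_on_eval_fps])
      fix m
      show "snd ` ?S \<subseteq> eball 0 (fps_conv_radius (a $ m))"
        using conv2_inner_radius[OF assms] r(2) by auto
    qed
    then have "continuous_on ?S (\<lambda>(t, z). eval2 a t z)"
      by (intro uniform_limit_theorem[OF _ ul]) auto
    then have "continuous_on (square r) (\<lambda>(t, z). eval2 a t z)"
      by (rule continuous_on_subset) (auto simp: square_def)
    moreover have "open (square r)" by (auto simp: square_def intro: open_Times)
    ultimately show ?thesis using r(3) by (simp add: continuous_on_eq_continuous_at)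
  qed
  then show ?thesis by (simp add: continuous_at_imp_continuous_on)
qed

text \<open>Differentiation term by term in the outer series: the differentiated terms converge
  uniformly in z by the bound for \<open>deriv_z a\<close>.\<close>

lemma eval2_deriv_z:
  assumes a: "conv2 \<sigma> a" "conv2 \<sigma> (deriv_z a)" and tz: "(t, z) \<in> square \<rho>"
  shows "((\<lambda>z. eval2 a t z) has_real_derivative eval2 (deriv_z a) t z) (at z)"
proof -
  obtain r where r: "0 < r" "r < \<rho>" "(t, z) \<in> square r" using square_inner[OF tz] .
  let ?S = "{-r..r}"
  have "((\<lambda>z. \<Sum>m. eval_fps (a $ m) z * t ^ m) has_field_derivative
      (\<Sum>m. eval_fps (deriv_z a $ m) z * t ^ m)) (at z)"
  proof (rule has_field_derivative_series'(2))
    show "convex ?S" by simp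
    show "((\<lambda>z. eval_fps (a $ m) z * t ^ m) has_field_derivative eval_fps (deriv_z a $ m) y * t ^ m)
        (at y within ?S)" if "y \<in> ?S" for m y
    proof -
      have "\<bar>y\<bar> < \<rho>" using that r by auto
      then have "(eval_fps (a $ m) has_field_derivative eval_fps (fps_deriv (a $ m)) y) (at y)"
        by (intro has_field_derivative_eval_fps conv2_inner_radius[OF a(1)])
      from DERIV_cmult_right[OF this, of "t ^ m"] show ?thesis
        by (simp add: deriv_z_def has_field_derivative_at_within)
    qed
    show "uniformly_convergent_on ?S (\<lambda>N z. \<Sum>m<N. eval_fps (deriv_z a $ m) z * t ^ m)"
    proof -
      obtain l where l: "uniform_limit (?S \<times> ?S)
          (\<lambda>N (t, z). \<Sum>m<N. eval_fps (deriv_z a $ m) z * t ^ m) l sequentially"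
        using eval2_series_uniform[OF a(2) _ r(2)] r(1)
        by (auto simp: uniformly_convergent_on_def)
      have "(\<lambda>z. (t, z)) \<in> ?S \<rightarrow> ?S \<times> ?S" using r(3) by (auto simp: square_def)
      from uniform_limit_compose'[OF l this] show ?thesis
        by (auto simp: uniformly_convergent_on_def)
    qed
    show "0 \<in> ?S" using r(1) by simp
    show "summable (\<lambda>m. eval_fps (a $ m) 0 * t ^ m)"
      using summable_fps[OF conv2_outer_radius[OF a(1), of t 0]] tz r
      by (simp add: square_iff slice_def)
    show "z \<in> interior ?S" using r(3) by (simp add: square_def)
  qed
  then show ?thesis by (simp add: eval2_eq)
qed

text \<open>Total differentiability from the two partial derivatives and continuity of the one in z.
  The assumptions concern \<open>int_t (deriv_z a)\<close> because the weighted norm controls the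
  z-derivative in this integrated form.\<close>

lemma eval2_int_t_has_derivative:
  assumes a: "conv2 \<sigma> a" "conv2 \<sigma> (int_t a)" "conv2 \<sigma> (int_t (deriv_z a))"
    and x: "x \<in> square \<rho>"
  shows "((\<lambda>(t, z). eval2 (int_t a) t z) has_derivative
    (\<lambda>h. fst h * eval2 a (fst x) (snd x) + snd h * eval2 (int_t (deriv_z a)) (fst x) (snd x))) (at x)"
proof -
  let ?I = "{-\<rho><..<\<rho>}"
  obtain t z where tz: "x = (t, z)" by (cases x)
  have "t \<in> ?I" "z \<in> ?I" using x by (auto simp: tz square_def)
  let ?fy = "\<lambda>t z. blinfun_scaleR_left (eval2 (int_t (deriv_z a)) t z)"
  have cont: "continuous_on (square \<rho>) (\<lambda>(t, z). ?fy t z)"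
    using continuous_on_eval2[OF a(3)] unfolding case_prod_unfold
    by (intro bounded_linear.continuous_on[OF bounded_linear_blinfun_scaleR_left])
  have "((\<lambda>(t, z). eval2 (int_t a) t z) has_derivative
      (\<lambda>(ht, hz). ht * eval2 a t z + ?fy t z hz)) (at (t, z) within ?I \<times> ?I)"
  proof (rule has_derivative_partialsI)
    show "((\<lambda>t. eval2 (int_t a) t z) has_derivative (\<lambda>h. h * eval2 a t z)) (at t within ?I)"
      using eval2_int_t[OF a(1,2) x[unfolded tz]]
      by (auto simp: has_field_derivative_def mult_commute_abs intro: has_derivative_at_withinI)
    show "((\<lambda>z. eval2 (int_t a) t z) has_derivative blinfun_apply (?fy t z)) (at z within ?I)"
      if "t \<in> ?I" "z \<in> ?I" for t z
      using eval2_deriv_z[OF a(2), of t z] a(3) that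
      by (auto simp: has_field_derivative_def mult_commute_abs deriv_z_int_t square_def
          intro: has_derivative_at_withinI)
    show "continuous (at (t, z) within ?I \<times> ?I) (\<lambda>(t, z). ?fy t z)"
      using cont x unfolding tz square_def by (simp add: continuous_on_eq_continuous_within)
  qed (use \<open>z \<in> ?I\<close> in auto)
  moreover have "at (t, z) within ?I \<times> ?I = at (t, z)"
    using \<open>t \<in> ?I\<close> \<open>z \<in> ?I\<close> by (intro at_within_open) (auto intro: open_Times)
  ultimately show ?thesis
    by (simp add: tz case_prod_unfold)
qed

end

text \<open>The binomial coefficient in the weight costs at most 2^(m+n), and \<eta>^(2m+n) is at
  least \<eta>^(2(m+n)). Hence the rate 2/\<eta>^2 and, later, the half side \<eta>^2/2 of the
  square of convergence.\<close>

lemma conv2_if_fnorm_bounded: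
  assumes "0 < \<eta>" "\<eta> \<le> 1" and C: "\<And>k. fnorm \<eta> k a \<le> C"
  shows "conv2 (2 / \<eta>\<^sup>2) a"
  unfolding conv2_def
proof (intro exI allI)
  fix m n
  have C0: "C \<ge> 0" using order_trans[OF fnorm_nonneg C] assms by blast
  have "\<bar>a $ m $ n\<bar> * weight \<eta> m n \<le> C"
    using order_trans[OF fnorm_coeff_le C] assms by blast
  then have "\<bar>a $ m $ n\<bar> \<le> C / weight \<eta> m n"
    using weight_pos[OF assms(1), of m n] by (simp add: pos_le_divide_eq)
  also have "\<dots> = C * (real (m + n choose m) / \<eta> ^ (2 * m + n))"
    by (simp add: weight_def)
  also have "\<dots> \<le> C * (2 ^ (m + n) / \<eta> ^ (2 * (m + n)))"
  proof (intro mult_left_mono frac_le C0)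
    show "real (m + n choose m) \<le> 2 ^ (m + n)"
    proof -
      have "(m + n choose m) \<le> (\<Sum>k\<le>m + n. (m + n choose k))"
        by (intro member_le_sum) auto
      then have "(m + n choose m) \<le> 2 ^ (m + n)" by (simp add: choose_row_sum)
      then show ?thesis by (metis of_nat_le_iff of_nat_numeral of_nat_power)
    qed
    show "\<eta> ^ (2 * (m + n)) \<le> \<eta> ^ (2 * m + n)"
      using assms by (intro power_decreasing) auto
  qed (use assms in auto)
  also have "\<dots> = C * (2 / \<eta>\<^sup>2) ^ (m + n)"
    by (simp only: power_divide power_mult)
  finally show "\<bar>a $ m $ n\<bar> \<le> C * (2 / \<eta>\<^sup>2) ^ (m + n)" .
qed

section \<open>Power series solution of the Cauchy problem\<close>

definition int_dz :: "fps2 \<Rightarrow> fps2" where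
  "int_dz a = int_t (deriv_z a)"

lemma int_dz_diff: "int_dz (a - b) = int_dz a - int_dz b"
  by (simp add: int_dz_def int_t_diff deriv_z_diff)

text \<open>Size and Lipschitz constant are both O(\<eta>^j), with C independent of \<eta> and of
  the truncation, so that \<eta> can be chosen last. On the ball of radius 2 there is room for a
  constant of norm at most 1 together with a small perturbation.\<close>

definition order_map :: "nat \<Rightarrow> (fps2 \<Rightarrow> fps2) \<Rightarrow> bool" where
  "order_map j f \<longleftrightarrow> (\<exists>C\<ge>0. \<forall>\<eta> k a b. 0 < \<eta> \<and> \<eta> \<le> 1 \<and> fnorm \<eta> k a \<le> 2 \<and> fnorm \<eta> k b \<le> 2 \<longrightarrow>
     fnorm \<eta> k (f a) \<le> C * \<eta> ^ j \<and> fnorm \<eta> k (f a - f b) \<le> C * \<eta> ^ j * fnorm \<eta> k (a - b))"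

text \<open>Agreement up to terms that, together with their Lipschitz constants, are \<open>O(\<eta>)\<close>.\<close>

definition approx :: "(fps2 \<Rightarrow> fps2) \<Rightarrow> (fps2 \<Rightarrow> fps2) \<Rightarrow> bool" where
  "approx f g \<longleftrightarrow> order_map 0 f \<and> order_map 0 g \<and> order_map 1 (\<lambda>a. f a - g a)"

lemma order_mapI:
  assumes "C \<ge> 0"
    and "\<And>\<eta> k a b. 0 < \<eta> \<Longrightarrow> \<eta> \<le> 1 \<Longrightarrow> fnorm \<eta> k a \<le> 2 \<Longrightarrow> fnorm \<eta> k b \<le> 2 \<Longrightarrow>
      fnorm \<eta> k (f a) \<le> C * \<eta> ^ j"
    and "\<And>\<eta> k a b. 0 < \<eta> \<Longrightarrow> \<eta> \<le> 1 \<Longrightarrow> fnorm \<eta> k a \<le> 2 \<Longrightarrow> fnorm \<eta> k b \<le> 2 \<Longrightarrow>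
      fnorm \<eta> k (f a - f b) \<le> C * \<eta> ^ j * fnorm \<eta> k (a - b)"
  shows "order_map j f"
  using assms unfolding order_map_def by (intro exI[of _ C]) blast

lemma order_mapE:
  assumes "order_map j f"
  obtains C where "C \<ge> 0"
    "\<And>\<eta> k a. 0 < \<eta> \<Longrightarrow> \<eta> \<le> 1 \<Longrightarrow> fnorm \<eta> k a \<le> 2 \<Longrightarrow> fnorm \<eta> k (f a) \<le> C * \<eta> ^ j"
    "\<And>\<eta> k a b. 0 < \<eta> \<Longrightarrow> \<eta> \<le> 1 \<Longrightarrow> fnorm \<eta> k a \<le> 2 \<Longrightarrow> fnorm \<eta> k b \<le> 2 \<Longrightarrow>
      fnorm \<eta> k (f a - f b) \<le> C * \<eta> ^ j * fnorm \<eta> k (a - b)"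
  using assms unfolding order_map_def by blast

lemma order_map_add:
  assumes "order_map j f" "order_map j g"
  shows "order_map j (\<lambda>a. f a + g a)"
proof -
  obtain C where C: "C \<ge> 0"
    "\<And>\<eta> k a. 0 < \<eta> \<Longrightarrow> \<eta> \<le> 1 \<Longrightarrow> fnorm \<eta> k a \<le> 2 \<Longrightarrow> fnorm \<eta> k (f a) \<le> C * \<eta> ^ j"
    "\<And>\<eta> k a b. 0 < \<eta> \<Longrightarrow> \<eta> \<le> 1 \<Longrightarrow> fnorm \<eta> k a \<le> 2 \<Longrightarrow> fnorm \<eta> k b \<le> 2 \<Longrightarrow>
      fnorm \<eta> k (f a - f b) \<le> C * \<eta> ^ j * fnorm \<eta> k (a - b)"
    using order_mapE[OF assms(1)] by metis
  obtain D where D: "D \<ge> 0"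
    "\<And>\<eta> k a. 0 < \<eta> \<Longrightarrow> \<eta> \<le> 1 \<Longrightarrow> fnorm \<eta> k a \<le> 2 \<Longrightarrow> fnorm \<eta> k (g a) \<le> D * \<eta> ^ j"
    "\<And>\<eta> k a b. 0 < \<eta> \<Longrightarrow> \<eta> \<le> 1 \<Longrightarrow> fnorm \<eta> k a \<le> 2 \<Longrightarrow> fnorm \<eta> k b \<le> 2 \<Longrightarrow>
      fnorm \<eta> k (g a - g b) \<le> D * \<eta> ^ j * fnorm \<eta> k (a - b)"
    using order_mapE[OF assms(2)] by metis
  show ?thesis
  proof (rule order_mapI[of "C + D"])
    fix \<eta> k a b assume h: "0 < \<eta>" "\<eta> \<le> 1" "fnorm \<eta> k a \<le> 2" "fnorm \<eta> k b \<le> 2"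
    show "fnorm \<eta> k (f a + g a) \<le> (C + D) * \<eta> ^ j"
      using fnorm_triangle[OF h(1), of k "f a" "g a"] C(2)[OF h(1-3)] D(2)[OF h(1-3)]
      by (simp add: distrib_right)
    have e: "(f a + g a) - (f b + g b) = (f a - f b) + (g a - g b)" by simp
    show "fnorm \<eta> k ((f a + g a) - (f b + g b)) \<le> (C + D) * \<eta> ^ j * fnorm \<eta> k (a - b)"
      unfolding e
      using fnorm_triangle[OF h(1), of k "f a - f b" "g a - g b"] C(3)[OF h] D(3)[OF h]
      by (simp add: distrib_right)
  qed (use C D in auto)
qed

lemma order_map_mult:
  assumes "order_map i f" "order_map j g"
  shows "order_map (i + j) (\<lambda>a. f a * g a)"
proof -
  obtain C where C: "C \<ge> 0"
    "\<And>\<eta> k a. 0 < \<eta> \<Longrightarrow> \<eta> \<le> 1 \<Longrightarrow> fnorm \<eta> k a \<le> 2 \<Longrightarrow> fnorm \<eta> k (f a) \<le> C * \<eta> ^ i"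
    "\<And>\<eta> k a b. 0 < \<eta> \<Longrightarrow> \<eta> \<le> 1 \<Longrightarrow> fnorm \<eta> k a \<le> 2 \<Longrightarrow> fnorm \<eta> k b \<le> 2 \<Longrightarrow>
      fnorm \<eta> k (f a - f b) \<le> C * \<eta> ^ i * fnorm \<eta> k (a - b)"
    using order_mapE[OF assms(1)] by metis
  obtain D where D: "D \<ge> 0"
    "\<And>\<eta> k a. 0 < \<eta> \<Longrightarrow> \<eta> \<le> 1 \<Longrightarrow> fnorm \<eta> k a \<le> 2 \<Longrightarrow> fnorm \<eta> k (g a) \<le> D * \<eta> ^ j"
    "\<And>\<eta> k a b. 0 < \<eta> \<Longrightarrow> \<eta> \<le> 1 \<Longrightarrow> fnorm \<eta> k a \<le> 2 \<Longrightarrow> fnorm \<eta> k b \<le> 2 \<Longrightarrow>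
      fnorm \<eta> k (g a - g b) \<le> D * \<eta> ^ j * fnorm \<eta> k (a - b)"
    using order_mapE[OF assms(2)] by metis
  have mult: "fnorm \<eta> k (x * y) \<le> X * Y"
    if "0 < \<eta>" "fnorm \<eta> k x \<le> X" "fnorm \<eta> k y \<le> Y" for \<eta> k x y X Y
    using that fnorm_mult[OF that(1), of k x y] fnorm_nonneg[OF that(1), of k x]
      fnorm_nonneg[OF that(1), of k y]
    by (meson mult_mono order_trans)
  show ?thesis
  proof (rule order_mapI[of "2 * C * D"])
    fix \<eta> k a b assume h: "0 < \<eta>" "\<eta> \<le> 1" "fnorm \<eta> k a \<le> 2" "fnorm \<eta> k b \<le> 2"
    have "0 \<le> C * D * \<eta> ^ (i + j)" using C(1) D(1) h by simp
    then show "fnorm \<eta> k (f a * g a) \<le> 2 * C * D * \<eta> ^ (i + j)"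
      using mult[OF h(1) C(2)[OF h(1-3)] D(2)[OF h(1-3)]] by (simp add: power_add algebra_simps)
    have "f a * g a - f b * g b = (f a - f b) * g a + f b * (g a - g b)"
      by (simp add: algebra_simps)
    moreover have "fnorm \<eta> k ((f a - f b) * g a) \<le> C * D * \<eta> ^ (i + j) * fnorm \<eta> k (a - b)"
      using mult[OF h(1) C(3)[OF h] D(2)[OF h(1-3)]] by (simp add: power_add algebra_simps)
    moreover have "fnorm \<eta> k (f b * (g a - g b)) \<le> C * D * \<eta> ^ (i + j) * fnorm \<eta> k (a - b)"
      using mult[OF h(1) C(2)[OF h(1,2,4)] D(3)[OF h]] by (simp add: power_add algebra_simps)
    ultimately show "fnorm \<eta> k (f a * g a - f b * g b) \<le> 2 * C * D * \<eta> ^ (i + j) * fnorm \<eta> k (a - b)"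
      using fnorm_triangle[OF h(1), of k "(f a - f b) * g a" "f b * (g a - g b)"] by simp
  qed (use C D in auto)
qed

lemma order_map_uminus:
  assumes "order_map j f"
  shows "order_map j (\<lambda>a. - f a)"
proof -
  have "fnorm \<eta> k (- f a - - f b) = fnorm \<eta> k (f a - f b)" for \<eta> k a b
    by (metis fnorm_minus minus_diff_minus)
  then show ?thesis using assms by (simp add: order_map_def del: minus_diff_minus)
qed

lemma order_map_weaken:
  assumes "order_map (Suc j) f"
  shows "order_map j f"
proof -
  obtain C where C: "C \<ge> 0"
    "\<And>\<eta> k a. 0 < \<eta> \<Longrightarrow> \<eta> \<le> 1 \<Longrightarrow> fnorm \<eta> k a \<le> 2 \<Longrightarrow> fnorm \<eta> k (f a) \<le> C * \<eta> ^ Suc j"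
    "\<And>\<eta> k a b. 0 < \<eta> \<Longrightarrow> \<eta> \<le> 1 \<Longrightarrow> fnorm \<eta> k a \<le> 2 \<Longrightarrow> fnorm \<eta> k b \<le> 2 \<Longrightarrow>
      fnorm \<eta> k (f a - f b) \<le> C * \<eta> ^ Suc j * fnorm \<eta> k (a - b)"
    using order_mapE[OF assms] by metis
  show ?thesis
  proof (rule order_mapI[OF C(1)])
    fix \<eta> k a b assume h: "0 < (\<eta> :: real)" "\<eta> \<le> 1" "fnorm \<eta> k a \<le> 2" "fnorm \<eta> k b \<le> 2"
    have le: "C * \<eta> ^ Suc j \<le> C * \<eta> ^ j"
      using C(1) h by (intro mult_left_mono power_decreasing) auto
    show "fnorm \<eta> k (f a) \<le> C * \<eta> ^ j"
      by (rule order_trans[OF C(2)[OF h(1-3)] le])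
    show "fnorm \<eta> k (f a - f b) \<le> C * \<eta> ^ j * fnorm \<eta> k (a - b)"
      by (rule order_trans[OF C(3)[OF h] mult_right_mono[OF le fnorm_nonneg[OF h(1)]]])
  qed
qed

lemma order_map_const:
  assumes "\<And>\<eta> k. 0 < \<eta> \<Longrightarrow> \<eta> \<le> 1 \<Longrightarrow> fnorm \<eta> k c \<le> C * \<eta> ^ j" "C \<ge> 0"
  shows "order_map j (\<lambda>_. c)"
  using assms fnorm_nonneg by (intro order_mapI[of C]) auto

lemma order_map_const2: "order_map 0 (\<lambda>_. const2 c)"
  by (rule order_map_const[of _ "\<bar>c\<bar>"]) (auto simp: fnorm_const2)

lemma order_map_var_t: "order_map 1 (\<lambda>_. var_t)"
proof (rule order_map_const[of _ 1])
  fix \<eta> :: real and k assume "0 < \<eta>" "\<eta> \<le> 1"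
  then show "fnorm \<eta> k var_t \<le> 1 * \<eta> ^ 1"
    using fnorm_var_t[of \<eta> k] power_decreasing[of 1 2 \<eta>] by simp
qed simp

lemma order_map_var_z: "order_map 1 (\<lambda>_. var_z)"
  by (rule order_map_const[of _ 1]) (auto simp: fnorm_var_z)

lemma order_map_ident: "order_map 0 (\<lambda>a. a)"
  by (rule order_mapI[of 2]) (auto simp: fnorm_nonneg)

text \<open>Linearity transfers the norm estimate of \<open>L\<close> to differences, so both bounds
  gain one factor \<eta>.\<close>

lemma order_map_linear:
  assumes L: "\<And>\<eta> k a. 0 < \<eta> \<Longrightarrow> \<eta> \<le> 1 \<Longrightarrow> fnorm \<eta> k (L a) \<le> \<eta> * fnorm \<eta> k a"
    and diff: "\<And>a b. L (a - b) = L a - L b" and f: "order_map 0 f"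
  shows "order_map 1 (\<lambda>a. L (f a))"
proof -
  obtain C where C: "C \<ge> 0"
    "\<And>\<eta> k a. 0 < \<eta> \<Longrightarrow> \<eta> \<le> 1 \<Longrightarrow> fnorm \<eta> k a \<le> 2 \<Longrightarrow> fnorm \<eta> k (f a) \<le> C * \<eta> ^ 0"
    "\<And>\<eta> k a b. 0 < \<eta> \<Longrightarrow> \<eta> \<le> 1 \<Longrightarrow> fnorm \<eta> k a \<le> 2 \<Longrightarrow> fnorm \<eta> k b \<le> 2 \<Longrightarrow>
      fnorm \<eta> k (f a - f b) \<le> C * \<eta> ^ 0 * fnorm \<eta> k (a - b)"
    using order_mapE[OF f] by metis
  show ?thesis
  proof (rule order_mapI[OF C(1)])
    fix \<eta> k a b assume h: "0 < \<eta>" "\<eta> \<le> 1" "fnorm \<eta> k a \<le> 2" "fnorm \<eta> k b \<le> 2"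
    show "fnorm \<eta> k (L (f a)) \<le> C * \<eta> ^ 1"
      using order_trans[OF L[OF h(1,2)] mult_left_mono[OF C(2)[OF h(1-3)], of \<eta>]] h(1)
      by (simp add: mult.commute)
    show "fnorm \<eta> k (L (f a) - L (f b)) \<le> C * \<eta> ^ 1 * fnorm \<eta> k (a - b)"
      using order_trans[OF L[OF h(1,2)] mult_left_mono[OF C(3)[OF h], of \<eta>]] h(1)
      by (simp add: mult_ac diff)
  qed
qed

lemma fnorm_int_t_le:
  assumes "0 < \<eta>" "\<eta> \<le> 1"
  shows "fnorm \<eta> k (int_t a) \<le> \<eta> * fnorm \<eta> k a"
proof -
  have "\<eta>\<^sup>2 * fnorm \<eta> k a \<le> \<eta> * fnorm \<eta> k a"
    using assms power_decreasing[of 1 2 \<eta>] by (intro mult_right_mono fnorm_nonneg) auto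
  then show ?thesis using fnorm_int_t[OF assms(1), of k a] by linarith
qed

lemma approx_int:
  assumes "order_map 0 f"
  shows "approx (\<lambda>a. int_t (f a)) (\<lambda>_. 0)" "approx (\<lambda>a. int_dz (f a)) (\<lambda>_. 0)"
    "order_map 0 (\<lambda>a. int_t (f a))" "order_map 0 (\<lambda>a. int_dz (f a))"
proof -
  have zero: "order_map 0 (\<lambda>_. 0)" by (rule order_map_const[of _ 0]) auto
  have 1: "order_map 1 (\<lambda>a. int_t (f a))" "order_map 1 (\<lambda>a. int_dz (f a))"
    by (intro order_map_linear fnorm_int_t_le int_t_diff assms; assumption)
      (intro order_map_linear int_dz_diff assms, simp add: int_dz_def fnorm_int_t_deriv_z)
  then show 0: "order_map 0 (\<lambda>a. int_t (f a))" "order_map 0 (\<lambda>a. int_dz (f a))"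
    by (auto intro: order_map_weaken)
  show "approx (\<lambda>a. int_t (f a)) (\<lambda>_. 0)" "approx (\<lambda>a. int_dz (f a)) (\<lambda>_. 0)"
    using zero 0 1 by (auto simp: approx_def)
qed

lemma approx_refl: "order_map 0 f \<Longrightarrow> approx f f"
  unfolding approx_def by (auto intro: order_map_const[of _ 0])

lemma approx_const2: "approx (\<lambda>_. const2 c) (\<lambda>_. const2 c)"
  by (intro approx_refl order_map_const2)

lemma approx_var: "approx (\<lambda>_. var_t) (\<lambda>_. 0)" "approx (\<lambda>_. var_z) (\<lambda>_. 0)"
  using order_map_var_t order_map_var_z order_map_weaken[of 0]
  by (auto simp: approx_def intro: order_map_const[of _ 0])

lemma approx_add:
  assumes "approx f f'" "approx g g'"
  shows "approx (\<lambda>a. f a + g a) (\<lambda>a. f' a + g' a)"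
proof -
  have "(\<lambda>a. (f a + g a) - (f' a + g' a)) = (\<lambda>a. (f a - f' a) + (g a - g' a))" by auto
  then show ?thesis using assms by (simp add: approx_def order_map_add)
qed

lemma approx_uminus:
  assumes "approx f f'"
  shows "approx (\<lambda>a. - f a) (\<lambda>a. - f' a)"
proof -
  have "(\<lambda>a. - f a - - f' a) = (\<lambda>a. - (f a - f' a))" by auto
  then show ?thesis using assms by (simp add: approx_def order_map_uminus del: minus_diff_eq)
qed

lemma approx_diff:
  assumes "approx f f'" "approx g g'"
  shows "approx (\<lambda>a. f a - g a) (\<lambda>a. f' a - g' a)"
  using approx_add[OF assms(1) approx_uminus[OF assms(2)]] by simp

lemma approx_mult:
  assumes "approx f f'" "approx g g'"
  shows "approx (\<lambda>a. f a * g a) (\<lambda>a. f' a * g' a)"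
proof -
  have "(\<lambda>a. f a * g a - f' a * g' a) = (\<lambda>a. (f a - f' a) * g a + f' a * (g a - g' a))"
    by (auto simp: algebra_simps)
  then show ?thesis
    using assms order_map_mult[of 0 f 0 g] order_map_mult[of 0 f' 0 g']
      order_map_mult[of 1 "\<lambda>a. f a - f' a" 0 g] order_map_mult[of 0 f' 1 "\<lambda>a. g a - g' a"]
    by (simp add: approx_def order_map_add)
qed

lemma const2_1: "const2 1 = 1" and const2_numeral: "const2 (numeral n) = numeral n"
  by (simp_all add: const2_def fps_numeral_fps_const[symmetric])

lemma const2_ring: "const2 (c + d) = const2 c + const2 d" "const2 (c * d) = const2 c * const2 d"
  "const2 (- c) = - const2 c" "const2 0 = 0"
  by (simp_all add: const2_def)

lemma approx_one: "approx (\<lambda>_. 1) (\<lambda>_. 1)" and approx_numeral: "approx (\<lambda>_. numeral n) (\<lambda>_. numeral n)"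
  using approx_const2[of 1] approx_const2[of "numeral n"] by (simp_all add: const2_1 const2_numeral)

lemma approx_power:
  assumes "approx f f'"
  shows "approx (\<lambda>a. f a ^ n) (\<lambda>a. f' a ^ n)"
  using assms by (induction n) (auto intro: approx_one approx_mult)

text \<open>These rules act like setting \<eta> = 0: the limit of a composite expression is found by
  replacing variables and integrals by 0 and keeping constants and the unknown.\<close>

lemmas approx_intros = approx_add approx_diff approx_uminus approx_mult approx_power
  approx_one approx_numeral approx_const2 approx_var

text \<open>A map that is constant up to O(\<eta>) becomes a contraction of the ball of radius 2
  once \<eta> is small.\<close>

lemma approx_fixed_point:
  assumes "approx P (\<lambda>_. const2 c)" "\<bar>c\<bar> \<le> 1"
  obtains \<eta> w where "0 < \<eta>" "\<eta> \<le> 1" "P w = w" "\<And>k. fnorm \<eta> k w \<le> 2"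
proof -
  obtain C where C: "C \<ge> 0"
    "\<And>\<eta> k a. 0 < \<eta> \<Longrightarrow> \<eta> \<le> 1 \<Longrightarrow> fnorm \<eta> k a \<le> 2 \<Longrightarrow> fnorm \<eta> k (P a - const2 c) \<le> C * \<eta> ^ 1"
    "\<And>\<eta> k a b. 0 < \<eta> \<Longrightarrow> \<eta> \<le> 1 \<Longrightarrow> fnorm \<eta> k a \<le> 2 \<Longrightarrow> fnorm \<eta> k b \<le> 2 \<Longrightarrow>
      fnorm \<eta> k ((P a - const2 c) - (P b - const2 c)) \<le> C * \<eta> ^ 1 * fnorm \<eta> k (a - b)"
    using assms(1) order_mapE[of 1 "\<lambda>a. P a - const2 c"] unfolding approx_def by metis
  \<comment> \<open>This choice gives C \<eta> \<le> 1/2 and \<eta> \<le> 1 at once, also when C =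
    0. The image then has norm at most 1 + 1/2.\<close>
  define \<eta> where "\<eta> = 1 / (2 * C + 2)"
  have \<eta>: "0 < \<eta>" "\<eta> \<le> 1" "C * \<eta> \<le> 1 / 2"
    using C(1) by (auto simp: \<eta>_def field_simps)
  obtain w where w: "P w = w" "\<And>k. fnorm \<eta> k w \<le> 2"
  proof (rule fps2_contraction_fixed_point[OF \<eta>(1), of 2 P])
    fix k a assume a: "fnorm \<eta> k a \<le> 2"
    show "fnorm \<eta> k (P a) \<le> 2"
      using fnorm_triangle[OF \<eta>(1), of k "P a - const2 c" "const2 c"] C(2)[OF \<eta>(1,2) a] \<eta>(3)
        fnorm_const2[OF \<eta>(1), of k c] assms(2) by simp
    fix b assume b: "fnorm \<eta> k b \<le> 2"
    show "fnorm \<eta> k (P a - P b) \<le> fnorm \<eta> k (a - b) / 2"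
      using C(3)[OF \<eta>(1,2) a b] mult_right_mono[OF \<eta>(3) fnorm_nonneg[OF \<eta>(1)], of k "a - b"] by simp
  qed (use that in auto)
  with \<eta> show thesis by (intro that) auto
qed

section \<open>Bounded series and their values\<close>

definition fbounded :: "real \<Rightarrow> fps2 \<Rightarrow> bool" where
  "fbounded \<eta> a \<longleftrightarrow> (\<exists>C. \<forall>k. fnorm \<eta> k a \<le> C)"

text \<open>Carries the boundedness that every evaluation rule needs along with the value, so that a
  composite expression is evaluated by introduction rules alone.\<close>

definition evals :: "real \<Rightarrow> real \<Rightarrow> real \<Rightarrow> fps2 \<Rightarrow> real \<Rightarrow> bool" where
  "evals \<eta> t z a v \<longleftrightarrow> fbounded \<eta> a \<and> eval2 a t z = v"

context
  fixes \<eta> :: real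
  assumes \<eta>: "0 < \<eta>" "\<eta> \<le> 1"
begin

lemma fbounded_conv2: "fbounded \<eta> a \<Longrightarrow> conv2 (2 / \<eta>\<^sup>2) a"
  using conv2_if_fnorm_bounded[OF \<eta>] by (auto simp: fbounded_def)

lemma half_square: "2 / \<eta>\<^sup>2 > 0" "\<eta>\<^sup>2 / 2 = 1 / (2 / \<eta>\<^sup>2)"
  using \<eta> by auto

lemma fbounded_add: "fbounded \<eta> a \<Longrightarrow> fbounded \<eta> b \<Longrightarrow> fbounded \<eta> (a + b)"
  unfolding fbounded_def by (meson \<eta>(1) add_mono fnorm_triangle order_trans)

lemma fbounded_minus: "fbounded \<eta> a \<Longrightarrow> fbounded \<eta> (- a)"
  by (simp add: fbounded_def)

lemma fbounded_mult: "fbounded \<eta> a \<Longrightarrow> fbounded \<eta> b \<Longrightarrow> fbounded \<eta> (a * b)"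
  unfolding fbounded_def by (meson \<eta>(1) mult_mono fnorm_mult fnorm_nonneg order_trans)

lemma fbounded_int:
  assumes "fbounded \<eta> a"
  shows "fbounded \<eta> (int_t a)" "fbounded \<eta> (int_dz a)"
proof -
  obtain C where C: "fnorm \<eta> k a \<le> C" for k using assms by (auto simp: fbounded_def)
  have "\<eta> * fnorm \<eta> k a \<le> \<eta> * C" for k using \<eta>(1) C[of k] by simp
  then show "fbounded \<eta> (int_t a)" "fbounded \<eta> (int_dz a)"
    using fnorm_int_t_le[OF \<eta>] fnorm_int_t_deriv_z[OF \<eta>(1)]
    unfolding fbounded_def int_dz_def by (meson order_trans)+
qed

lemma evals_add: "evals \<eta> t z a u \<Longrightarrow> evals \<eta> t z b v \<Longrightarrow> (t, z) \<in> square (\<eta>\<^sup>2 / 2) \<Longrightarrow> evals \<eta> t z (a + b) (u + v)"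
  using eval2_add[OF half_square] by (auto simp: evals_def fbounded_add fbounded_conv2)

lemma evals_mult: "evals \<eta> t z a u \<Longrightarrow> evals \<eta> t z b v \<Longrightarrow> (t, z) \<in> square (\<eta>\<^sup>2 / 2) \<Longrightarrow> evals \<eta> t z (a * b) (u * v)"
  using eval2_mult[OF half_square] by (auto simp: evals_def fbounded_mult fbounded_conv2)

lemma evals_uminus: "evals \<eta> t z a u \<Longrightarrow> (t, z) \<in> square (\<eta>\<^sup>2 / 2) \<Longrightarrow> evals \<eta> t z (- a) (- u)"
  using eval2_minus[OF half_square] by (auto simp: evals_def fbounded_minus fbounded_conv2)

lemma evals_diff: "evals \<eta> t z a u \<Longrightarrow> evals \<eta> t z b v \<Longrightarrow> (t, z) \<in> square (\<eta>\<^sup>2 / 2) \<Longrightarrow> evals \<eta> t z (a - b) (u - v)"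
  using evals_add[OF _ evals_uminus] by force

lemma evals_const2: "evals \<eta> t z (const2 c) c"
proof -
  have "slice (const2 c) z = fps_const c"
    by (rule fps_ext) (simp add: slice_def const2_def)
  then show ?thesis
    using fnorm_const2[OF \<eta>(1)] by (auto simp: evals_def eval2_def fbounded_def)
qed

lemma evals_var_t: "evals \<eta> t z var_t t"
proof -
  have "slice var_t z = fps_X"
    by (rule fps_ext) (simp add: slice_def var_t_def)
  then show ?thesis
    using fnorm_var_t[OF \<eta>(1)] by (auto simp: evals_def eval2_def fbounded_def)
qed

lemma evals_var_z: "evals \<eta> t z var_z z"
proof -
  have "slice var_z z = fps_const z"
    by (rule fps_ext) (simp add: slice_def var_z_def)
  then show ?thesis
    using fnorm_var_z[OF \<eta>(1)] by (auto simp: evals_def eval2_def fbounded_def)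
qed

lemma evals_one: "evals \<eta> t z 1 1" and evals_numeral: "evals \<eta> t z (numeral n) (numeral n)"
  using evals_const2[of t z 1] evals_const2[of t z "numeral n"]
  by (simp_all add: const2_1 const2_numeral)

lemma evals_power: "evals \<eta> t z a u \<Longrightarrow> (t, z) \<in> square (\<eta>\<^sup>2 / 2) \<Longrightarrow> evals \<eta> t z (a ^ n) (u ^ n)"
  by (induction n) (auto intro: evals_one evals_mult)

lemmas evals_intros = evals_add evals_diff evals_uminus evals_mult evals_power
  evals_one evals_numeral evals_const2 evals_var_t evals_var_z

end


text \<open>In the coordinates \<open>t = (x\<^sup>2 + y\<^sup>2 - 2) / 2\<close>, \<open>z = y - 1\<close> write \<open>\<phi> = F(t, z)\<close>, \<open>p = F\<^sub>t\<close>, \<open>q = F\<^sub>z\<close>, \<open>w = p\<^sub>t\<close>,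
  \<open>a = p\<^sub>z\<close>, \<open>b = q\<^sub>z\<close>, so that \<open>D\<phi> = (x p, y p + q)\<close>. With \<open>A = x\<^sup>2 + y\<^sup>2\<close> and \<open>Y = y\<close>, only even powers of
  \<open>x\<close> occur in \<open>c\<^sup>2 (\<Delta>\<phi> + 2) = |D\<phi>|\<^sup>2 + D\<phi> \<sqdot> D\<^sup>2\<phi> D\<phi>\<close>; replacing \<open>x\<^sup>2\<close> by \<open>A - Y\<^sup>2\<close>, the equation becomes
  \<open>w * poly_lead = poly_rest\<close>. The polynomials are evaluated both at power series and at reals.\<close>

definition poly_speed2 :: "'a::comm_ring_1 \<Rightarrow> 'a \<Rightarrow> 'a \<Rightarrow> 'a \<Rightarrow> 'a" where
  "poly_speed2 A Y p q = A * p ^ 2 + 2 * Y * p * q + q ^ 2"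

text \<open>With g = \<gamma> - 1, h = 1/2, S = |D\<phi>|^2 and E = K - \<phi> this is c^2. The
  numbers are parameters since the same polynomial is used over power series, where they become
  \<open>const2\<close> coefficients.\<close>

definition poly_sonic2 :: "'a::comm_ring_1 \<Rightarrow> 'a \<Rightarrow> 'a \<Rightarrow> 'a \<Rightarrow> 'a" where
  "poly_sonic2 g h S E = g * (E - h * S)"

text \<open>The principal symbol c^2 |\<nabla>t|^2 - (D\<phi> \<bullet> \<nabla>t)^2 in the
  direction \<nabla>t = (x, y); it vanishes where the circles t = const are characteristic.\<close>

definition poly_lead :: "'a::comm_ring_1 \<Rightarrow> 'a \<Rightarrow> 'a \<Rightarrow> 'a \<Rightarrow> 'a \<Rightarrow> 'a" where
  "poly_lead c2 A Y p q = c2 * A - (A * p + Y * q) ^ 2"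

definition poly_rest :: "'a::comm_ring_1 \<Rightarrow> 'a \<Rightarrow> 'a \<Rightarrow> 'a \<Rightarrow> 'a \<Rightarrow> 'a \<Rightarrow> 'a \<Rightarrow> 'a" where
  "poly_rest c2 A Y p q a b =
     - (c2 * (2 * p + 2 * Y * a + b + 2)) + poly_speed2 A Y p q + (A - Y ^ 2) * p ^ 3 +
     2 * p * (Y * p + q) * (A - Y ^ 2) * a + (Y * p + q) ^ 2 * (p + 2 * Y * a + b)"

text \<open>The data \<open>p = 0\<close>, \<open>F = K - q\<^sup>2 / kappa \<gamma>\<close> at \<open>t = 0\<close> make the whole arc sonic with \<open>D\<phi> = (0, q)\<close>; then \<open>q = F\<^sub>z\<close>
  leaves only \<open>q\<close> affine with slope \<open>- kappa \<gamma> / 2\<close>.\<close>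

lemma transonic_series:
  fixes \<gamma> K :: real
  assumes \<gamma>: "\<gamma> > 1"
  obtains \<rho> F p q w a b where "\<rho> > 0"
    "continuous_on (square \<rho>) w" "continuous_on (square \<rho>) a" "continuous_on (square \<rho>) b"
    "\<And>x. x \<in> square \<rho> \<Longrightarrow> (F has_derivative (\<lambda>h. fst h * p x + snd h * q x)) (at x)"
    "\<And>x. x \<in> square \<rho> \<Longrightarrow> (p has_derivative (\<lambda>h. fst h * w x + snd h * a x)) (at x)"
    "\<And>x. x \<in> square \<rho> \<Longrightarrow> (q has_derivative (\<lambda>h. fst h * a x + snd h * b x)) (at x)"
    "\<And>t z. (t, z) \<in> square \<rho> \<Longrightarrow>
       (let A = 2 + 2 * t; Y = 1 + z; p = p (t, z); q = q (t, z);
            c2 = poly_sonic2 (\<gamma> - 1) (1 / 2) (poly_speed2 A Y p q) (K - F (t, z))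
        in w (t, z) * poly_lead c2 A Y p q = poly_rest c2 A Y p q (a (t, z)) (b (t, z)))"
    "\<And>z. (0, z) \<in> square \<rho> \<Longrightarrow> p (0, z) = 0" "\<And>z. (0, z) \<in> square \<rho> \<Longrightarrow> a (0, z) = 0"
    "\<And>z. (0, z) \<in> square \<rho> \<Longrightarrow> q (0, z) = 1 - kappa \<gamma> / 2 * z"
    "\<And>z. (0, z) \<in> square \<rho> \<Longrightarrow> F (0, z) = K - (1 - kappa \<gamma> / 2 * z)\<^sup>2 / kappa \<gamma>"
proof -
  note kpos = kappa_pos[OF \<gamma>]
  define A :: fps2 where "A = 2 + 2 * var_t"
  define Y :: fps2 where "Y = 1 + var_z"
  define q0 :: fps2 where "q0 = 1 - const2 (kappa \<gamma> / 2) * var_z"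
  \<comment> \<open>All quantities as functions of w alone: p and a vanish at t = 0, q starts from
    \<open>q0\<close>, and b from the slope of \<open>q0\<close>. \<open>fE\<close> is K - F, the
    only combination in which F and K enter the equation.\<close>
  define fp :: "fps2 \<Rightarrow> fps2" where "fp = (\<lambda>w. int_t w)"
  define fa :: "fps2 \<Rightarrow> fps2" where "fa = (\<lambda>w. int_dz w)"
  define fq :: "fps2 \<Rightarrow> fps2" where "fq = (\<lambda>w. q0 + int_t (int_dz w))"
  define fb :: "fps2 \<Rightarrow> fps2" where "fb = (\<lambda>w. int_dz (int_dz w) - const2 (kappa \<gamma> / 2))"
  define fE :: "fps2 \<Rightarrow> fps2" where "fE = (\<lambda>w. const2 (1 / kappa \<gamma>) * q0 ^ 2 - int_t (int_t w))"
  define fc :: "fps2 \<Rightarrow> fps2" where "fc = (\<lambda>w. poly_sonic2 (const2 (\<gamma> - 1)) (const2 (1 / 2))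
      (poly_speed2 A Y (fp w) (fq w)) (fE w))"
  \<comment> \<open>\<open>w * lead = rest\<close> as a fixed point equation: at the origin \<open>lead = 1\<close> and \<open>rest = - 1\<close> whatever \<open>w\<close> is.\<close>
  define P :: "fps2 \<Rightarrow> fps2" where "P = (\<lambda>w. poly_rest (fc w) A Y (fp w) (fq w) (fa w) (fb w) -
      (poly_lead (fc w) A Y (fp w) (fq w) - 1) * w)"
  have small: "approx (\<lambda>w. int_t w) (\<lambda>_. 0)" "approx (\<lambda>w. int_dz w) (\<lambda>_. 0)"
      "approx (\<lambda>w. int_t (int_t w)) (\<lambda>_. 0)" "approx (\<lambda>w. int_t (int_dz w)) (\<lambda>_. 0)"
      "approx (\<lambda>w. int_dz (int_dz w)) (\<lambda>_. 0)"
    by (intro approx_int order_map_ident)+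
  \<comment> \<open>The right-hand side is \<open>P\<close> with variables and integrals replaced by
    0. It is left unsimplified so that its shape matches the rules.\<close>
  have "approx P (\<lambda>w.
      poly_rest (const2 (\<gamma> - 1) * (const2 (1 / kappa \<gamma>) * (1 - const2 (kappa \<gamma> / 2) * 0) ^ 2 - 0 - const2 (1 / 2)
        * poly_speed2 (2 + 2 * 0) (1 + 0) 0 ((1 - const2 (kappa \<gamma> / 2) * 0) + 0)))
        (2 + 2 * 0) (1 + 0) 0 ((1 - const2 (kappa \<gamma> / 2) * 0) + 0) 0 (0 - const2 (kappa \<gamma> / 2)) -
      (poly_lead (const2 (\<gamma> - 1) * (const2 (1 / kappa \<gamma>) * (1 - const2 (kappa \<gamma> / 2) * 0) ^ 2 - 0 - const2 (1 / 2)
        * poly_speed2 (2 + 2 * 0) (1 + 0) 0 ((1 - const2 (kappa \<gamma> / 2) * 0) + 0)))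
        (2 + 2 * 0) (1 + 0) 0 ((1 - const2 (kappa \<gamma> / 2) * 0) + 0) - 1) * w)"
    unfolding P_def fc_def fE_def fb_def fq_def fa_def fp_def q0_def A_def Y_def
      poly_rest_def poly_lead_def poly_sonic2_def poly_speed2_def
    by (intro approx_intros small approx_refl[OF order_map_ident])
  \<comment> \<open>The value of c^2 at the center is 1, equal to |D\<phi>|^2 = 1 there: this is the
    relation that defines \<kappa>.\<close>
  moreover have c2: "const2 (\<gamma> - 1) * (const2 (1 / kappa \<gamma>) - const2 (1 / 2)) = (1 :: fps2)"
  proof -
    have "(\<gamma> - 1) * (1 / kappa \<gamma> - 1 / 2) = 1" using \<gamma> by (simp add: kappa_def field_simps)
    then show ?thesis by (metis const2_ring const2_1 diff_conv_add_uminus)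
  qed
  \<comment> \<open>The slope -\<kappa>/2 of q enters \<open>poly_rest\<close> once with factor -c^2
    and once with factor q^2. Both squares are 1, so it cancels and -1 is left for every
    \<gamma>.\<close>
  moreover have "poly_speed2 2 1 0 1 = (1 :: fps2)" "poly_lead 1 2 1 0 1 = (1 :: fps2)"
      "poly_rest 1 2 1 0 1 0 (- const2 (kappa \<gamma> / 2)) = const2 (- 1)"
    by (simp_all add: poly_speed2_def poly_lead_def poly_rest_def const2_ring const2_1)
  ultimately have "approx P (\<lambda>w. const2 (- 1))" by simp
  then obtain \<eta> w where \<eta>: "0 < \<eta>" "\<eta> \<le> 1" and w: "P w = w" "\<And>k. fnorm \<eta> k w \<le> 2"
    using approx_fixed_point[of P "- 1"] by auto
  have wb: "fbounded \<eta> w" using w(2) by (auto simp: fbounded_def)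
  note fb_int = fbounded_int[OF \<eta>]
  let ?e = "\<lambda>f x. eval2 f (fst x) (snd x)"
  let ?ini = "\<lambda>x :: real \<times> real. 1 - kappa \<gamma> / 2 * snd x"
  have cont: "continuous_on (square (\<eta>\<^sup>2 / 2)) (?e f)" if "fbounded \<eta> f" for f
    using continuous_on_eval2[OF half_square[OF \<eta>] fbounded_conv2[OF \<eta> that]]
    by (simp add: case_prod_unfold)
  have der: "(?e (int_t f) has_derivative (\<lambda>h. fst h * ?e f x + snd h * ?e (int_dz f) x)) (at x)"
    if "fbounded \<eta> f" "x \<in> square (\<eta>\<^sup>2 / 2)" for f x
    using eval2_int_t_has_derivative[OF half_square[OF \<eta>] fbounded_conv2[OF \<eta> that(1)]
        fbounded_conv2[OF \<eta> fb_int(1)[OF that(1)]]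
        fbounded_conv2[OF \<eta> fb_int(2)[OF that(1), unfolded int_dz_def]] that(2)]
    by (simp add: case_prod_unfold int_dz_def)
  have dz_int: "int_dz (int_t f) = int_t (int_dz f)" for f
    by (simp add: int_dz_def deriv_z_int_t)
  show thesis
  proof (rule that[of "\<eta>\<^sup>2 / 2" "?e w" "?e (int_dz w)" "\<lambda>x. ?e (int_dz (int_dz w)) x - kappa \<gamma> / 2"
        "\<lambda>x. K - (?ini x)\<^sup>2 / kappa \<gamma> + ?e (int_t (int_t w)) x" "?e (int_t w)"
        "\<lambda>x. ?ini x + ?e (int_t (int_dz w)) x"])
    show "\<eta>\<^sup>2 / 2 > 0" using \<eta> by simp
    show "continuous_on (square (\<eta>\<^sup>2 / 2)) (?e w)" "continuous_on (square (\<eta>\<^sup>2 / 2)) (?e (int_dz w))"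
        "continuous_on (square (\<eta>\<^sup>2 / 2)) (\<lambda>x. ?e (int_dz (int_dz w)) x - kappa \<gamma> / 2)"
      by (intro continuous_intros cont fb_int wb)+
  next
    fix x assume x: "x \<in> square (\<eta>\<^sup>2 / 2)"
    show "(?e (int_t w) has_derivative (\<lambda>h. fst h * ?e w x + snd h * ?e (int_dz w) x)) (at x)"
      by (rule der[OF wb x])
    show "((\<lambda>x. ?ini x + ?e (int_t (int_dz w)) x) has_derivative
        (\<lambda>h. fst h * ?e (int_dz w) x + snd h * (?e (int_dz (int_dz w)) x - kappa \<gamma> / 2))) (at x)"
      by (rule derivative_eq_intros der[OF fb_int(2)[OF wb] x] refl)+ (simp add: algebra_simps)
    show "((\<lambda>x. K - (?ini x)\<^sup>2 / kappa \<gamma> + ?e (int_t (int_t w)) x) has_derivative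
        (\<lambda>h. fst h * ?e (int_t w) x + snd h * (?ini x + ?e (int_t (int_dz w)) x))) (at x)"
      using kpos
      by (auto intro!: derivative_eq_intros der[OF fb_int(1)[OF wb] x] simp: dz_int fun_eq_iff field_simps)
  next
    fix t z assume tz: "(t, z) \<in> square (\<eta>\<^sup>2 / 2)"
    let ?p = "eval2 (int_t w) t z" let ?a = "eval2 (int_dz w) t z"
    let ?q = "1 - kappa \<gamma> / 2 * z + eval2 (int_t (int_dz w)) t z"
    let ?b = "eval2 (int_dz (int_dz w)) t z - kappa \<gamma> / 2"
    let ?E = "1 / kappa \<gamma> * (1 - kappa \<gamma> / 2 * z) ^ 2 - eval2 (int_t (int_t w)) t z"
    let ?c = "poly_sonic2 (\<gamma> - 1) (1 / 2) (poly_speed2 (2 + 2 * t) (1 + z) ?p ?q) ?E"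
    have ev: "evals \<eta> t z f (eval2 f t z)" if "fbounded \<eta> f" for f
      using that by (simp add: evals_def)
    \<comment> \<open>Evaluation is a homomorphism on bounded series, so the fixed point identity
      becomes the equation for real values at (t, z).\<close>
    have "evals \<eta> t z (P w) (poly_rest ?c (2 + 2 * t) (1 + z) ?p ?q ?a ?b -
        (poly_lead ?c (2 + 2 * t) (1 + z) ?p ?q - 1) * eval2 w t z)"
      unfolding P_def fc_def fE_def fb_def fq_def fa_def fp_def q0_def A_def Y_def
        poly_rest_def poly_lead_def poly_sonic2_def poly_speed2_def
      by (intro evals_intros[OF \<eta>] tz ev fb_int wb)
    then have eq: "eval2 w t z = poly_rest ?c (2 + 2 * t) (1 + z) ?p ?q ?a ?b -
        (poly_lead ?c (2 + 2 * t) (1 + z) ?p ?q - 1) * eval2 w t z"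
      by (simp add: w(1) evals_def)
    have E: "K - (K - (1 - kappa \<gamma> / 2 * z)\<^sup>2 / kappa \<gamma> + eval2 (int_t (int_t w)) t z) = ?E" by simp
    have "eval2 w t z * poly_lead ?c (2 + 2 * t) (1 + z) ?p ?q =
        poly_rest ?c (2 + 2 * t) (1 + z) ?p ?q ?a ?b"
      using eq by (simp add: algebra_simps)
    then show "let A = 2 + 2 * t; Y = 1 + z; p = ?e (int_t w) (t, z);
          q = ?ini (t, z) + ?e (int_t (int_dz w)) (t, z);
          c2 = poly_sonic2 (\<gamma> - 1) (1 / 2) (poly_speed2 A Y p q)
            (K - (K - (?ini (t, z))\<^sup>2 / kappa \<gamma> + ?e (int_t (int_t w)) (t, z)))
        in ?e w (t, z) * poly_lead c2 A Y p q
          = poly_rest c2 A Y p q (?e (int_dz w) (t, z)) (?e (int_dz (int_dz w)) (t, z) - kappa \<gamma> / 2)"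
      unfolding Let_def fst_conv snd_conv E .
  next
    fix z
    show "?e (int_t w) (0, z) = 0" "?e (int_dz w) (0, z) = 0"
      "?ini (0, z) + ?e (int_t (int_dz w)) (0, z) = 1 - kappa \<gamma> / 2 * z"
      "K - (?ini (0, z))\<^sup>2 / kappa \<gamma> + ?e (int_t (int_t w)) (0, z) = K - (1 - kappa \<gamma> / 2 * z)\<^sup>2 / kappa \<gamma>"
      by (simp_all add: eval2_int_t_0 int_dz_def)
  qed
qed

section \<open>A transonic solution with a circular sonic arc\<close>

text \<open>Sends the circle of radius sqrt 2 to t = 0 and the point (1, 1) to the origin. The
  potential is a pull-back along this polynomial map, so no inverse has to be constructed.\<close>

definition straighten :: "plane \<Rightarrow> real \<times> real" where
  "straighten x = (((fst x)\<^sup>2 + (snd x)\<^sup>2 - 2) / 2, snd x - 1)"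

text \<open>A symmetric matrix written as a combination of three fixed operators, which makes it
  continuous in its entries without further argument.\<close>

definition sym_blinfun :: "real \<Rightarrow> real \<Rightarrow> real \<Rightarrow> plane \<Rightarrow>\<^sub>L plane" where
  "sym_blinfun c1 c2 c3 = c1 *\<^sub>R Blinfun (\<lambda>h. (fst h, 0)) + c2 *\<^sub>R Blinfun (\<lambda>h. (snd h, fst h))
     + c3 *\<^sub>R Blinfun (\<lambda>h. (0, snd h))"

lemma sym_blinfun_apply:
  "blinfun_apply (sym_blinfun c1 c2 c3) h = (c1 * fst h + c2 * snd h, c2 * fst h + c3 * snd h)"
proof -
  have "bounded_linear (\<lambda>h :: plane. (fst h, 0 :: real))" "bounded_linear (\<lambda>h :: plane. (snd h, fst h))"
    "bounded_linear (\<lambda>h :: plane. (0 :: real, snd h))"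
    by (auto intro!: bounded_linear_Pair bounded_linear_fst bounded_linear_snd bounded_linear_zero)
  then show ?thesis
    by (simp add: sym_blinfun_def blinfun.add_left blinfun.scaleR_left bounded_linear_Blinfun_apply)
qed

lemma has_derivative_straighten:
  "(straighten has_derivative (\<lambda>h. (fst x * fst h + snd x * snd h, snd h))) (at x)"
  unfolding straighten_def
  by (auto intro!: derivative_eq_intros simp: fun_eq_iff field_simps power2_eq_square)

lemma straighten_coords:
  "2 + 2 * fst (straighten x) = (fst x)\<^sup>2 + (snd x)\<^sup>2" "1 + snd (straighten x) = snd x"
  by (simp_all add: straighten_def field_simps)

lemma continuous_on_straighten: "continuous_on S straighten"
  unfolding straighten_def by (intro continuous_intros) auto

lemma partial_t:
  assumes "(G has_derivative (\<lambda>h. fst h * u + snd h * v)) (at (t, z))"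
  shows "((\<lambda>t. G (t, z)) has_real_derivative u) (at t)"
proof -
  have "((\<lambda>t. (t, z)) has_derivative (\<lambda>h. (h, 0))) (at t)"
    by (auto intro!: derivative_eq_intros)
  from has_derivative_compose[OF this assms] show ?thesis
    by (simp add: has_field_derivative_def mult_commute_abs)
qed

text \<open>The bound t < 6/5 keeps 2 - t^2 above 14/25, hence f \<ge> 1/2. The constant 18 is the
  resulting bound 2 + 16 for |f''| = 1/f + t^2/f^3.\<close>

lemma C11_arc: "C11_on 0 (6 / 5) (\<lambda>t. sqrt (2 - t\<^sup>2))"
  and deriv_arc: "0 < t \<Longrightarrow> t < 6 / 5 \<Longrightarrow> deriv (\<lambda>t. sqrt (2 - t\<^sup>2)) t = - t / sqrt (2 - t\<^sup>2)"
proof -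
  let ?f = "\<lambda>t :: real. sqrt (2 - t\<^sup>2)" and ?I = "{0<..<6 / 5 :: real}"
  have pos: "2 - t\<^sup>2 \<ge> 14 / 25" if "t \<in> ?I" for t
    using that power_mono[of t "6 / 5" 2] by (simp add: power2_eq_square)
  have d: "(?f has_real_derivative - t / ?f t) (at t)" if "t \<in> ?I" for t
    using pos[OF that] by (auto intro!: derivative_eq_intros simp: field_simps)
  then show "0 < t \<Longrightarrow> t < 6 / 5 \<Longrightarrow> deriv ?f t = - t / ?f t"
    by (intro DERIV_imp_deriv) auto
  have deriv: "deriv ?f t = - t / ?f t" if "t \<in> ?I" for t
    using d[OF that] by (rule DERIV_imp_deriv)
  have f_ge: "?f t \<ge> 1 / 2" if "t \<in> ?I" for t
    using pos[OF that] by (intro real_le_rsqrt) (simp add: power2_eq_square)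
  have lip: "18-lipschitz_on ?I (\<lambda>t. - t / ?f t)"
  proof (rule lipschitz_onI)
    fix s t assume st: "s \<in> ?I" "t \<in> ?I"
    have "norm (- s / ?f s - - t / ?f t) \<le> 18 * norm (s - t)"
    proof (rule differentiable_bound[of ?I "\<lambda>t. - t / ?f t" "\<lambda>t. (*) (- (1 / ?f t) - t\<^sup>2 / ?f t ^ 3)"])
      fix u assume u: "u \<in> ?I"
      have f0: "?f u > 0" using f_ge[OF u] by linarith
      have "((\<lambda>t. - t / ?f t) has_real_derivative (- 1 * ?f u - - u * (- u / ?f u)) / (?f u * ?f u)) (at u)"
        using f0 by (intro DERIV_divide d[OF u] DERIV_minus DERIV_ident) auto
      moreover have "(- 1 * ?f u - - u * (- u / ?f u)) / (?f u * ?f u) = - (1 / ?f u) - u\<^sup>2 / ?f u ^ 3"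
        using f0 by (simp add: field_simps power2_eq_square power3_eq_cube)
      ultimately show "((\<lambda>t. - t / ?f t) has_derivative (*) (- (1 / ?f u) - u\<^sup>2 / ?f u ^ 3)) (at u within ?I)"
        by (simp only: has_field_derivative_def has_derivative_at_withinI)
      have A: "1 / ?f u \<le> 2" using f_ge[OF u] f0 by (simp add: field_simps)
      have "u\<^sup>2 / ?f u ^ 3 \<le> 2 / (1 / 2) ^ 3"
        using f_ge[OF u] f0 pos[OF u] by (intro frac_le power_mono) auto
      also have "2 / (1 / 2) ^ 3 = (16 :: real)" by (simp add: power3_eq_cube)
      finally have B: "u\<^sup>2 / ?f u ^ 3 \<le> 16" .
      have "0 \<le> 1 / ?f u" "0 \<le> u\<^sup>2 / ?f u ^ 3" using f0 by auto
      then have "\<bar>- (1 / ?f u) - u\<^sup>2 / ?f u ^ 3\<bar> \<le> 18" using A B by linarith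
      then show "onorm ((*) (- (1 / ?f u) - u\<^sup>2 / ?f u ^ 3)) \<le> 18"
        by (intro onorm_le) (simp only: real_norm_def abs_mult mult_right_mono abs_ge_zero)
    qed (use st in auto)
    then show "dist (- s / ?f s) (- t / ?f t) \<le> 18 * dist s t" by (simp only: dist_norm)
  qed simp
  show "C11_on 0 (6 / 5) ?f"
    unfolding C11_on_def
  proof (intro conjI ballI)
    fix t assume t: "t \<in> ?I"
    show "?f differentiable at t" using d[OF t] by (auto simp: real_differentiable_def)
    have "18-lipschitz_on (?I \<inter> ball t 1) (deriv ?f)"
      using lipschitz_on_transform[OF lipschitz_on_subset[OF lip, of "?I \<inter> ball t 1"], of "deriv ?f"] deriv by auto
    then show "\<exists>\<epsilon>>0. \<exists>L. L-lipschitz_on (?I \<inter> ball t \<epsilon>) (deriv ?f)"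
      by (intro exI[of _ 1]) auto
  qed
qed

section \<open>The potential in the plane and its change of type\<close>

context
  fixes \<gamma> K \<rho> :: real and F p q w a b :: "real \<times> real \<Rightarrow> real"
  assumes \<gamma>: "\<gamma> > 1" and \<rho>: "\<rho> > 0"
    and cont: "continuous_on (square \<rho>) w" "continuous_on (square \<rho>) a" "continuous_on (square \<rho>) b"
    and dF: "\<And>x. x \<in> square \<rho> \<Longrightarrow> (F has_derivative (\<lambda>h. fst h * p x + snd h * q x)) (at x)"
    and dp: "\<And>x. x \<in> square \<rho> \<Longrightarrow> (p has_derivative (\<lambda>h. fst h * w x + snd h * a x)) (at x)"
    and dq: "\<And>x. x \<in> square \<rho> \<Longrightarrow> (q has_derivative (\<lambda>h. fst h * a x + snd h * b x)) (at x)"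
    and pde: "\<And>t z. (t, z) \<in> square \<rho> \<Longrightarrow>
       (let A = 2 + 2 * t; Y = 1 + z; p = p (t, z); q = q (t, z);
            c2 = poly_sonic2 (\<gamma> - 1) (1 / 2) (poly_speed2 A Y p q) (K - F (t, z))
        in w (t, z) * poly_lead c2 A Y p q = poly_rest c2 A Y p q (a (t, z)) (b (t, z)))"
    and p0: "\<And>z. (0, z) \<in> square \<rho> \<Longrightarrow> p (0, z) = 0" and a0: "\<And>z. (0, z) \<in> square \<rho> \<Longrightarrow> a (0, z) = 0"
    and q0: "\<And>z. (0, z) \<in> square \<rho> \<Longrightarrow> q (0, z) = 1 - kappa \<gamma> / 2 * z"
    and F0: "\<And>z. (0, z) \<in> square \<rho> \<Longrightarrow> F (0, z) = K - (1 - kappa \<gamma> / 2 * z)\<^sup>2 / kappa \<gamma>"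
begin

definition pot :: "plane \<Rightarrow> real" where "pot x = F (straighten x)"

definition grad :: "plane \<Rightarrow> plane" where
  "grad x = (fst x * p (straighten x), snd x * p (straighten x) + q (straighten x))"

definition hess :: "plane \<Rightarrow> plane \<Rightarrow>\<^sub>L plane" where
  "hess x = (let s = straighten x in sym_blinfun (p s + (fst x)\<^sup>2 * w s)
     (fst x * (snd x * w s + a s)) (p s + (snd x)\<^sup>2 * w s + 2 * snd x * a s + b s))"

definition dom :: "plane set" where "dom = straighten -` square \<rho>"

lemma cont': "continuous_on (square \<rho>) F" "continuous_on (square \<rho>) p" "continuous_on (square \<rho>) q"
  using dF dp dq
  by (meson continuous_at_imp_continuous_on has_derivative_continuous)+

lemma straighten_square: "x \<in> dom \<Longrightarrow> straighten x \<in> square \<rho>"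
  by (simp add: dom_def)

lemma pot_GDERIV:
  assumes "x \<in> dom"
  shows "GDERIV pot x :> grad x"
proof -
  have "(pot has_derivative (\<lambda>h. (fst x * fst h + snd x * snd h) * p (straighten x) + snd h * q (straighten x))) (at x)"
    using has_derivative_compose[OF has_derivative_straighten dF[OF straighten_square[OF assms]]]
    by (simp add: pot_def[abs_def])
  moreover have "(\<lambda>h. (fst x * fst h + snd x * snd h) * p (straighten x) + snd h * q (straighten x))
      = (\<lambda>h. h \<bullet> grad x)"
    by (simp add: grad_def inner_prod_def fun_eq_iff algebra_simps)
  ultimately show ?thesis by (simp add: gderiv_def)
qed

lemma grad_has_derivative:
  assumes "x \<in> dom"
  shows "(grad has_derivative blinfun_apply (hess x)) (at x)"
proof -
  let ?s = "straighten x"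
  have 1: "((\<lambda>x. p (straighten x)) has_derivative
      (\<lambda>h. (fst x * fst h + snd x * snd h) * w ?s + snd h * a ?s)) (at x)"
    using has_derivative_compose[OF has_derivative_straighten dp[OF straighten_square[OF assms]]] by simp
  have 2: "((\<lambda>x. q (straighten x)) has_derivative
      (\<lambda>h. (fst x * fst h + snd x * snd h) * a ?s + snd h * b ?s)) (at x)"
    using has_derivative_compose[OF has_derivative_straighten dq[OF straighten_square[OF assms]]] by simp
  have "((\<lambda>x. (fst x * p (straighten x), snd x * p (straighten x) + q (straighten x))) has_derivative
      (\<lambda>h. (fst x * ((fst x * fst h + snd x * snd h) * w ?s + snd h * a ?s) + fst h * p ?s,
        (snd x * ((fst x * fst h + snd x * snd h) * w ?s + snd h * a ?s) + snd h * p ?s) +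
        ((fst x * fst h + snd x * snd h) * a ?s + snd h * b ?s)))) (at x)"
    by (intro has_derivative_Pair has_derivative_add has_derivative_mult 1 2
        bounded_linear_imp_has_derivative bounded_linear_fst bounded_linear_snd)
  moreover have "(\<lambda>h. (fst x * ((fst x * fst h + snd x * snd h) * w ?s + snd h * a ?s) + fst h * p ?s,
        (snd x * ((fst x * fst h + snd x * snd h) * w ?s + snd h * a ?s) + snd h * p ?s) +
        ((fst x * fst h + snd x * snd h) * a ?s + snd h * b ?s))) = blinfun_apply (hess x)"
    by (simp add: hess_def Let_def sym_blinfun_apply fun_eq_iff algebra_simps power2_eq_square)
  ultimately show ?thesis by (simp add: grad_def[abs_def])
qed

lemma C2_upto_pot:
  assumes "open \<Omega>" "\<Omega> \<subseteq> S" "S \<subseteq> closure \<Omega>" "S \<subseteq> dom"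
  shows "C2_upto \<Omega> S pot grad"
proof -
  have c: "continuous_on S (\<lambda>x. G (straighten x))" if "continuous_on (square \<rho>) G" for G :: "_ \<Rightarrow> real"
    using assms(4) by (intro continuous_on_compose2[OF that continuous_on_straighten]) (auto simp: dom_def)
  have "continuous_on S pot" "continuous_on S grad" "continuous_on S hess"
    unfolding pot_def[abs_def] grad_def[abs_def] hess_def[abs_def] Let_def sym_blinfun_def
    by (intro continuous_intros c cont cont')+
  then show ?thesis
    unfolding C2_upto_def using assms pot_GDERIV grad_has_derivative by (intro conjI exI[of _ hess]) auto
qed

definition speed2 :: "real \<Rightarrow> real \<Rightarrow> real" where
  "speed2 t z = poly_speed2 (2 + 2 * t) (1 + z) (p (t, z)) (q (t, z))"

definition bern :: "real \<Rightarrow> real \<Rightarrow> real" where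
  "bern t z = K - F (t, z) - speed2 t z / 2"

lemma norm_grad: "(norm (grad x))\<^sup>2 = speed2 (fst (straighten x)) (snd (straighten x))"
proof -
  have "(norm (grad x))\<^sup>2 = (fst x * p (straighten x))\<^sup>2 + (snd x * p (straighten x) + q (straighten x))\<^sup>2"
    by (simp add: grad_def norm_Pair)
  also have "\<dots> = speed2 (fst (straighten x)) (snd (straighten x))"
    unfolding speed2_def straighten_coords prod.collapse poly_speed2_def
    by (simp add: power2_eq_square algebra_simps)
  finally show ?thesis .
qed

lemma head_pot: "head K pot grad x = bern (fst (straighten x)) (snd (straighten x))"
  by (simp add: head_def bern_def norm_grad pot_def)

text \<open>Undoes the substitution of A - Y^2 for x^2: with the pulled-back gradient and Hessian
  the polynomial equation is the non-divergence equation, which gives the divergence form where the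
  head is positive.\<close>

lemma potential_flow_pot:
  assumes "x \<in> dom" and pos: "bern (fst (straighten x)) (snd (straighten x)) > 0"
  shows "has_divergence (\<lambda>y. density \<gamma> K pot grad y *\<^sub>R grad y) (- 2 * density \<gamma> K pot grad x) x"
proof -
  have pos': "head K pot grad x > 0" using pos by (simp add: head_pot)
  obtain x1 x2 where x: "x = (x1, x2)" by (cases x)
  define s where "s = straighten x"
  have s: "s \<in> square \<rho>" using straighten_square[OF assms(1)] by (simp add: s_def)
  have fs: "2 + 2 * fst s = x1\<^sup>2 + x2\<^sup>2" "1 + snd s = x2" unfolding s_def straighten_coords by (simp_all add: x)
  define c2 where "c2 = (\<gamma> - 1) * head K pot grad x"
  have c2: "poly_sonic2 (\<gamma> - 1) (1 / 2) (poly_speed2 (2 + 2 * fst s) (1 + snd s) (p s) (q s)) (K - F s) = c2"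
    by (simp add: c2_def head_pot bern_def speed2_def poly_sonic2_def s_def[symmetric])
  have eq: "w s * poly_lead c2 (x1\<^sup>2 + x2\<^sup>2) x2 (p s) (q s) = poly_rest c2 (x1\<^sup>2 + x2\<^sup>2) x2 (p s) (q s) (a s) (b s)"
    using pde[of "fst s" "snd s"] s c2 unfolding Let_def prod.collapse fs by simp
  have tr: "(\<Sum>b\<in>Basis. hess x b \<bullet> b) = 2 * p s + (x1\<^sup>2 + x2\<^sup>2) * w s + 2 * x2 * a s + b s"
    by (simp add: Basis_prod_def sum.union_disjoint sum.reindex inner_prod_def hess_def Let_def
        sym_blinfun_apply x s_def[unfolded x, symmetric] algebra_simps)
  have gr: "grad x = (x1 * p s, x2 * p s + q s)" by (simp add: grad_def x s_def)
  have hs: "hess x h = ((p s + x1\<^sup>2 * w s) * fst h + x1 * (x2 * w s + a s) * snd h,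
      x1 * (x2 * w s + a s) * fst h + (p s + x2\<^sup>2 * w s + 2 * x2 * a s + b s) * snd h)" for h
    by (simp add: hess_def Let_def sym_blinfun_apply x s_def)
  have "c2 * ((\<Sum>b\<in>Basis. hess x b \<bullet> b) + 2) = grad x \<bullet> grad x + grad x \<bullet> hess x (grad x)"
    using eq unfolding tr unfolding hs gr poly_lead_def poly_rest_def poly_speed2_def
    by (simp add: inner_prod_def) algebra
  then show ?thesis
    using has_divergence_density_iff[OF \<gamma> pos' pot_GDERIV[OF assms(1)] grad_has_derivative[OF assms(1)]]
    by (simp add: c2_def)
qed

text \<open>This is |D\<phi>|^2 - c^2, whose sign decides the type; unlike the norms themselves it
  is differentiable without a square root.\<close>

definition mach :: "real \<Rightarrow> real \<Rightarrow> real" where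
  "mach t z = speed2 t z - (\<gamma> - 1) * bern t z"

definition speed2_t :: "real \<times> real \<Rightarrow> real" where
  "speed2_t x = 2 * (p x)\<^sup>2 + (2 + 2 * fst x) * (2 * p x * w x) +
     2 * (1 + snd x) * (w x * q x + p x * a x) + 2 * q x * a x"

definition mach_t :: "real \<times> real \<Rightarrow> real" where
  "mach_t x = (\<gamma> + 1) / 2 * speed2_t x + (\<gamma> - 1) * p x"

lemma mach_deriv:
  assumes "(t, z) \<in> square \<rho>"
  shows "((\<lambda>t. mach t z) has_real_derivative mach_t (t, z)) (at t)"
proof -
  note d = partial_t[OF dF[OF assms]] partial_t[OF dp[OF assms]] partial_t[OF dq[OF assms]]
  have d': "((\<lambda>t. speed2 t z) has_real_derivative speed2_t (t, z)) (at t)"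
    unfolding speed2_def poly_speed2_def speed2_t_def
    by (auto intro!: derivative_eq_intros d simp: algebra_simps power2_eq_square)
  show ?thesis
    unfolding mach_def bern_def mach_t_def
    by (auto intro!: derivative_eq_intros d d' simp: field_simps)
qed

text \<open>On t = 0 every term is a multiple of q^2, and the factors cancel by (\<gamma> + 1)/2 =
  (\<gamma> - 1)/\<kappa>. This is why K - F was prescribed as q^2/\<kappa>.\<close>

lemma mach_initial:
  assumes "(0, z) \<in> square \<rho>"
  shows "mach 0 z = 0"
proof -
  have "speed2 0 z = (1 - kappa \<gamma> / 2 * z)\<^sup>2"
    using assms by (simp add: speed2_def poly_speed2_def p0 q0)
  moreover have "S - (\<gamma> - 1) * (S / kappa \<gamma> - S / 2) = S * ((\<gamma> + 1) / 2 - (\<gamma> - 1) / kappa \<gamma>)" for S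
    using kappa_pos[OF \<gamma>] by (simp add: field_simps)
  ultimately have "mach 0 z = (1 - kappa \<gamma> / 2 * z)\<^sup>2 * ((\<gamma> + 1) / 2 - (\<gamma> - 1) / kappa \<gamma>)"
    using assms by (simp add: mach_def bern_def F0)
  moreover have "(\<gamma> + 1) / 2 - (\<gamma> - 1) / kappa \<gamma> = 0"
    using \<gamma> by (simp add: kappa_def field_simps)
  ultimately show ?thesis by simp
qed

text \<open>At the center p = a = 0 and q = c = 1, so the equation gives w = -1. Only 2wq survives
  in the t-derivative of |D\<phi>|^2, and \<open>mach_t\<close> becomes -(\<gamma> + 1).\<close>

lemma at_origin: "(0, 0) \<in> square \<rho>" "bern 0 0 > 0" "mach_t (0, 0) < 0" "q (0, 0) > 0"
proof -
  show 0: "(0, 0) \<in> square \<rho>" using \<rho> by (simp add: square_iff)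
  show "q (0, 0) > 0" using q0[OF 0] by simp
  have s: "speed2 0 0 = 1" using p0[OF 0] q0[OF 0] by (simp add: speed2_def poly_speed2_def)
  then have b1: "(\<gamma> - 1) * bern 0 0 = 1" using mach_initial[OF 0] by (simp add: mach_def)
  then show "bern 0 0 > 0" using \<gamma> by (metis diff_gt_0_iff_gt zero_less_mult_pos zero_less_one)
  have c2: "poly_sonic2 (\<gamma> - 1) (1 / 2) (poly_speed2 2 1 0 1) (K - F (0, 0)) = 1"
    using b1 s p0[OF 0] q0[OF 0] by (simp add: poly_sonic2_def bern_def speed2_def)
  have "w (0, 0) * poly_lead 1 2 1 0 1 = poly_rest 1 2 1 0 1 0 (b (0, 0))"
    using pde[OF 0] p0[OF 0] q0[OF 0] a0[OF 0] c2 by (simp add: Let_def)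
  then have "w (0, 0) = - 1"
    by (simp add: poly_lead_def poly_rest_def poly_speed2_def)
  then have "mach_t (0, 0) = - (\<gamma> + 1)"
    using p0[OF 0] q0[OF 0] a0[OF 0] by (simp add: mach_t_def speed2_t_def field_simps)
  then show "mach_t (0, 0) < 0" using \<gamma> by simp
qed

lemma small_square:
  obtains \<delta> where "0 < \<delta>" "\<delta> < \<rho>" "\<delta> \<le> 1 / 4"
    "\<And>t z. \<bar>t\<bar> \<le> \<delta> \<Longrightarrow> \<bar>z\<bar> \<le> \<delta> \<Longrightarrow> bern t z > 0 \<and> mach_t (t, z) < 0 \<and> q (t, z) > 0"
proof -
  have op: "open (square \<rho>)" by (auto simp: square_def intro: open_Times)
  have cb: "continuous_on (square \<rho>) (\<lambda>x. bern (fst x) (snd x))"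
    unfolding bern_def speed2_def poly_speed2_def prod.collapse by (intro continuous_intros cont') auto
  have cm: "continuous_on (square \<rho>) mach_t"
    unfolding mach_t_def[abs_def] speed2_t_def by (intro continuous_intros cont cont') auto
  have ev: "\<forall>\<^sub>F x in nhds (0, 0). (x \<in> square \<rho> \<and> bern (fst x) (snd x) > 0) \<and> mach_t x < 0 \<and> q x > 0"
  proof -
    have t: "(G \<longlongrightarrow> G (0, 0)) (nhds (0, 0))" if "continuous_on (square \<rho>) G" for G :: "_ \<Rightarrow> real"
      using that op at_origin(1) by (simp add: continuous_on_eq_continuous_at isCont_def tendsto_at_iff_tendsto_nhds)
    show ?thesis
      using eventually_nhds_in_open[OF op at_origin(1)] order_tendstoD(1)[OF t[OF cb], of 0]
        order_tendstoD(2)[OF t[OF cm], of 0] order_tendstoD(1)[OF t[OF cont'(3)], of 0] at_origin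
      by (simp add: eventually_conj_iff)
  qed
  then obtain e where e: "e > 0"
    "\<And>x. dist x (0, 0) < e \<Longrightarrow> (x \<in> square \<rho> \<and> bern (fst x) (snd x) > 0) \<and> mach_t x < 0 \<and> q x > 0"
    unfolding eventually_nhds_metric by blast
  show thesis
  \<comment> \<open>e/4 keeps |t| + |z| below e, \<rho>/2 keeps the closed square inside the domain,
    and 1/4 keeps y between 3/4 and 5/4.\<close>
  proof (rule that[of "min (min (e / 4) (\<rho> / 2)) (1 / 4)"])
    fix t z assume h: "\<bar>t\<bar> \<le> min (min (e / 4) (\<rho> / 2)) (1 / 4)" "\<bar>z\<bar> \<le> min (min (e / 4) (\<rho> / 2)) (1 / 4)"
    have "dist (t, z) (0, 0) \<le> \<bar>t\<bar> + \<bar>z\<bar>"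
      by (simp add: dist_norm norm_Pair sqrt_sum_squares_le_sum_abs)
    then have "dist (t, z) (0, 0) < e" using h e(1) by linarith
    from e(2)[OF this] show "bern t z > 0 \<and> mach_t (t, z) < 0 \<and> q (t, z) > 0" by simp
  qed (use e(1) \<rho> in auto)
qed


theorem transonic_arc_solution:
  "\<exists>N \<Gamma> \<phi> g. local_solution \<gamma> K N \<Gamma> \<phi> g \<and>
     (\<exists>z R. R > 0 \<and> \<Gamma> \<subseteq> sphere z R) \<and> (\<forall>Q\<in>\<Gamma>. \<not> exceptional \<Gamma> g Q)"
proof -
  obtain \<delta> where \<delta>: "0 < \<delta>" "\<delta> < \<rho>" "\<delta> \<le> 1 / 4"
    "\<And>t z. \<bar>t\<bar> \<le> \<delta> \<Longrightarrow> \<bar>z\<bar> \<le> \<delta> \<Longrightarrow> bern t z > 0 \<and> mach_t (t, z) < 0 \<and> q (t, z) > 0"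
    using small_square by metis
  \<comment> \<open>The condition x > 0 selects one of the two arcs over the same range of y, which
    keeps the sonic set connected.\<close>
  define N where "N = {x. fst x > 0 \<and> \<bar>fst (straighten x)\<bar> < \<delta> \<and> \<bar>snd (straighten x)\<bar> < \<delta>}"
  let ?\<Gamma> = "{x \<in> N. sonic \<gamma> K pot grad x}"
  let ?m = "{x \<in> N. supersonic \<gamma> K pot grad x}"
  let ?p = "{x \<in> N. subsonic \<gamma> K pot grad x}"
  let ?f = "\<lambda>t :: real. sqrt (2 - t\<^sup>2)"
  have cs: "continuous_on UNIV (\<lambda>x. fst (straighten x))" "continuous_on UNIV (\<lambda>x. snd (straighten x))"
    by (intro continuous_intros continuous_on_straighten)+
  have N_open: "open N"
    unfolding N_def by (intro open_Collect_conj open_Collect_less continuous_intros cs)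
  have N_closure: "closure N \<subseteq> dom"
  proof -
    have "closure N \<subseteq> {x. \<bar>fst (straighten x)\<bar> \<le> \<delta> \<and> \<bar>snd (straighten x)\<bar> \<le> \<delta>}"
      by (rule closure_minimal)
        (auto simp: N_def intro!: closed_Collect_conj closed_Collect_le continuous_intros cs)
    also have "\<dots> \<subseteq> dom" using \<delta>(2) by (auto simp: dom_def square_def mem_Times_iff)
    finally show ?thesis .
  qed
  then have N_dom: "N \<subseteq> dom" using closure_subset by blast
  have snd_N: "3 / 4 < snd x" "snd x < 5 / 4" if "x \<in> N" for x
    using that \<delta>(3) by (auto simp: N_def straighten_def)
  have bern_N: "head K pot grad x > 0" and q_N: "q (straighten x) > 0" if "x \<in> N" for x
    using that \<delta>(4)[of "fst (straighten x)" "snd (straighten x)"] by (auto simp: N_def head_pot)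
  \<comment> \<open>On each line z = const the function \<open>mach\<close> is strictly decreasing
    in t and vanishes at t = 0. The flow is therefore supersonic inside the circle, subsonic
    outside, and sonic on it only.\<close>
  have type_N: "subsonic \<gamma> K pot grad x \<longleftrightarrow> (fst x)\<^sup>2 + (snd x)\<^sup>2 > 2"
    "supersonic \<gamma> K pot grad x \<longleftrightarrow> (fst x)\<^sup>2 + (snd x)\<^sup>2 < 2"
    "sonic \<gamma> K pot grad x \<longleftrightarrow> (fst x)\<^sup>2 + (snd x)\<^sup>2 = 2" if x: "x \<in> N" for x
  proof -
    define t where "t = fst (straighten x)"
    define z where "z = snd (straighten x)"
    have tz: "\<bar>t\<bar> < \<delta>" "\<bar>z\<bar> < \<delta>" using x by (auto simp: N_def t_def z_def)
    have deriv: "\<exists>y. ((\<lambda>t. mach t z) has_real_derivative y) (at s) \<and> y < 0" if "\<bar>s\<bar> < \<delta>" for s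
      using mach_deriv[of s z] \<delta>(2) \<delta>(4)[of s z] that tz(2) by (auto simp: square_iff)
    have m0: "mach 0 z = 0" using mach_initial[of z] \<delta>(1,2) tz(2) by (simp add: square_iff)
    have neg: "mach t z < 0" if "t > 0"
      using DERIV_neg_imp_decreasing[OF that, of "\<lambda>t. mach t z"] deriv tz(1) m0 by force
    have pos: "mach t z > 0" if "t < 0"
      using DERIV_neg_imp_decreasing[OF that, of "\<lambda>t. mach t z"] deriv tz(1) m0 by force
    have m: "mach t z = (norm (grad x))\<^sup>2 - (sonic_speed \<gamma> K pot grad x)\<^sup>2"
      using bern_N[OF x] \<gamma> by (simp add: mach_def norm_grad head_pot sonic_speed_def t_def z_def)
    have c: "sonic_speed \<gamma> K pot grad x \<ge> 0" using bern_N[OF x] \<gamma> by (simp add: sonic_speed_def)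
    have sgn: "norm (grad x) < sonic_speed \<gamma> K pot grad x \<longleftrightarrow> mach t z < 0"
      "norm (grad x) > sonic_speed \<gamma> K pot grad x \<longleftrightarrow> mach t z > 0"
      "norm (grad x) = sonic_speed \<gamma> K pot grad x \<longleftrightarrow> mach t z = 0"
      unfolding m using c
      by (auto simp: abs_square_less_1 power2_eq_iff_nonneg power_strict_mono
          dest: power2_less_imp_less power_strict_mono[where n = 2])
    have "t = ((fst x)\<^sup>2 + (snd x)\<^sup>2 - 2) / 2" by (simp add: t_def straighten_def)
    then show "subsonic \<gamma> K pot grad x \<longleftrightarrow> (fst x)\<^sup>2 + (snd x)\<^sup>2 > 2"
      "supersonic \<gamma> K pot grad x \<longleftrightarrow> (fst x)\<^sup>2 + (snd x)\<^sup>2 < 2"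
      "sonic \<gamma> K pot grad x \<longleftrightarrow> (fst x)\<^sup>2 + (snd x)\<^sup>2 = 2"
      unfolding subsonic_def supersonic_def sonic_def sgn
      using neg pos m0 by (cases t "0 :: real" rule: linorder_cases; force)+
  qed
  have \<Gamma>_eq: "?\<Gamma> = {x \<in> N. (fst x)\<^sup>2 + (snd x)\<^sup>2 = 2}"
    and m_eq: "?m = {x \<in> N. (fst x)\<^sup>2 + (snd x)\<^sup>2 < 2}"
    and p_eq: "?p = {x \<in> N. (fst x)\<^sup>2 + (snd x)\<^sup>2 > 2}"
    using type_N by auto
  have open_mp: "open ?m" "open ?p"
    unfolding m_eq p_eq Collect_conj_eq[of "\<lambda>x. x \<in> N"] Collect_mem_eq
    by (intro open_Int N_open open_Collect_less continuous_intros)+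
  \<comment> \<open>From y > 3/4 follows x^2 < 23/16, which is just below 36/25. This is the origin
    of 6/5.\<close>
  have graph: "fst x < 6 / 5" "snd x = ?f (fst x)" if "x \<in> ?\<Gamma>" for x
  proof -
    have x: "x \<in> N" "(fst x)\<^sup>2 + (snd x)\<^sup>2 = 2" using that \<Gamma>_eq by auto
    have "(3 / 4)\<^sup>2 < (snd x)\<^sup>2" using snd_N[OF x(1)] by (intro power_strict_mono) auto
    then have "(fst x)\<^sup>2 < (6 / 5)\<^sup>2" using x(2) by (simp add: power2_eq_square)
    then show "fst x < 6 / 5" by (rule power2_less_imp_less) simp
    have "2 - (fst x)\<^sup>2 = (snd x)\<^sup>2" using x(2) by simp
    then show "snd x = ?f (fst x)" using snd_N[OF x(1)] by simp
  qed
  have local_ball: "\<exists>r>0. ball Q r \<subseteq> N \<inter> {x. fst x < 6 / 5}" if Q: "Q \<in> ?\<Gamma>" for Q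
  proof (rule openE)
    show "open (N \<inter> {x. fst x < 6 / 5})"
      by (intro open_Int N_open open_Collect_less continuous_intros)
    show "Q \<in> N \<inter> {x. fst x < 6 / 5}" using Q graph(1)[OF Q] by simp
  qed auto
  have rot0: "rot 0 x = x" for x by (simp add: rot_def)
  have chart: "curve_chart ?\<Gamma> Q 0 ?f 0 (6 / 5) r \<and> on_two_sides ?p ?m Q 0 ?f 0 (6 / 5) r"
    if Q: "Q \<in> ?\<Gamma>" and r: "r > 0" "ball Q r \<subseteq> N \<inter> {x. fst x < 6 / 5}" for Q r
  proof -
    have sq: "2 - t\<^sup>2 \<ge> 0" if "0 < t" "t < 6 / 5" for t :: real
      using that power_mono[of t "6 / 5" 2] by (simp add: power2_eq_square)
    have in_ball: "0 < fst x" "fst x < 6 / 5" "0 < snd x" "x \<in> N" if "x \<in> ball Q r" for x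
    proof -
      have x: "x \<in> N" "fst x < 6 / 5" using that r by auto
      then show "0 < fst x" "fst x < 6 / 5" "0 < snd x" "x \<in> N"
        using snd_N[OF x(1)] by (auto simp: N_def)
    qed
    have on: "snd x = ?f (fst x) \<longleftrightarrow> (fst x)\<^sup>2 + (snd x)\<^sup>2 = 2"
      "snd x < ?f (fst x) \<longleftrightarrow> (fst x)\<^sup>2 + (snd x)\<^sup>2 < 2"
      "?f (fst x) < snd x \<longleftrightarrow> (fst x)\<^sup>2 + (snd x)\<^sup>2 > 2" if "x \<in> ball Q r" for x
    proof -
      note b = in_ball[OF that]
      have f: "(?f (fst x))\<^sup>2 = 2 - (fst x)\<^sup>2" "?f (fst x) \<ge> 0" using sq[OF b(1,2)] by auto
      show "snd x = ?f (fst x) \<longleftrightarrow> (fst x)\<^sup>2 + (snd x)\<^sup>2 = 2"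
        using f b(3) power2_eq_iff_nonneg[of "snd x" "?f (fst x)"] by auto
      show "snd x < ?f (fst x) \<longleftrightarrow> (fst x)\<^sup>2 + (snd x)\<^sup>2 < 2"
        using f b(3) power_mono_iff[of "?f (fst x)" "snd x" 2] by auto
      show "?f (fst x) < snd x \<longleftrightarrow> (fst x)\<^sup>2 + (snd x)\<^sup>2 > 2"
        using f b(3) power_mono_iff[of "snd x" "?f (fst x)" 2] by auto
    qed
    have "?\<Gamma> \<inter> ball Q r = {(t, ?f t) |t. 0 < t \<and> t < 6 / 5} \<inter> ball Q r"
      unfolding \<Gamma>_eq using in_ball on(1) by (auto 4 3 simp: prod_eq_iff)
    moreover have "?p \<inter> ball Q r = {(t, s) |t s. 0 < t \<and> t < 6 / 5 \<and> ?f t < s} \<inter> ball Q r"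
      unfolding p_eq using in_ball on(3) by (auto 4 3 simp: prod_eq_iff)
    moreover have "?m \<inter> ball Q r = {(t, s) |t s. 0 < t \<and> t < 6 / 5 \<and> s < ?f t} \<inter> ball Q r"
      unfolding m_eq using in_ball on(2) by (auto 4 3 simp: prod_eq_iff)
    ultimately show ?thesis
      using r(1) C11_arc
      by (simp only: curve_chart_def on_two_sides_def above_graph_def below_graph_def rot0) simp
  qed
  \<comment> \<open>Moving a point of the arc upward increases x^2 + y^2 because y > 0, so it is a
    limit of subsonic points.\<close>
  have closure_p: "?p \<union> ?\<Gamma> \<subseteq> closure ?p"
  proof -
    have "Q \<in> closure ?p" if Q: "Q \<in> ?\<Gamma>" for Q
      unfolding closure_approachable
    proof (intro allI impI)
      fix e :: real assume e: "e > 0"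
      obtain r where r: "r > 0" "ball Q r \<subseteq> N" using local_ball[OF Q] by auto
      let ?d = "min e r / 2"
      have d: "?d > 0" "?d < e" "?d < r" using e r by auto
      define x where "x = Q + (0, ?d)"
      have dist: "dist x Q = ?d" using d by (simp add: x_def dist_norm norm_Pair)
      then have "x \<in> N" using r(2) d(3) by (auto simp: dist_commute)
      moreover have "(snd Q)\<^sup>2 < (snd x)\<^sup>2"
        using snd_N[of Q] Q d(1) by (intro power_strict_mono) (auto simp: x_def)
      then have "(fst x)\<^sup>2 + (snd x)\<^sup>2 > 2" using Q \<Gamma>_eq by (auto simp: x_def)
      moreover have "dist x Q < e" using d(2) by (simp only: dist)
      ultimately show "\<exists>y\<in>?p. dist y Q < e" unfolding p_eq by (intro bexI[of _ x]) auto
    qed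
    then show ?thesis using closure_subset[of ?p] by (intro Un_least subsetI) auto
  qed
  have flow: "potential_flow \<gamma> K \<Omega> pot grad" if "\<Omega> \<subseteq> N" for \<Omega>
    unfolding potential_flow_def
  proof (intro ballI conjI)
    fix x assume "x \<in> \<Omega>"
    then have x: "x \<in> N" "x \<in> dom" using that N_dom by auto
    show "0 \<le> head K pot grad x" using bern_N[OF x(1)] by simp
    show "has_divergence (\<lambda>y. density \<gamma> K pot grad y *\<^sub>R grad y) (- 2 * density \<gamma> K pot grad x) x"
      using bern_N[OF x(1)] by (intro potential_flow_pot x(2)) (simp add: head_pot)
  qed
  have conf: "sonic_configuration \<gamma> K ?m ?p ?\<Gamma> pot pot grad grad"
    unfolding sonic_configuration_def
  proof (intro conjI)
    show "C2_upto ?m (closure ?m) pot grad"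
      using N_closure closure_mono[of ?m N]
      by (intro C2_upto_pot open_mp closure_subset) auto
    show "C2_upto ?p (?p \<union> ?\<Gamma>) pot grad"
      using N_dom by (intro C2_upto_pot open_mp closure_p) auto
    show "\<forall>Q\<in>?\<Gamma>. \<exists>\<theta> f l1 l2 r. curve_chart ?\<Gamma> Q \<theta> f l1 l2 r \<and>
        (on_two_sides ?p ?m Q \<theta> f l1 l2 r \<or> on_two_sides ?m ?p Q \<theta> f l1 l2 r)"
      using chart local_ball by meson
  qed (auto simp: supersonic_def subsonic_def intro!: flow)
  \<comment> \<open>The arc is parametrized by y here, since \<open>N\<close> cuts it exactly at the
    heights 1 - \<delta> and 1 + \<delta>; the charts above use x.\<close>
  have \<Gamma>_image: "?\<Gamma> = (\<lambda>y. (sqrt (2 - y\<^sup>2), y)) ` {1 - \<delta><..<1 + \<delta>}"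
  proof (intro equalityI subsetI)
    fix x assume "x \<in> ?\<Gamma>"
    then have x: "x \<in> N" "(fst x)\<^sup>2 + (snd x)\<^sup>2 = 2" using \<Gamma>_eq by auto
    have "fst x = sqrt (2 - (snd x)\<^sup>2)"
      using x by (intro real_sqrt_unique[symmetric]) (auto simp: N_def)
    then show "x \<in> (\<lambda>y. (sqrt (2 - y\<^sup>2), y)) ` {1 - \<delta><..<1 + \<delta>}"
      using x(1) by (intro image_eqI[of _ _ "snd x"]) (auto simp: N_def straighten_def prod_eq_iff)
  next
    fix x assume "x \<in> (\<lambda>y. (sqrt (2 - y\<^sup>2), y)) ` {1 - \<delta><..<1 + \<delta>}"
    then obtain y where y: "x = (sqrt (2 - y\<^sup>2), y)" "1 - \<delta> < y" "y < 1 + \<delta>" by auto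
    have "y\<^sup>2 \<le> (5 / 4)\<^sup>2" using y \<delta>(3) by (intro power_mono) auto
    then have "2 - y\<^sup>2 > 0" by (simp add: power2_eq_square)
    then show "x \<in> ?\<Gamma>"
      unfolding \<Gamma>_eq using y \<delta>(1) by (auto simp: N_def straighten_def)
  qed
  have "connected ?\<Gamma>"
    unfolding \<Gamma>_image by (intro connected_continuous_image continuous_intros) auto
  moreover have "?\<Gamma> \<noteq> {}" unfolding \<Gamma>_image using \<delta>(1) by auto
  moreover have "C2_upto N N pot grad"
    using N_dom by (intro C2_upto_pot N_open closure_subset) auto
  ultimately have "local_solution \<gamma> K N ?\<Gamma> pot grad"
    unfolding local_solution_def using conf flow by auto
  moreover have "?\<Gamma> \<subseteq> sphere 0 (sqrt 2)"
    unfolding \<Gamma>_eq by (auto simp: norm_Pair)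
  \<comment> \<open>On the arc D\<phi> = (0, q) with q > 0, while the tangent is (1, -x/y). Their
    product -q x/y is nonzero because x > 0.\<close>
  moreover have "\<not> exceptional ?\<Gamma> grad Q" if Q: "Q \<in> ?\<Gamma>" for Q
  proof -
    obtain r where r: "r > 0" "ball Q r \<subseteq> N \<inter> {x. fst x < 6 / 5}" using local_ball[OF Q] by auto
    have QN: "Q \<in> N" "fst Q > 0" using Q by (auto simp: N_def)
    have "straighten Q = (0, snd Q - 1)"
      using Q \<Gamma>_eq by (auto simp: straighten_def)
    then have "p (straighten Q) = 0"
      using p0[of "snd Q - 1"] straighten_square[of Q] N_dom QN by auto
    then have g: "grad Q = (0, q (straighten Q))" by (simp add: grad_def)
    have "tangent 0 ?f Q = (1, - fst Q / snd Q)"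
      using deriv_arc[OF QN(2) graph(1)[OF Q]] graph(2)[OF Q] by (simp add: tangent_def rot0)
    then have "grad Q \<bullet> tangent 0 ?f Q \<noteq> 0"
      using q_N[OF QN(1)] QN snd_N[OF QN(1)] by (simp add: g inner_prod_def)
    then show ?thesis using exceptional_iff[OF conjunct1[OF chart[OF Q r]] Q] by simp
  qed
  ultimately show ?thesis
    by (intro exI[of _ N] exI[of _ ?\<Gamma>] exI[of _ pot] exI[of _ grad] exI[of _ 0] exI[of _ "sqrt 2"] conjI ballI) auto
qed

end

theorem theorem2p1:
  fixes \<gamma> K :: real
  assumes "\<gamma> > 1"
  shows
    "(\<forall>\<Omega>m \<Omega>p \<Gamma> \<phi>m \<phi>p gm gp.
        sonic_configuration \<gamma> K \<Omega>m \<Omega>p \<Gamma> \<phi>m \<phi>p gm gp \<and> connected \<Gamma> \<longrightarrow>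
        (\<forall>Q\<in>\<Gamma>. \<forall>\<theta> f l1 l2 r. curve_chart \<Gamma> Q \<theta> f l1 l2 r \<longrightarrow>
           (exceptional \<Gamma> gp Q \<longleftrightarrow>
              has_tangential_derivative \<theta> f (sonic_speed \<gamma> K \<phi>p gp) 0 Q \<or>
              sonic_speed \<gamma> K \<phi>p gp Q = 0)) \<and>
        ((\<forall>Q\<in>\<Gamma>. exceptional \<Gamma> gp Q \<and> sonic_speed \<gamma> K \<phi>p gp Q > 0) \<longrightarrow>
           (\<exists>c2>0. (\<forall>Q\<in>\<Gamma>. sonic_speed \<gamma> K \<phi>p gp Q = c2) \<and> (\<exists>z. \<Gamma> \<subseteq> sphere z c2)))) \<and>
     (\<exists>N \<Gamma> \<phi> g. local_solution \<gamma> K N \<Gamma> \<phi> g \<and>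
        (\<exists>z R. R > 0 \<and> \<Gamma> \<subseteq> sphere z R) \<and> (\<forall>Q\<in>\<Gamma>. \<not> exceptional \<Gamma> g Q))"
proof (intro conjI)
  show "\<exists>N \<Gamma> \<phi> g. local_solution \<gamma> K N \<Gamma> \<phi> g \<and>
      (\<exists>z R. R > 0 \<and> \<Gamma> \<subseteq> sphere z R) \<and> (\<forall>Q\<in>\<Gamma>. \<not> exceptional \<Gamma> g Q)"
  proof (rule transonic_series[OF assms, of K], goal_cases)
    case (1 \<rho> F p q w a b)
    show ?case by (rule transonic_arc_solution[OF assms 1])
  qed
qed (intro allI impI conjI ballI; elim conjE,
    rule exceptional_iff_tangential[OF assms] exceptional_curve_circle[OF assms]; blast)

end
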